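(* Let $\omega$ be a balanced metric on a compact complex manifold $X$ with $\dim_{\mathbb{C}}X=n\geq 2$. For any class $\mathfrak{c}\in H^2_{DR}(X,\mathbb{C})$, the following equivalence holds: $$\mathfrak{c}\ \text{is } \omega\text{-primitive}\iff \exists\,\alpha\in\mathfrak{c}\ \text{such that}\ \alpha\ \text{is } \omega\text{-primitive}.$$
   Context: A Hermitian metric is identified with its smooth positive definite $(1,1)$-form $\omega$; it is balanced if $d\omega^{n-1}=0$. Notation: $\omega_p:=\omega^p/p!$. A class $\mathfrak{c}=\{\beta\}_{DR}\in H^2_{DR}(X,\mathbb{C})$ is $\omega$-primitive if it lies in the kernel of the well-defined linear map $H^2_{DR}(X,\mathbb{C})\to H^{2n}_{DR}(X,\mathbb{C})$, $\{\beta\}_{DR}\mapsto\{\omega_{n-1}\wedge\beta\}_{DR}$. A smooth $2$-form $\alpha$ is $\omega$-primitive if $\omega_{n-1}\wedge\alpha=0$. Here $\alpha\in\mathfrak{c}$ means that $\alpha$ is a smooth $d$-closed $2$-form representing $\mathfrak{c}$. *)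

theory Defs
  imports "HOL-Analysis.Analysis" "HOL-Library.Function_Algebras"
begin

section \<open>Smooth and holomorphic maps on open sets\<close>

text \<open>
  \<open>Ck_on k S f\<close> is meant for open \<open>S\<close>: \<open>f\<close> is differentiable at every point of \<open>S\<close> and every
  directional derivative \<open>x \<mapsto> Df(x) v\<close> is of class \<open>C\<^sup>k\<^sup>-\<^sup>1\<close>.
\<close>

primrec Ck_on :: "nat \<Rightarrow> 'v::real_normed_vector set \<Rightarrow> ('v \<Rightarrow> 'w::real_normed_vector) \<Rightarrow> bool" where
  "Ck_on 0 S f \<longleftrightarrow> continuous_on S f"
| "Ck_on (Suc k) S f \<longleftrightarrow>
     (\<forall>x\<in>S. f differentiable (at x)) \<and> (\<forall>v. Ck_on k S (\<lambda>x. frechet_derivative f (at x) v))"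

definition smooth_on :: "'v::real_normed_vector set \<Rightarrow> ('v \<Rightarrow> 'w::real_normed_vector) \<Rightarrow> bool" where
  "smooth_on S f \<longleftrightarrow> (\<forall>k. Ck_on k S f)"

definition holomorphic_map_on ::
    "(complex ^ 'n) set \<Rightarrow> (complex ^ 'n \<Rightarrow> complex ^ 'm) \<Rightarrow> bool" where
  "holomorphic_map_on S f \<longleftrightarrow>
     (\<forall>x\<in>S. \<exists>f'. (f has_derivative f') (at x) \<and> (\<forall>z v. f' (z *s v) = z *s f' v))"


section \<open>Complex manifolds\<close>

text \<open>A chart is a pair of a domain \<open>U\<close> and a map \<open>\<phi>\<close>, of which only the values on \<open>U\<close> matter.
  The complex dimension is \<open>CARD('n)\<close>.\<close>

type_synonym ('a, 'n) chart = "'a set \<times> ('a \<Rightarrow> complex ^ 'n)"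

definition chart_image :: "('a, 'n) chart \<Rightarrow> (complex ^ 'n) set" where
  "chart_image c = snd c ` fst c"

definition chart_inv :: "('a, 'n) chart \<Rightarrow> complex ^ 'n \<Rightarrow> 'a" where
  "chart_inv c = inv_into (fst c) (snd c)"

definition overlap :: "('a, 'n) chart \<Rightarrow> ('a, 'n) chart \<Rightarrow> (complex ^ 'n) set" where
  "overlap c e = snd c ` (fst c \<inter> fst e)"

definition transition :: "('a, 'n) chart \<Rightarrow> ('a, 'n) chart \<Rightarrow> complex ^ 'n \<Rightarrow> complex ^ 'n" where
  "transition c e = snd e \<circ> chart_inv c"

definition complex_manifold :: "'a topology \<Rightarrow> ('a, 'n::finite) chart set \<Rightarrow> bool" where
  "complex_manifold X A \<longleftrightarrow>
     Hausdorff_space X \<and> second_countable X \<and>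
     (\<forall>c\<in>A. openin X (fst c) \<and> open (chart_image c) \<and>
        homeomorphic_map (subtopology X (fst c)) (top_of_set (chart_image c)) (snd c)) \<and>
     topspace X = (\<Union>c\<in>A. fst c) \<and>
     (\<forall>c\<in>A. \<forall>e\<in>A. holomorphic_map_on (overlap c e) (transition c e))"


section \<open>Alternating multilinear forms on a real vector space\<close>

text \<open>
  A complex-valued \<open>k\<close>-form takes its arguments as a sequence \<open>v\<close>, of which only
  \<open>v 0, \<dots>, v (k - 1)\<close> are relevant; equality of functions is thus equality of forms.
\<close>

type_synonym 'v form = "(nat \<Rightarrow> 'v) \<Rightarrow> complex"

definition alt_form :: "nat \<Rightarrow> 'v::real_vector form \<Rightarrow> bool" where
  "alt_form k a \<longleftrightarrow>
     (\<forall>v w. (\<forall>i<k. v i = w i) \<longrightarrow> a v = a w) \<and>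
     (\<forall>v. \<forall>i<k. linear (\<lambda>x. a (v(i := x)))) \<and>
     (\<forall>v. \<forall>i<k. \<forall>j<k. i \<noteq> j \<longrightarrow> v i = v j \<longrightarrow> a v = 0)"

text \<open>The wedge product of a \<open>p\<close>-form and a \<open>q\<close>-form, in the normalisation in which
  \<open>(a \<and> b)(v, w) = a(v) b(w) - a(w) b(v)\<close> for \<open>1\<close>-forms.\<close>

definition wedge :: "nat \<Rightarrow> nat \<Rightarrow> 'v form \<Rightarrow> 'v form \<Rightarrow> 'v form" where
  "wedge p q a b = (\<lambda>v.
     (\<Sum>\<sigma> | \<sigma> permutes {..<p + q}.
        of_int (sign \<sigma>) * a (\<lambda>i. v (\<sigma> i)) * b (\<lambda>i. v (\<sigma> (p + i)))) / (fact p * fact q))"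

definition pullback :: "('v \<Rightarrow> 'w) \<Rightarrow> 'w form \<Rightarrow> 'v form" where
  "pullback f a = (\<lambda>v. a (\<lambda>i. f (v i)))"

definition dz :: "'n \<Rightarrow> (complex ^ 'n) form" where
  "dz j = (\<lambda>v. v 0 $ j)"

definition dzbar :: "'n \<Rightarrow> (complex ^ 'n) form" where
  "dzbar j = (\<lambda>v. cnj (v 0 $ j))"

text \<open>The exterior derivative of a \<open>k\<close>-form on an open subset of a vector space:
  the sum over \<open>i \<le> k\<close> of \<open>(-1)^i\<close> times the derivative along \<open>v i\<close> of \<open>a\<close> evaluated on
  \<open>v 0, \<dots>, v k\<close> with \<open>v i\<close> omitted.\<close>

definition ext_deriv ::
    "nat \<Rightarrow> ('v::real_normed_vector \<Rightarrow> 'v form) \<Rightarrow> 'v \<Rightarrow> 'v form" where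
  "ext_deriv k a x = (\<lambda>v. \<Sum>i\<le>k. (-1) ^ i *
     frechet_derivative (\<lambda>y. a y (\<lambda>j. if j < i then v j else v (Suc j))) (at x) (v i))"


section \<open>Differential forms on a complex manifold\<close>

text \<open>
  A differential form is the family of its local expressions in the charts of the atlas,
  related by pullback along the transition maps. The families are set to \<open>0\<close> where they have no
  meaning, so that equality of families is equality of differential forms.
\<close>

type_synonym ('a, 'n) dform = "('a, 'n) chart \<Rightarrow> complex ^ 'n \<Rightarrow> (complex ^ 'n) form"

definition smooth_forms :: "('a, 'n::finite) chart set \<Rightarrow> nat \<Rightarrow> ('a, 'n) dform set" where
  "smooth_forms A k = {\<alpha>.
     (\<forall>c\<in>A. \<forall>x\<in>chart_image c. alt_form k (\<alpha> c x)) \<and>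
     (\<forall>c\<in>A. \<forall>v. smooth_on (chart_image c) (\<lambda>x. \<alpha> c x v)) \<and>
     (\<forall>c\<in>A. \<forall>e\<in>A. \<forall>x\<in>overlap c e.
        \<alpha> c x = pullback (frechet_derivative (transition c e) (at x)) (\<alpha> e (transition c e x))) \<and>
     (\<forall>c x. \<not> (c \<in> A \<and> x \<in> chart_image c) \<longrightarrow> \<alpha> c x = 0)}"

definition ext_d :: "('a, 'n::finite) chart set \<Rightarrow> nat \<Rightarrow> ('a, 'n) dform \<Rightarrow> ('a, 'n) dform" where
  "ext_d A k \<alpha> = (\<lambda>c x. if c \<in> A \<and> x \<in> chart_image c then ext_deriv k (\<alpha> c) x else 0)"

definition wedge_form ::
    "nat \<Rightarrow> nat \<Rightarrow> ('a, 'n) dform \<Rightarrow> ('a, 'n) dform \<Rightarrow> ('a, 'n) dform" where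
  "wedge_form p q \<alpha> \<beta> = (\<lambda>c x. wedge p q (\<alpha> c x) (\<beta> c x))"

text \<open>The power \<open>\<omega>^p\<close> of a \<open>2\<close>-form, and \<open>\<omega>\<^sub>p = \<omega>^p / p!\<close>; both have degree \<open>2 * p\<close>.\<close>

primrec form_power ::
    "('a, 'n::finite) chart set \<Rightarrow> ('a, 'n) dform \<Rightarrow> nat \<Rightarrow> ('a, 'n) dform" where
  "form_power A \<omega> 0 = (\<lambda>c x v. if c \<in> A \<and> x \<in> chart_image c then 1 else 0)"
| "form_power A \<omega> (Suc p) = wedge_form 2 (2 * p) \<omega> (form_power A \<omega> p)"

definition divided_power ::
    "('a, 'n::finite) chart set \<Rightarrow> ('a, 'n) dform \<Rightarrow> nat \<Rightarrow> ('a, 'n) dform" where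
  "divided_power A \<omega> p = (\<lambda>c x v. form_power A \<omega> p c x v / fact p)"


section \<open>De Rham cohomology with complex coefficients\<close>

definition closed_forms :: "('a, 'n::finite) chart set \<Rightarrow> nat \<Rightarrow> ('a, 'n) dform set" where
  "closed_forms A k = {\<alpha> \<in> smooth_forms A k. ext_d A k \<alpha> = 0}"

definition exact_forms :: "('a, 'n::finite) chart set \<Rightarrow> nat \<Rightarrow> ('a, 'n) dform set" where
  "exact_forms A k = (case k of 0 \<Rightarrow> {0} | Suc m \<Rightarrow> ext_d A m ` smooth_forms A m)"

definition de_Rham_rel ::
    "('a, 'n::finite) chart set \<Rightarrow> nat \<Rightarrow> (('a, 'n) dform \<times> ('a, 'n) dform) set" where
  "de_Rham_rel A k =
     {(\<alpha>, \<beta>). \<alpha> \<in> closed_forms A k \<and> \<beta> \<in> closed_forms A k \<and> \<alpha> - \<beta> \<in> exact_forms A k}"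

definition de_Rham_class ::
    "('a, 'n::finite) chart set \<Rightarrow> nat \<Rightarrow> ('a, 'n) dform \<Rightarrow> ('a, 'n) dform set" where
  "de_Rham_class A k \<alpha> = de_Rham_rel A k `` {\<alpha>}"

definition de_Rham :: "('a, 'n::finite) chart set \<Rightarrow> nat \<Rightarrow> ('a, 'n) dform set set" where
  "de_Rham A k = closed_forms A k // de_Rham_rel A k"


section \<open>Balanced metrics and primitivity\<close>

definition positive_definite_hermitian :: "complex ^ 'n ^ 'n \<Rightarrow> bool" where
  "positive_definite_hermitian h \<longleftrightarrow>
     (\<forall>j k. h $ j $ k = cnj (h $ k $ j)) \<and>
     (\<forall>v. v \<noteq> 0 \<longrightarrow> 0 < Re (\<Sum>j\<in>UNIV. \<Sum>k\<in>UNIV. h $ j $ k * v $ j * cnj (v $ k)))"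

text \<open>A Hermitian metric as a smooth positive definite \<open>(1,1)\<close>-form: in each chart it is
  \<open>\<i> \<Sum> h\<^sub>j\<^sub>k dz\<^sub>j \<and> d\<bar>z\<^sub>k\<close>. Smoothness of the coefficients \<open>h\<^sub>j\<^sub>k\<close> is that of \<open>\<omega>\<close>.\<close>

definition hermitian_metric :: "('a, 'n::finite) chart set \<Rightarrow> ('a, 'n) dform \<Rightarrow> bool" where
  "hermitian_metric A \<omega> \<longleftrightarrow>
     \<omega> \<in> smooth_forms A 2 \<and>
     (\<forall>c\<in>A. \<forall>x\<in>chart_image c. \<exists>h. positive_definite_hermitian h \<and>
        \<omega> c x = (\<lambda>v. \<Sum>j\<in>UNIV. \<Sum>k\<in>UNIV. \<i> * h $ j $ k * wedge 1 1 (dz j) (dzbar k) v))"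

definition balanced_metric :: "('a, 'n::finite) chart set \<Rightarrow> ('a, 'n) dform \<Rightarrow> bool" where
  "balanced_metric A \<omega> \<longleftrightarrow>
     hermitian_metric A \<omega> \<and> ext_d A (2 * (CARD('n) - 1)) (form_power A \<omega> (CARD('n) - 1)) = 0"

definition lefschetz ::
    "('a, 'n::finite) chart set \<Rightarrow> ('a, 'n) dform \<Rightarrow> ('a, 'n) dform \<Rightarrow> ('a, 'n) dform" where
  "lefschetz A \<omega> \<beta> =
     wedge_form (2 * (CARD('n) - 1)) 2 (divided_power A \<omega> (CARD('n) - 1)) \<beta>"

text \<open>The induced map from the second to the top cohomology. The union over all representatives
  is the usual lifting of a map to a quotient; for a balanced \<open>\<omega>\<close> all members of the union coincide.\<close>

definition lefschetz_class ::
    "('a, 'n::finite) chart set \<Rightarrow> ('a, 'n) dform \<Rightarrow> ('a, 'n) dform set \<Rightarrow> ('a, 'n) dform set" where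
  "lefschetz_class A \<omega> \<cc> = (\<Union>\<beta>\<in>\<cc>. de_Rham_class A (2 * CARD('n)) (lefschetz A \<omega> \<beta>))"

definition primitive_class ::
    "('a, 'n::finite) chart set \<Rightarrow> ('a, 'n) dform \<Rightarrow> ('a, 'n) dform set \<Rightarrow> bool" where
  "primitive_class A \<omega> \<cc> \<longleftrightarrow>
     \<cc> \<in> de_Rham A 2 \<and> lefschetz_class A \<omega> \<cc> = de_Rham_class A (2 * CARD('n)) 0"

definition primitive_form ::
    "('a, 'n::finite) chart set \<Rightarrow> ('a, 'n) dform \<Rightarrow> ('a, 'n) dform \<Rightarrow> bool" where
  "primitive_form A \<omega> \<alpha> \<longleftrightarrow> \<alpha> \<in> smooth_forms A 2 \<and> lefschetz A \<omega> \<alpha> = 0"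

end

theory Submission
  imports Defs "HOL-Complex_Analysis.Cauchy_Integral_Formula"
begin

text \<open>
  Write \<open>\<Omega> = \<omega>\<^sub>n\<^sub>-\<^sub>1\<close>. As \<open>\<Omega>\<close> is closed of even degree,
  \<open>\<Omega> \<and> d\<eta> = d(\<Omega> \<and> \<eta>)\<close> for every 1-form \<open>\<eta>\<close>. If \<open>\<beta>\<close> represents a primitive class, then
  \<open>-\<Omega> \<and> \<beta> = d\<zeta>\<close> for some form \<open>\<zeta>\<close> of degree \<open>2n - 1\<close>. At every point \<open>\<eta> \<mapsto> \<Omega> \<and> \<eta>\<close> is an
  isomorphism from 1-forms to \<open>(2n - 1)\<close>-forms, so \<open>\<zeta> = \<Omega> \<and> \<eta>\<close> for a smooth 1-form \<open>\<eta>\<close>, and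
  \<open>\<beta> + d\<eta>\<close> is a primitive representative. Conversely, the images under \<open>\<Omega> \<and> _\<close> of any two
  representatives of a class differ by an exact form.
\<close>

section \<open>Alternation over permutations\<close>

text \<open>Injectivity of the wedge with \<Omega> is seen by evaluation: a nonzero vector u0 is
  completed to a frame of pairs \<open>u k\<close>, \<open>\<i> *s u k\<close> and the single vector
  u0, in which \<omega> is block diagonal. On this frame the wedge of the power of \<omega> with a
  1-form \<open>a\<close> is a positive multiple of \<open>a\<close> at u0. Source and target have
  the same dimension 2n, so injectivity gives bijectivity, and Cramer's rule gives smoothness of the
  solution. A form is a family of chart expressions, so two compatibility questions arise. The local
  solutions glue because the solution is unique and the pullback of one solves the equation in the
  other chart. The derivative of a 1-form is compatible with transition maps because second
  derivatives are symmetric. Transition maps are only assumed to be complex differentiable at each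
  point, so the existence and continuity of their higher derivatives must be proved, by Cauchy
  estimates.\<close>

lemma sign_comp_permutes:
  assumes "finite S" "p permutes S" "q permutes S"
  shows "sign (p \<circ> q) = sign p * sign q"
  using assms by (simp add: sign_compose permutes_imp_permutation)

lemma of_int_sign_mult_self [simp]: "of_int (sign p) * (of_int (sign p) :: complex) = 1"
  "of_int (sign p) * (of_int (sign p) * (z :: complex)) = z"
  by (simp_all add: sign_def)

text \<open>Unnormalised antisymmetrisation. Wedge products, exterior derivatives and powers of a
  2-form are all rewritten as alternations, so that identities between them become reindexings of
  one sum, and the factorials are settled by \<open>alternation_absorb\<close>.\<close>

definition alternation :: "nat \<Rightarrow> 'v form \<Rightarrow> 'v form" where
  "alternation m F = (\<lambda>v. \<Sum>\<sigma> | \<sigma> permutes {..<m}. of_int (sign \<sigma>) * F (\<lambda>i. v (\<sigma> i)))"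

lemma alternation_cong:
  assumes "\<And>\<sigma>. \<sigma> permutes {..<m} \<Longrightarrow> F (\<lambda>i. v (\<sigma> i)) = G (\<lambda>i. v (\<sigma> i))"
  shows "alternation m F v = alternation m G v"
  unfolding alternation_def using assms by (intro sum.cong) auto

text \<open>Reindexing by right composition with \<tau>; the sign of \<tau> squares to 1 and can be
  moved to the other side.\<close>

lemma alternation_permute_inner:
  assumes "\<tau> permutes {..<m}"
  shows "alternation m (\<lambda>w. F (\<lambda>i. w (\<tau> i))) v = of_int (sign \<tau>) * alternation m F v"
proof -
  have "alternation m F v =
      (\<Sum>\<sigma> | \<sigma> permutes {..<m}. of_int (sign (\<sigma> \<circ> \<tau>)) * F (\<lambda>i. v ((\<sigma> \<circ> \<tau>) i)))"
    unfolding alternation_def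
    using sum_permutations_compose_right[OF assms, of "\<lambda>\<sigma>. of_int (sign \<sigma>) * F (\<lambda>i. v (\<sigma> i))"] by simp
  also have "\<dots> = (\<Sum>\<sigma> | \<sigma> permutes {..<m}. of_int (sign \<tau>) * (of_int (sign \<sigma>) * F (\<lambda>i. v (\<sigma> (\<tau> i)))))"
    by (intro sum.cong refl) (simp add: sign_comp_permutes[OF finite_lessThan _ assms] mult_ac)
  finally have "of_int (sign \<tau>) * alternation m F v = of_int (sign \<tau>) * (of_int (sign \<tau>) *
      (\<Sum>\<sigma> | \<sigma> permutes {..<m}. (of_int (sign \<sigma>) * F (\<lambda>i. v (\<sigma> (\<tau> i))))))"
    by (simp add: sum_distrib_left)
  then show ?thesis by (simp add: alternation_def)
qed

text \<open>Reindexing by left composition. This is the antisymmetry of an alternation in its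
  arguments, as demanded by \<open>alt_formI\<close>.\<close>

lemma alternation_permute_outer:
  assumes "\<tau> permutes {..<m}"
  shows "alternation m F (\<lambda>i. v (\<tau> i)) = of_int (sign \<tau>) * alternation m F v"
proof -
  have "alternation m F v =
      (\<Sum>\<sigma> | \<sigma> permutes {..<m}. of_int (sign (\<tau> \<circ> \<sigma>)) * F (\<lambda>i. v ((\<tau> \<circ> \<sigma>) i)))"
    unfolding alternation_def
    using setum_permutations_compose_left[OF assms, of "\<lambda>\<sigma>. of_int (sign \<sigma>) * F (\<lambda>i. v (\<sigma> i))"] by simp
  also have "\<dots> = (\<Sum>\<sigma> | \<sigma> permutes {..<m}. of_int (sign \<tau>) * (of_int (sign \<sigma>) * F (\<lambda>i. v (\<tau> (\<sigma> i)))))"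
    by (intro sum.cong refl) (simp add: sign_comp_permutes[OF finite_lessThan assms] mult_ac)
  finally have "of_int (sign \<tau>) * alternation m F v = of_int (sign \<tau>) * (of_int (sign \<tau>) *
      (\<Sum>\<sigma> | \<sigma> permutes {..<m}. (of_int (sign \<sigma>) * F (\<lambda>i. v (\<tau> (\<sigma> i))))))"
    by (simp add: sum_distrib_left)
  then show ?thesis by (simp add: alternation_def)
qed

lemma alternation_sum:
  "alternation m (\<lambda>w. \<Sum>a\<in>S. F a w) v = (\<Sum>a\<in>S. alternation m (F a) v)"
  unfolding alternation_def by (subst sum.swap) (simp add: sum_distrib_left)

lemma alternation_add:
  "alternation m (\<lambda>w. F w + G w) v = alternation m F v + alternation m G v"
  unfolding alternation_def by (simp add: sum.distrib algebra_simps)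

lemma alternation_scale:
  "alternation m (\<lambda>w. c * F w) v = c * alternation m F v"
  unfolding alternation_def by (simp add: sum_distrib_left mult_ac)

text \<open>An inner antisymmetrisation is redundant under an outer one: each of its
  \<open>fact q\<close> terms is a reindexing of the same sum, and the two signs cancel. This
  removes the factorials from nested wedge products.\<close>

lemma alternation_absorb:
  assumes "\<And>\<tau>. \<tau> permutes {..<q} \<Longrightarrow> \<rho> \<tau> permutes {..<m} \<and> sign (\<rho> \<tau>) = sign \<tau>"
  shows "alternation m (\<lambda>w. \<Sum>\<tau> | \<tau> permutes {..<q}. of_int (sign \<tau>) * F (\<lambda>i. w (\<rho> \<tau> i))) v
       = fact q * alternation m F v"
proof -
  have "alternation m (\<lambda>w. \<Sum>\<tau> | \<tau> permutes {..<q}. of_int (sign \<tau>) * F (\<lambda>i. w (\<rho> \<tau> i))) v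
     = (\<Sum>\<tau> | \<tau> permutes {..<q}. of_int (sign \<tau>) * alternation m (\<lambda>w. F (\<lambda>i. w (\<rho> \<tau> i))) v)"
    by (simp add: alternation_sum alternation_scale)
  also have "\<dots> = (\<Sum>\<tau> | \<tau> permutes {..<q}. alternation m F v)"
  proof (intro sum.cong refl)
    fix \<tau> :: "nat \<Rightarrow> nat" assume "\<tau> \<in> {\<tau>. \<tau> permutes {..<q}}"
    with assms have "\<rho> \<tau> permutes {..<m}" "sign (\<rho> \<tau>) = sign \<tau>" by auto
    then show "of_int (sign \<tau>) * alternation m (\<lambda>w. F (\<lambda>i. w (\<rho> \<tau> i))) v = alternation m F v"
      by (simp add: alternation_permute_inner)
  qed
  also have "\<dots> = fact q * alternation m F v"
    by (simp add: card_permutations[of _ q])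
  finally show ?thesis .
qed

text \<open>Embeds the permutations of q slots into those of p + q slots by acting on the last q of
  them.\<close>

definition shift_perm :: "nat \<Rightarrow> (nat \<Rightarrow> nat) \<Rightarrow> nat \<Rightarrow> nat" where
  "shift_perm p \<tau> = (\<lambda>i. if i < p then i else p + \<tau> (i - p))"

lemma shift_perm_add [simp]: "shift_perm p \<tau> (p + i) = p + \<tau> i"
  by (simp add: shift_perm_def)

lemma shift_perm_less [simp]: "i < p \<Longrightarrow> shift_perm p \<tau> i = i"
  by (simp add: shift_perm_def)

lemma shift_perm_transpose:
  "shift_perm p (Transposition.transpose a b \<circ> \<tau>) = Transposition.transpose (p + a) (p + b) \<circ> shift_perm p \<tau>"
  by (auto simp: fun_eq_iff shift_perm_def Transposition.transpose_def)

text \<open>Induction over transpositions, which the embedding turns into transpositions of the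
  shifted indices.\<close>

lemma shift_perm_permutes:
  assumes "\<tau> permutes {..<q}" "p + q = m"
  shows "shift_perm p \<tau> permutes {..<m} \<and> sign (shift_perm p \<tau>) = sign \<tau>"
  using assms(1) finite_lessThan[of q]
proof (induction \<tau> rule: permutes_induct)
  case id
  have "shift_perm p id = id" by (auto simp: fun_eq_iff shift_perm_def)
  then show ?case by (metis permutes_id sign_id)
next
  case (swap a b \<tau>)
  with assms(2) have IH: "shift_perm p \<tau> permutes {..<m}" "sign (shift_perm p \<tau>) = sign \<tau>" by auto
  have t: "Transposition.transpose (p + a) (p + b) permutes {..<m}" using swap assms(2) by (intro permutes_swap_id) auto
  have "sign (Transposition.transpose a b \<circ> \<tau>) = sign (Transposition.transpose a b) * sign \<tau>"
    using swap by (intro sign_comp_permutes[of "{..<q}"] permutes_swap_id) auto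
  moreover have "sign (Transposition.transpose (p + a) (p + b) \<circ> shift_perm p \<tau>)
      = sign (Transposition.transpose (p + a) (p + b)) * sign \<tau>"
    using IH t by (subst sign_comp_permutes[of "{..<m}"]) auto
  ultimately show ?case
    unfolding shift_perm_transpose using permutes_compose[OF IH(1) t] by (simp only: sign_swap_id) simp
qed

text \<open>The cycle on 0..b that brings argument b to the front and keeps the order of the others.
  It reproduces the omission pattern of \<open>ext_deriv\<close> and also moves one slot past p
  others in the Leibniz rule.\<close>

fun cycle_perm :: "nat \<Rightarrow> nat \<Rightarrow> nat" where
  "cycle_perm b 0 = b"
| "cycle_perm b (Suc j) = (if j < b then j else Suc j)"

text \<open>Passing from b to b + 1 composes with one adjacent transposition, hence the
  sign.\<close>

lemma cycle_perm_permutes: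
  assumes "b \<le> k"
  shows "cycle_perm b permutes {..<Suc k} \<and> sign (cycle_perm b) = (-1) ^ b"
  using assms
proof (induction b)
  case 0
  have "cycle_perm 0 = id"
  proof
    fix i show "cycle_perm 0 i = id i" by (cases i) auto
  qed
  then show ?case by (metis permutes_id sign_id power_0)
next
  case (Suc b)
  have *: "cycle_perm (Suc b) = Transposition.transpose b (Suc b) \<circ> cycle_perm b"
  proof
    fix i show "cycle_perm (Suc b) i = (Transposition.transpose b (Suc b) \<circ> cycle_perm b) i"
      by (cases i) (auto simp: Transposition.transpose_def)
  qed
  have t: "Transposition.transpose b (Suc b) permutes {..<Suc k}" using Suc.prems by (intro permutes_swap_id) auto
  have IH: "cycle_perm b permutes {..<Suc k}" "sign (cycle_perm b) = (-1) ^ b"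
    using Suc by auto
  show ?case unfolding * using permutes_compose[OF IH(1) t] sign_comp_permutes[OF _ t IH(1)] IH(2)
    by (simp only: finite_lessThan sign_swap_id) simp
qed

text \<open>Decomposition into cosets of the stabiliser of 0: by hypothesis all
  \<open>fact k\<close> terms of a coset agree, so one representative for each image b of 0 remains.
  This turns a full alternation into a signed sum of the shape of \<open>ext_deriv\<close>.\<close>

lemma alternation_Suc:
  assumes perm: "\<And>\<tau> w. \<tau> permutes {1..k} \<Longrightarrow> F (\<lambda>i. w (\<tau> i)) = of_int (sign \<tau>) * F w"
  shows "alternation (Suc k) F v = fact k * (\<Sum>b\<le>k. (-1) ^ b * F (\<lambda>i. v (cycle_perm b i)))"
proof -
  have ins: "{..<Suc k} = insert 0 {1..k}" by auto
  have fin: "finite {..<Suc k}" by simp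
  have sub: "q permutes {..<Suc k}" if "q permutes {1..k}" for q
    by (rule permutes_subset[OF that]) auto
  have tr: "Transposition.transpose 0 b permutes {..<Suc k}" if "b \<in> {..<Suc k}" for b
    using that by (intro permutes_swap_id) auto
  have "alternation (Suc k) F v = (\<Sum>b\<in>insert 0 {1..k}. \<Sum>q | q permutes {1..k}.
      of_int (sign (Transposition.transpose 0 b \<circ> q)) * F (\<lambda>i. v ((Transposition.transpose 0 b \<circ> q) i)))"
    unfolding alternation_def ins by (subst sum_over_permutations_insert) auto
  also have "\<dots> = (\<Sum>b\<in>insert 0 {1..k}. \<Sum>q | q permutes {1..k}.
      of_int (sign (Transposition.transpose 0 b)) * F (\<lambda>i. v (Transposition.transpose 0 b i)))"
  proof (intro sum.cong refl)
    fix b q assume b: "b \<in> insert 0 {1..k}" and q: "q \<in> {q. q permutes {1..k}}"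
    have "F (\<lambda>i. v ((Transposition.transpose 0 b \<circ> q) i)) = of_int (sign q) * F (\<lambda>i. v (Transposition.transpose 0 b i))"
      using perm[of q "\<lambda>i. v (Transposition.transpose 0 b i)"] q by (simp add: o_def)
    moreover have "sign (Transposition.transpose 0 b \<circ> q) = sign (Transposition.transpose 0 b) * sign q"
      using b q tr sub ins by (intro sign_comp_permutes[OF fin]) auto
    ultimately show "of_int (sign (Transposition.transpose 0 b \<circ> q)) * F (\<lambda>i. v ((Transposition.transpose 0 b \<circ> q) i)) =
        of_int (sign (Transposition.transpose 0 b)) * F (\<lambda>i. v (Transposition.transpose 0 b i))"
      by (simp add: mult.assoc)
  qed
  also have "\<dots> = (\<Sum>b\<in>{..<Suc k}. fact k * (of_int (sign (Transposition.transpose 0 b)) * F (\<lambda>i. v (Transposition.transpose 0 b i))))"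
    unfolding ins by (intro sum.cong refl) (simp add: card_permutations[of _ k])
  also have "\<dots> = (\<Sum>b\<in>{..<Suc k}. fact k * ((-1) ^ b * F (\<lambda>i. v (cycle_perm b i))))"
  proof (intro sum.cong refl)
    fix b assume b: "b \<in> {..<Suc k}"
    \<comment> \<open>So far the coset representatives are the transpositions of 0 and b; q is the
      element of the stabiliser of 0 by which they differ from the cycles.\<close>
    define q where "q = inv (Transposition.transpose 0 b) \<circ> cycle_perm b"
    have c: "cycle_perm b permutes {..<Suc k}" "sign (cycle_perm b) = (-1) ^ b"
      using cycle_perm_permutes[of b k] b by auto
    have qp: "q permutes {..<Suc k}"
      unfolding q_def using c tr[OF b] by (intro permutes_compose permutes_inv)
    have q0: "q 0 = 0" unfolding q_def by simp
    have q1: "q permutes {1..k}"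
      by (rule permutes_superset[OF qp]) (use q0 in \<open>auto simp: not_le\<close>)
    have cq: "cycle_perm b = Transposition.transpose 0 b \<circ> q"
      unfolding q_def by (simp add: o_assoc[symmetric] fun_eq_iff)
    have "sign (cycle_perm b) = sign (Transposition.transpose 0 b) * sign q"
      unfolding cq using b tr qp by (intro sign_comp_permutes[OF fin]) auto
    moreover have "F (\<lambda>i. v (cycle_perm b i)) = of_int (sign q) * F (\<lambda>i. v (Transposition.transpose 0 b i))"
      unfolding cq using perm[OF q1, of "\<lambda>i. v (Transposition.transpose 0 b i)"] by (simp add: o_def)
    ultimately have "of_int (sign (cycle_perm b)) * F (\<lambda>i. v (cycle_perm b i))
      = of_int (sign (Transposition.transpose 0 b)) * F (\<lambda>i. v (Transposition.transpose 0 b i))"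
      by (simp add: mult.assoc)
    then show "fact k * (of_int (sign (Transposition.transpose 0 b)) * F (\<lambda>i. v (Transposition.transpose 0 b i))) =
        fact k * ((-1) ^ b * F (\<lambda>i. v (cycle_perm b i)))"
      using c by simp
  qed
  finally show ?thesis by (simp add: sum_distrib_left lessThan_Suc_atMost)
qed


section \<open>Wedge products and the Leibniz rule\<close>

lemma wedge_alternation:
  "wedge p q a b v = alternation (p + q) (\<lambda>w. a w * b (\<lambda>i. w (p + i))) v / (fact p * fact q)"
  by (simp add: wedge_def alternation_def mult.assoc)

lemma alt_form_cong:
  "alt_form k a \<Longrightarrow> (\<And>i. i < k \<Longrightarrow> v i = w i) \<Longrightarrow> a v = a w"
  unfolding alt_form_def by (elim conjE) simp

lemma alt_form_linear: "alt_form k a \<Longrightarrow> i < k \<Longrightarrow> linear (\<lambda>x. a (v(i := x)))"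
  by (simp add: alt_form_def)

lemma alt_form_repeat:
  "alt_form k a \<Longrightarrow> i < k \<Longrightarrow> j < k \<Longrightarrow> i \<noteq> j \<Longrightarrow> v i = v j \<Longrightarrow> a v = 0"
  by (simp add: alt_form_def)

text \<open>Polarisation: expand the zero obtained by putting \<open>v i + v j\<close> into both
  slots.\<close>

lemma alt_form_transpose:
  assumes a: "alt_form k a" and ij: "i < k" "j < k" "i \<noteq> j"
  shows "a (\<lambda>l. v (Transposition.transpose i j l)) = - a v"
proof -
  let ?f = "\<lambda>x y. a ((v(i := x))(j := y))"
  have l2: "linear (\<lambda>y. ?f x y)" for x using alt_form_linear[OF a ij(2)] .
  have l1: "linear (\<lambda>x. ?f x y)" for y
    using alt_form_linear[OF a ij(1), of "v(j := y)"] ij(3) by (simp add: fun_upd_twist)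
  have z: "?f x x = 0" for x by (rule alt_form_repeat[OF a ij]) (use ij in auto)
  have z': "a (v(j := v i)) = 0" using z[of "v i"] by simp
  have "0 = ?f (v i + v j) (v i + v j)" using z by simp
  also have "\<dots> = ?f (v i) (v i) + ?f (v i) (v j) + (?f (v j) (v i) + ?f (v j) (v j))"
    unfolding linear_add[OF l1] linear_add[OF l2] by simp
  also have "\<dots> = ?f (v i) (v j) + ?f (v j) (v i)" using z z' by simp
  also have "(v(i := v i))(j := v j) = v" by auto
  also have "(v(i := v j))(j := v i) = (\<lambda>l. v (Transposition.transpose i j l))"
    using ij(3) by (auto simp: Transposition.transpose_def)
  finally show ?thesis by (simp add: add_eq_0_iff)
qed

lemma alt_form_permute:
  assumes a: "alt_form k a" and "\<tau> permutes {..<k}"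
  shows "a (\<lambda>l. v (\<tau> l)) = of_int (sign \<tau>) * a v"
  using assms(2) finite_lessThan
proof (induction \<tau> arbitrary: v rule: permutes_induct)
  case id
  then show ?case by (simp only: id_apply sign_id) simp
next
  case (swap i j p)
  have "sign (Transposition.transpose i j \<circ> p) = - sign p"
    using sign_comp_permutes[OF finite_lessThan permutes_swap_id swap.hyps(4), of i j] swap.hyps
    by (simp only: sign_swap_id) simp
  moreover have "a (\<lambda>l. v ((Transposition.transpose i j \<circ> p) l)) = - (of_int (sign p) * a v)"
    using swap.IH[of "\<lambda>l. v (Transposition.transpose i j l)"] alt_form_transpose[OF a, of i j v] swap.hyps
    by simp
  ultimately show ?case by (simp only:) simp
qed

text \<open>Antisymmetry suffices for vanishing on repeated arguments, since transposing equal
  arguments gives \<open>a v = - a v\<close>. Alternations satisfy the permutation condition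
  directly.\<close>

lemma alt_formI:
  assumes cong: "\<And>v w. (\<And>i. i < k \<Longrightarrow> v i = w i) \<Longrightarrow> a v = a w"
    and lin: "\<And>v i. i < k \<Longrightarrow> linear (\<lambda>x. a (v(i := x)))"
    and perm: "\<And>v \<tau>. \<tau> permutes {..<k} \<Longrightarrow> a (\<lambda>l. v (\<tau> l)) = of_int (sign \<tau>) * a v"
  shows "alt_form k a"
  unfolding alt_form_def
proof (intro conjI allI impI)
  fix v i j assume ij: "i < k" "j < k" "i \<noteq> j" "v i = (v j :: 'a)"
  have "(\<lambda>l. v (Transposition.transpose i j l)) = v"
    using ij by (auto simp: Transposition.transpose_def)
  then show "a v = 0"
    using perm[OF permutes_swap_id[of i "{..<k}" j], of v] ij by (simp add: sign_swap_id)
next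
  fix v w assume "\<forall>i<k. v i = (w i :: 'a)"
  then show "a v = a w" by (intro cong) simp
next
  fix v i assume "i < k"
  then show "linear (\<lambda>x. a (v(i := x)))" by (rule lin)
qed

lemma linear_cmult:
  fixes f :: "'v::real_vector \<Rightarrow> complex"
  shows "linear f \<Longrightarrow> linear (\<lambda>x. c * f x)"
  using linear_compose[OF _ bounded_linear.linear[OF bounded_linear_mult_right]] by (simp add: o_def)

lemma alt_form_wedge:
  fixes a b :: "'v::real_vector form"
  assumes a: "alt_form p a" and b: "alt_form q b"
  shows "alt_form (p + q) (wedge p q a b)"
proof (rule alt_formI)
  fix v w :: "nat \<Rightarrow> 'v" assume *: "\<And>i. i < p + q \<Longrightarrow> v i = w i"
  show "wedge p q a b v = wedge p q a b w"
    unfolding wedge_def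
  proof (intro arg_cong2[where f = "(/)"] sum.cong refl arg_cong2[where f = "(*)"])
    fix \<sigma> :: "nat \<Rightarrow> nat" assume "\<sigma> \<in> {\<sigma>. \<sigma> permutes {..<p + q}}"
    then have **: "v (\<sigma> i) = w (\<sigma> i)" if "i < p + q" for i
      using * that permutes_in_image[of \<sigma> "{..<p + q}" i] by simp
    show "a (\<lambda>i. v (\<sigma> i)) = a (\<lambda>i. w (\<sigma> i))" by (rule alt_form_cong[OF a]) (simp add: **)
    show "b (\<lambda>i. v (\<sigma> (p + i))) = b (\<lambda>i. w (\<sigma> (p + i)))" by (rule alt_form_cong[OF b]) (simp add: **)
  qed
next
  fix v :: "nat \<Rightarrow> 'v" and i assume i: "i < p + q"
  have "linear (\<lambda>x. a (\<lambda>l. (v(i := x)) (\<sigma> l)) * b (\<lambda>l. (v(i := x)) (\<sigma> (p + l))))"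
    if "\<sigma> permutes {..<p + q}" for \<sigma>
  proof -
    \<comment> \<open>In the summand of \<sigma>, argument i enters at the single position j, which
      belongs to \<open>a\<close> if j < p and to \<open>b\<close> otherwise; the other factor does
      not depend on x.\<close>
    define j where "j = inv \<sigma> i"
    define u where "u = (\<lambda>l. v (\<sigma> l))"
    have sj: "\<sigma> l = i \<longleftrightarrow> l = j" for l
      unfolding j_def using that by (metis permutes_inv_eq)
    have j: "j < p + q" using that i permutes_in_image[OF that, of j] sj[of j] by auto
    have eq: "(v(i := x)) (\<sigma> l) = (u(j := x)) l" for x l
      using sj by (auto simp: u_def)
    show ?thesis
    proof (cases "j < p")
      case True
      have "b (\<lambda>l. (u(j := x)) (p + l)) = b (\<lambda>l. u (p + l))" for x
        using True by (intro arg_cong[of _ _ b]) auto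
      then show ?thesis unfolding eq using linear_compose[OF alt_form_linear[OF a True, of u]
          bounded_linear.linear[OF bounded_linear_mult_left[of "b (\<lambda>l. u (p + l))"]]] by (simp add: o_def fun_upd_def)
    next
      case False
      have "a (u(j := x)) = a u" for x
        by (rule alt_form_cong[OF a]) (use False in auto)
      moreover have "(\<lambda>l. (u(j := x)) (p + l)) = (\<lambda>l. u (p + l))(j - p := x)" for x
        by (rule ext) (use False in auto)
      moreover have "j - p < q" using False j by auto
      ultimately show ?thesis unfolding eq using linear_compose[OF alt_form_linear[OF b, of "j - p" "\<lambda>l. u (p + l)"]
          bounded_linear.linear[OF bounded_linear_mult_right[of "a u"]]] by (simp add: o_def fun_upd_def)
    qed
  qed
  then have "linear (\<lambda>x. (1 / (fact p * fact q) :: complex) * (\<Sum>\<sigma> | \<sigma> permutes {..<p + q}. of_int (sign \<sigma>) *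
      (a (\<lambda>l. (v(i := x)) (\<sigma> l)) * b (\<lambda>l. (v(i := x)) (\<sigma> (p + l))))))"
    by (intro linear_cmult linear_compose_sum ballI) simp
  then show "linear (\<lambda>x. wedge p q a b (v(i := x)))"
    by (simp add: wedge_def mult.assoc)
next
  fix v :: "nat \<Rightarrow> 'v" and \<tau> assume "\<tau> permutes {..<p + q}"
  then show "wedge p q a b (\<lambda>l. v (\<tau> l)) = of_int (sign \<tau>) * wedge p q a b v"
    unfolding wedge_alternation by (simp add: alternation_permute_outer)
qed

text \<open>Slot 0 is reserved for the direction of differentiation, so the arguments of the form
  are shifted by one and moved by permutations of 1..k.\<close>

lemma alt_form_permute_Suc:
  assumes a: "alt_form k a" and "\<tau> permutes {1..k}"
  shows "a (\<lambda>l. v (\<tau> (Suc l))) = of_int (sign \<tau>) * a (\<lambda>l. v (Suc l))"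
  using assms(2) finite_atLeastAtMost
proof (induction \<tau> arbitrary: v rule: permutes_induct)
  case id
  then show ?case by (simp only: id_apply sign_id) simp
next
  case (swap i j p)
  have "sign (Transposition.transpose i j \<circ> p) = - sign p"
    using sign_comp_permutes[OF finite_atLeastAtMost permutes_swap_id swap.hyps(4), of i j] swap.hyps
    by (simp only: sign_swap_id) simp
  moreover obtain i' j' where ij: "i = Suc i'" "j = Suc j'"
    using swap.hyps by (metis One_nat_def Suc_le_D atLeastAtMost_iff)
  have "Transposition.transpose i j (Suc l) = Suc (Transposition.transpose i' j' l)" for l
    unfolding ij by (auto simp: Transposition.transpose_def)
  then have "a (\<lambda>l. v ((Transposition.transpose i j \<circ> p) (Suc l))) = - (of_int (sign p) * a (\<lambda>l. v (Suc l)))"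
    using swap.IH[of "\<lambda>l. v (Transposition.transpose i j l)"]
      alt_form_transpose[OF a, of i' j' "\<lambda>l. v (Suc l)"] swap.hyps ij
    by simp
  ultimately show ?case by (simp only:) simp
qed

lemma frechet_derivative_eqI: "(f has_derivative f') (at x) \<Longrightarrow> frechet_derivative f (at x) = f'"
  using frechet_derivative_at by metis

lemma has_derivative_frechet:
  "f differentiable (at x) \<Longrightarrow> (f has_derivative frechet_derivative f (at x)) (at x)"
  by (simp add: frechet_derivative_works[symmetric])

lemma frechet_derivative_cong_open:
  assumes "f differentiable (at x)" "open S" "x \<in> S" "\<And>y. y \<in> S \<Longrightarrow> f y = g y"
  shows "frechet_derivative g (at x) = frechet_derivative f (at x)"
  by (intro frechet_derivative_eqI has_derivative_transform_within_open[OF has_derivative_frechet])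
    (use assms in auto)

text \<open>The alternated expression is already antisymmetric in slots 1..k, so
  \<open>alternation_Suc\<close> applies, and \<open>cycle_perm b\<close> produces the omission of
  argument b.\<close>

lemma ext_deriv_alternation:
  fixes a :: "'v::real_normed_vector \<Rightarrow> 'v form"
  assumes S: "open S" "x \<in> S" and a: "\<And>y. y \<in> S \<Longrightarrow> alt_form k (a y)"
    and d: "\<And>w. (\<lambda>y. a y w) differentiable (at x)"
  shows "ext_deriv k a x v =
    alternation (Suc k) (\<lambda>w. frechet_derivative (\<lambda>y. a y (\<lambda>j. w (Suc j))) (at x) (w 0)) v / fact k"
proof -
  have "frechet_derivative (\<lambda>y. a y (\<lambda>j. w (\<tau> (Suc j)))) (at x) (w (\<tau> 0)) =
      of_int (sign \<tau>) * frechet_derivative (\<lambda>y. a y (\<lambda>j. w (Suc j))) (at x) (w 0)"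
    if \<tau>: "\<tau> permutes {1..k}" for \<tau> w
  proof -
    have "((\<lambda>y. of_int (sign \<tau>) * a y (\<lambda>j. w (Suc j))) has_derivative
        (\<lambda>h. of_int (sign \<tau>) * frechet_derivative (\<lambda>y. a y (\<lambda>j. w (Suc j))) (at x) h)) (at x)"
      by (intro has_derivative_mult_right has_derivative_frechet d)
    then have "((\<lambda>y. a y (\<lambda>j. w (\<tau> (Suc j)))) has_derivative
        (\<lambda>h. of_int (sign \<tau>) * frechet_derivative (\<lambda>y. a y (\<lambda>j. w (Suc j))) (at x) h)) (at x)"
      by (rule has_derivative_transform_within_open[OF _ S]) (simp add: alt_form_permute_Suc[OF a \<tau>])
    moreover have "\<tau> 0 = 0" using \<tau> by (rule permutes_not_in) auto
    ultimately show ?thesis by (simp add: frechet_derivative_eqI)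
  qed
  then have "alternation (Suc k) (\<lambda>w. frechet_derivative (\<lambda>y. a y (\<lambda>j. w (Suc j))) (at x) (w 0)) v =
    fact k * (\<Sum>b\<le>k. (-1) ^ b * frechet_derivative (\<lambda>y. a y (\<lambda>j. v (cycle_perm b (Suc j)))) (at x) (v (cycle_perm b 0)))"
    by (rule alternation_Suc)
  then show ?thesis by (simp add: ext_deriv_def if_distrib cong: if_cong)
qed

lemma has_derivative_wedge:
  fixes a b :: "'v::real_normed_vector \<Rightarrow> 'v form"
  assumes "\<And>w. ((\<lambda>y. a y w) has_derivative (\<lambda>h. a' h w)) (at x)"
    and "\<And>w. ((\<lambda>y. b y w) has_derivative (\<lambda>h. b' h w)) (at x)"
  shows "((\<lambda>y. wedge p q (a y) (b y) w) has_derivative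
    (\<lambda>h. alternation (p + q) (\<lambda>w. a' h w * b x (\<lambda>i. w (p + i)) + a x w * b' h (\<lambda>i. w (p + i))) w
      / (fact p * fact q))) (at x)"
proof -
  have "((\<lambda>y. a y (\<lambda>i. w (\<sigma> i)) * b y (\<lambda>i. w (\<sigma> (p + i)))) has_derivative
      (\<lambda>h. a' h (\<lambda>i. w (\<sigma> i)) * b x (\<lambda>i. w (\<sigma> (p + i))) + a x (\<lambda>i. w (\<sigma> i)) * b' h (\<lambda>i. w (\<sigma> (p + i))))) (at x)"
    for \<sigma>
    using has_derivative_mult[OF assms(1)[of "\<lambda>i. w (\<sigma> i)"] assms(2)[of "\<lambda>i. w (\<sigma> (p + i))"]]
    by (simp add: add.commute)
  then have "((\<lambda>y. (\<Sum>\<sigma> | \<sigma> permutes {..<p + q}. of_int (sign \<sigma>) *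
        (a y (\<lambda>i. w (\<sigma> i)) * b y (\<lambda>i. w (\<sigma> (p + i))))) * inverse (fact p * fact q)) has_derivative
      (\<lambda>h. (\<Sum>\<sigma> | \<sigma> permutes {..<p + q}. of_int (sign \<sigma>) *
        (a' h (\<lambda>i. w (\<sigma> i)) * b x (\<lambda>i. w (\<sigma> (p + i))) + a x (\<lambda>i. w (\<sigma> i)) * b' h (\<lambda>i. w (\<sigma> (p + i))))) * inverse (fact p * fact q))) (at x)"
    by (intro has_derivative_mult_left has_derivative_mult_right has_derivative_sum)
  then show ?thesis
    unfolding wedge_alternation alternation_def divide_inverse .
qed

text \<open>Both sides are alternations over p + q + 1 slots. The product rule yields two terms. The
  first matches the derivative of \<open>a\<close> wedged with \<open>b\<close> as it stands; in the
  second the direction has to be moved past the p arguments of \<open>a\<close>, which costs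
  (-1)^p.\<close>

lemma ext_deriv_wedge:
  fixes a b :: "'v::real_normed_vector \<Rightarrow> 'v form"
  assumes S: "open S" "x \<in> S"
    and a: "\<And>y. y \<in> S \<Longrightarrow> alt_form p (a y)" and da: "\<And>w. (\<lambda>y. a y w) differentiable (at x)"
    and b: "\<And>y. y \<in> S \<Longrightarrow> alt_form q (b y)" and db: "\<And>w. (\<lambda>y. b y w) differentiable (at x)"
  shows "ext_deriv (p + q) (\<lambda>y. wedge p q (a y) (b y)) x v =
    wedge (Suc p) q (ext_deriv p a x) (b x) v + (-1) ^ p * wedge p (Suc q) (a x) (ext_deriv q b x) v"
proof -
  let ?m = "Suc (p + q)"
  define a' where "a' h w = frechet_derivative (\<lambda>y. a y w) (at x) h" for h w
  define b' where "b' h w = frechet_derivative (\<lambda>y. b y w) (at x) h" for h w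
  have a': "((\<lambda>y. a y w) has_derivative (\<lambda>h. a' h w)) (at x)" for w
    unfolding a'_def using has_derivative_frechet[OF da] by simp
  have b': "((\<lambda>y. b y w) has_derivative (\<lambda>h. b' h w)) (at x)" for w
    unfolding b'_def using has_derivative_frechet[OF db] by simp
  note dw = has_derivative_wedge[of a a' x b b' p q, OF a' b']
  \<comment> \<open>In \<open>G1\<close> and \<open>G2\<close> slot 0 holds the direction, slots
    1..p the arguments of \<open>a\<close>, and the remaining q slots those of
    \<open>b\<close>.\<close>
  define G1 where "G1 w = a' (w 0) (\<lambda>j. w (Suc j)) * b x (\<lambda>i. w (Suc (p + i)))" for w
  define G2 where "G2 w = a x (\<lambda>j. w (Suc j)) * b' (w 0) (\<lambda>i. w (Suc (p + i)))" for w
  have "ext_deriv (p + q) (\<lambda>y. wedge p q (a y) (b y)) x v =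
    alternation ?m (\<lambda>w. frechet_derivative (\<lambda>y. wedge p q (a y) (b y) (\<lambda>j. w (Suc j))) (at x) (w 0)) v / fact (p + q)"
    by (rule ext_deriv_alternation[OF S alt_form_wedge[OF a b]]) (use dw in \<open>auto simp: differentiable_def\<close>)
  also have "(\<lambda>w. frechet_derivative (\<lambda>y. wedge p q (a y) (b y) (\<lambda>j. w (Suc j))) (at x) (w 0)) =
     (\<lambda>w. 1 / (fact p * fact q) * (\<Sum>\<tau> | \<tau> permutes {..<p + q}. of_int (sign \<tau>) *
        (\<lambda>w. G1 w + G2 w) (\<lambda>i. w (shift_perm 1 \<tau> i))))"
    using shift_perm_add[of 1] unfolding frechet_derivative_eqI[OF dw] alternation_def G1_def G2_def by simp
  also have "alternation ?m \<dots> v = 1 / (fact p * fact q) * (fact (p + q) * alternation ?m (\<lambda>w. G1 w + G2 w) v)"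
    unfolding alternation_scale by (subst alternation_absorb[OF shift_perm_permutes]) auto
  finally have lhs: "ext_deriv (p + q) (\<lambda>y. wedge p q (a y) (b y)) x v =
      alternation ?m G1 v / (fact p * fact q) + alternation ?m G2 v / (fact p * fact q)"
    by (simp add: alternation_add add_divide_distrib)
  have ea: "ext_deriv p a x = (\<lambda>w. (1 / fact p) * (\<Sum>\<tau> | \<tau> permutes {..<Suc p}. of_int (sign \<tau>) *
      a' (w (\<tau> 0)) (\<lambda>j. w (\<tau> (Suc j)))))"
    by (rule ext) (simp add: ext_deriv_alternation[OF S a da] a'_def alternation_def)
  have "alternation ?m (\<lambda>w. ext_deriv p a x w * b x (\<lambda>i. w (Suc p + i))) v =
    alternation ?m (\<lambda>w. (1 / fact p) * (\<Sum>\<tau> | \<tau> permutes {..<Suc p}. of_int (sign \<tau>) * G1 (\<lambda>i. w (\<tau> i)))) v"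
  proof (rule alternation_cong)
    fix \<sigma> :: "nat \<Rightarrow> nat"
    let ?w = "\<lambda>i. v (\<sigma> i)"
    have "a' (?w (\<tau> 0)) (\<lambda>j. ?w (\<tau> (Suc j))) * b x (\<lambda>i. ?w (Suc p + i)) = G1 (\<lambda>i. ?w (\<tau> i))"
      if "\<tau> permutes {..<Suc p}" for \<tau>
    proof -
      have "\<tau> (Suc p + i) = Suc p + i" for i using that by (rule permutes_not_in) auto
      then show ?thesis unfolding G1_def by simp
    qed
    then have "(\<Sum>\<tau> | \<tau> permutes {..<Suc p}. of_int (sign \<tau>) *
        (a' (?w (\<tau> 0)) (\<lambda>j. ?w (\<tau> (Suc j))) * b x (\<lambda>i. ?w (Suc p + i)))) =
      (\<Sum>\<tau> | \<tau> permutes {..<Suc p}. of_int (sign \<tau>) * G1 (\<lambda>i. ?w (\<tau> i)))"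
      by (intro sum.cong refl arg_cong2[where f = "(*)"]) blast
    then show "ext_deriv p a x ?w * b x (\<lambda>i. ?w (Suc p + i)) =
      (1 / fact p) * (\<Sum>\<tau> | \<tau> permutes {..<Suc p}. of_int (sign \<tau>) * G1 (\<lambda>i. ?w (\<tau> i)))"
      unfolding ea by (simp add: sum_distrib_right mult.assoc)
  qed
  moreover have "\<tau> permutes {..<?m} \<and> sign \<tau> = sign \<tau>" if "\<tau> permutes {..<Suc p}" for \<tau>
    using permutes_subset[OF that, of "{..<?m}"] by auto
  note alternation_absorb[where q = "Suc p" and \<rho> = "\<lambda>x. x" and m = ?m and F = G1 and v = v, OF this]
  ultimately have r1: "wedge (Suc p) q (ext_deriv p a x) (b x) v = alternation ?m G1 v / (fact p * fact q)"
    by (simp only: wedge_alternation alternation_scale add_Suc) (simp del: fact_Suc)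
  have eb: "ext_deriv q b x = (\<lambda>w. (1 / fact q) * (\<Sum>\<tau> | \<tau> permutes {..<Suc q}. of_int (sign \<tau>) *
      b' (w (\<tau> 0)) (\<lambda>j. w (\<tau> (Suc j)))))"
    by (rule ext) (simp add: ext_deriv_alternation[OF S b db] b'_def alternation_def)
  \<comment> \<open>In the wedge of \<open>a\<close> with the derivative of \<open>b\<close> the
    direction sits in slot p, behind the arguments of \<open>a\<close>; \<open>cycle_perm p\<close>
    translates between the two orders.\<close>
  define G3 where "G3 w = G2 (\<lambda>i. w (cycle_perm p i))" for w
  have "alternation ?m (\<lambda>w. a x w * ext_deriv q b x (\<lambda>i. w (p + i))) v =
    alternation ?m (\<lambda>w. (1 / fact q) * (\<Sum>\<tau> | \<tau> permutes {..<Suc q}. of_int (sign \<tau>) *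
      G3 (\<lambda>i. w (shift_perm p \<tau> i)))) v"
  proof (rule alternation_cong)
    fix \<sigma> :: "nat \<Rightarrow> nat"
    let ?w = "\<lambda>i. v (\<sigma> i)"
    have "a x ?w * b' (?w (p + \<tau> 0)) (\<lambda>j. ?w (p + \<tau> (Suc j))) = G3 (\<lambda>i. ?w (shift_perm p \<tau> i))" for \<tau>
    proof -
      have "a x (\<lambda>j. ?w (shift_perm p \<tau> (if j < p then j else Suc j))) = a x ?w"
        by (rule alt_form_cong[OF a[OF S(2)]]) auto
      then show ?thesis
        using shift_perm_add[of p \<tau> 0] shift_perm_add[of p \<tau> "Suc _"] unfolding G3_def G2_def by simp
    qed
    then have "(\<Sum>\<tau> | \<tau> permutes {..<Suc q}. of_int (sign \<tau>) *
        (a x ?w * b' (?w (p + \<tau> 0)) (\<lambda>j. ?w (p + \<tau> (Suc j))))) =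
      (\<Sum>\<tau> | \<tau> permutes {..<Suc q}. of_int (sign \<tau>) * G3 (\<lambda>i. ?w (shift_perm p \<tau> i)))"
      by (intro sum.cong refl arg_cong2[where f = "(*)"]) blast
    from this[symmetric] show "a x ?w * ext_deriv q b x (\<lambda>i. ?w (p + i)) =
      (1 / fact q) * (\<Sum>\<tau> | \<tau> permutes {..<Suc q}. of_int (sign \<tau>) * G3 (\<lambda>i. ?w (shift_perm p \<tau> i)))"
      unfolding eb by (simp only: sum_distrib_left) (simp add: mult_ac)
  qed
  moreover have "p + Suc q = ?m" by simp
  note alternation_absorb[where q = "Suc q" and \<rho> = "shift_perm p" and m = ?m and F = G3 and v = v,
      OF shift_perm_permutes[OF _ this]]
  moreover have "alternation ?m G3 v = (-1) ^ p * alternation ?m G2 v"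
    using cycle_perm_permutes[of p "p + q"] alternation_permute_inner[of "cycle_perm p" ?m G2 v]
    unfolding G3_def by simp
  ultimately have "wedge p (Suc q) (a x) (ext_deriv q b x) v = (-1) ^ p * alternation ?m G2 v / (fact p * fact q)"
    by (simp only: wedge_alternation alternation_scale add_Suc_right) (simp del: fact_Suc)
  then have r2: "(-1) ^ p * wedge p (Suc q) (a x) (ext_deriv q b x) v = alternation ?m G2 v / (fact p * fact q)"
    by (simp add: power_add[symmetric] flip: mult.assoc mult_2)
  show ?thesis unfolding lhs r1 r2 ..
qed


section \<open>Functions of class \<open>C\<^sup>k\<close>\<close>

text \<open>On an open set all derivatives are determined by the values there. This matters because
  differential forms are set to 0 outside the charts.\<close>

lemma Ck_on_cong:
  assumes "open S" "Ck_on k S f" "\<And>x. x \<in> S \<Longrightarrow> f x = g x"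
  shows "Ck_on k S g"
  using assms(2,3)
proof (induction k arbitrary: f g)
  case 0
  then show ?case by (auto cong: continuous_on_cong)
next
  case (Suc k)
  have "frechet_derivative g (at x) = frechet_derivative f (at x)" "g differentiable (at x)" if "x \<in> S" for x
  proof -
    have "(f has_derivative frechet_derivative f (at x)) (at x)"
      using Suc.prems that by (intro has_derivative_frechet) auto
    then have "(g has_derivative frechet_derivative f (at x)) (at x)"
      by (rule has_derivative_transform_within_open) (use assms Suc.prems that in auto)
    then show "frechet_derivative g (at x) = frechet_derivative f (at x)" "g differentiable (at x)"
      by (auto simp: frechet_derivative_eqI differentiable_def)
  qed
  then show ?case using Suc.prems by (auto intro: Suc.IH[of "\<lambda>x. frechet_derivative f (at x) _"])
qed

lemma Ck_on_SucI:
  assumes "open S" "\<And>x. x \<in> S \<Longrightarrow> (f has_derivative f' x) (at x)" "\<And>v. Ck_on k S (\<lambda>x. f' x v)"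
  shows "Ck_on (Suc k) S f"
proof -
  have "Ck_on k S (\<lambda>x. frechet_derivative f (at x) v)" for v
    by (rule Ck_on_cong[OF assms(1) assms(3)[of v]]) (simp add: frechet_derivative_eqI[OF assms(2)])
  then show ?thesis using assms(2) by (auto simp: differentiable_def)
qed

lemma Ck_on_Suc_has_derivative:
  "Ck_on (Suc k) S f \<Longrightarrow> x \<in> S \<Longrightarrow> (f has_derivative frechet_derivative f (at x)) (at x)"
  by (simp add: has_derivative_frechet)

lemma Ck_on_SucD: "Ck_on (Suc k) S f \<Longrightarrow> Ck_on k S (\<lambda>x. frechet_derivative f (at x) v)"
  by simp

lemma Ck_on_lower: "Ck_on (Suc k) S f \<Longrightarrow> Ck_on k S f"
proof (induction k arbitrary: f)
  case 0
  then show ?case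
    by (auto intro!: continuous_at_imp_continuous_on differentiable_imp_continuous_within)
next
  case (Suc k)
  have "Ck_on k S (\<lambda>x. frechet_derivative f (at x) v)" for v
    using Suc.prems Suc.IH by (simp del: Ck_on.simps(2) add: Ck_on_SucD)
  then show ?case using Suc.prems by simp
qed

lemma Ck_on_const [simp]: "Ck_on k S (\<lambda>x. c)"
  by (induction k arbitrary: c) auto

lemma Ck_on_bounded_linear:
  assumes "open S" "bounded_linear L" "Ck_on k S f"
  shows "Ck_on k S (\<lambda>x. L (f x))"
  using assms(3)
proof (induction k arbitrary: f)
  case 0
  then show ?case using assms by (simp add: bounded_linear.continuous_on)
next
  case (Suc k)
  show ?case
    by (rule Ck_on_SucI[OF assms(1)])
      (rule bounded_linear.has_derivative[OF assms(2) Ck_on_Suc_has_derivative[OF Suc.prems]], assumption,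
       rule Suc.IH[OF Ck_on_SucD[OF Suc.prems]])
qed

lemma Ck_on_add:
  assumes "open S" "Ck_on k S f" "Ck_on k S g"
  shows "Ck_on k S (\<lambda>x. f x + g x)"
  using assms(2,3)
proof (induction k arbitrary: f g)
  case 0
  then show ?case by (simp add: continuous_on_add)
next
  case (Suc k)
  show ?case
    by (rule Ck_on_SucI[OF assms(1)])
      (rule has_derivative_add[OF Suc.prems[THEN Ck_on_Suc_has_derivative]], assumption+,
       rule Suc.IH[OF Suc.prems[THEN Ck_on_SucD]])
qed

lemma Ck_on_mult:
  fixes f g :: "'v::real_normed_vector \<Rightarrow> 'w::real_normed_algebra"
  assumes "open S" "Ck_on k S f" "Ck_on k S g"
  shows "Ck_on k S (\<lambda>x. f x * g x)"
  using assms(2,3)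
proof (induction k arbitrary: f g)
  case 0
  then show ?case by (simp add: continuous_on_mult)
next
  case (Suc k)
  show ?case
    by (rule Ck_on_SucI[OF assms(1)])
      (rule has_derivative_mult[OF Suc.prems[THEN Ck_on_Suc_has_derivative]], assumption+,
       intro Ck_on_add[OF assms(1)] Suc.IH Suc.prems[THEN Ck_on_SucD] Suc.prems[THEN Ck_on_lower])
qed

text \<open>The derivative of the inverse is a product of two copies of the inverse and the
  derivative of f, so the induction on k closes by the product rule.\<close>

lemma Ck_on_inverse:
  fixes f :: "'v::real_normed_vector \<Rightarrow> complex"
  assumes "open S" "Ck_on k S f" "\<And>x. x \<in> S \<Longrightarrow> f x \<noteq> 0"
  shows "Ck_on k S (\<lambda>x. inverse (f x))"
  using assms(2)
proof (induction k)
  case 0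
  then show ?case using assms by (simp add: continuous_on_inverse)
next
  case (Suc k)
  have "Ck_on k S (\<lambda>x. inverse (f x))" using Suc Ck_on_lower by blast
  then have "Ck_on k S (\<lambda>x. (-1) * (inverse (f x) * frechet_derivative f (at x) v * inverse (f x)))" for v
    by (intro Ck_on_mult[OF assms(1)] Ck_on_SucD[OF Suc.prems] Ck_on_const)
  then show ?case
    by (intro Ck_on_SucI[OF assms(1) Deriv.has_derivative_inverse[OF assms(3) Ck_on_Suc_has_derivative[OF Suc.prems]]])
      simp_all
qed

lemma Ck_on_sum:
  assumes "open S" "\<And>i. i \<in> I \<Longrightarrow> Ck_on k S (f i)"
  shows "Ck_on k S (\<lambda>x. \<Sum>i\<in>I. f i x)"
  using assms(2) by (induction I rule: infinite_finite_induct) (auto intro: Ck_on_add[OF assms(1)])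

lemma Ck_on_vec:
  fixes f :: "'v::real_normed_vector \<Rightarrow> 'w::euclidean_space ^ 'n"
  assumes "open S" "\<And>i. Ck_on k S (\<lambda>x. f x $ i)"
  shows "Ck_on k S f"
  using assms(2)
proof (induction k arbitrary: f)
  case 0
  then have "continuous_on S (\<lambda>x. \<chi> i. f x $ i)" by (intro continuous_on_vec_lambda) simp
  then show ?case by simp
next
  case (Suc k)
  have "(f has_derivative (\<lambda>h. \<chi> i. frechet_derivative (\<lambda>x. f x $ i) (at x) h)) (at x)" if "x \<in> S" for x
    using Ck_on_Suc_has_derivative[OF Suc.prems that]
    by (subst has_derivative_componentwise_within) (auto simp: Basis_vec_def inner_axis intro!: has_derivative_inner_left)
  then show ?case
    by (rule Ck_on_SucI[OF assms(1)]) (auto intro!: Suc.IH Ck_on_SucD Suc.prems)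
qed

lemma smooth_on_const [simp]: "smooth_on S (\<lambda>x. c)"
  by (simp add: smooth_on_def)

lemma smooth_on_cong:
  "open S \<Longrightarrow> smooth_on S f \<Longrightarrow> (\<And>x. x \<in> S \<Longrightarrow> f x = g x) \<Longrightarrow> smooth_on S g"
  by (metis Ck_on_cong smooth_on_def)

lemma smooth_on_add: "open S \<Longrightarrow> smooth_on S f \<Longrightarrow> smooth_on S g \<Longrightarrow> smooth_on S (\<lambda>x. f x + g x)"
  by (simp add: smooth_on_def Ck_on_add)

lemma smooth_on_mult:
  fixes f g :: "'v::real_normed_vector \<Rightarrow> 'w::real_normed_algebra"
  shows "open S \<Longrightarrow> smooth_on S f \<Longrightarrow> smooth_on S g \<Longrightarrow> smooth_on S (\<lambda>x. f x * g x)"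
  by (simp add: smooth_on_def Ck_on_mult)

lemma smooth_on_divide:
  fixes f g :: "'v::real_normed_vector \<Rightarrow> complex"
  shows "open S \<Longrightarrow> smooth_on S f \<Longrightarrow> smooth_on S g \<Longrightarrow> (\<And>x. x \<in> S \<Longrightarrow> g x \<noteq> 0) \<Longrightarrow> smooth_on S (\<lambda>x. f x / g x)"
  unfolding divide_inverse by (simp add: smooth_on_def Ck_on_mult Ck_on_inverse)

lemma smooth_on_sum:
  "open S \<Longrightarrow> (\<And>i. i \<in> I \<Longrightarrow> smooth_on S (f i)) \<Longrightarrow> smooth_on S (\<lambda>x. \<Sum>i\<in>I. f i x)"
  by (simp add: smooth_on_def Ck_on_sum)

lemma smooth_on_prod:
  fixes f :: "'i \<Rightarrow> 'v::real_normed_vector \<Rightarrow> complex"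
  assumes "open S" "\<And>i. i \<in> I \<Longrightarrow> smooth_on S (f i)"
  shows "smooth_on S (\<lambda>x. \<Prod>i\<in>I. f i x)"
  using assms(2) by (induction I rule: infinite_finite_induct) (auto intro: smooth_on_mult[OF assms(1)])

lemma smooth_on_differentiable: "smooth_on S f \<Longrightarrow> x \<in> S \<Longrightarrow> f differentiable (at x)"
  unfolding smooth_on_def by (metis Ck_on.simps(2))

lemma smooth_on_frechet: "smooth_on S f \<Longrightarrow> smooth_on S (\<lambda>x. frechet_derivative f (at x) v)"
  unfolding smooth_on_def by (metis Ck_on.simps(2))

section \<open>Symmetry of second derivatives\<close>

lemma has_real_derivative_along_line:
  fixes f :: "'v::real_normed_vector \<Rightarrow> real"
  assumes "f differentiable (at (p + t *\<^sub>R v))"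
  shows "((\<lambda>t. f (p + t *\<^sub>R v)) has_real_derivative frechet_derivative f (at (p + t *\<^sub>R v)) v) (at t)"
proof -
  note d = has_derivative_frechet[OF assms]
  have "((\<lambda>t. p + t *\<^sub>R v) has_derivative (\<lambda>h. h *\<^sub>R v)) (at t)"
    by (auto intro!: derivative_eq_intros)
  from has_derivative_compose[OF this d] show ?thesis
    unfolding has_field_derivative_def
    by (rule has_derivative_eq_rhs) (simp add: fun_eq_iff linear_scale[OF has_derivative_linear[OF d]] mult.commute)
qed

text \<open>The mean value theorem twice: for the difference of f along the two edges parallel to u,
  then for the derivative along u as a function on a segment parallel to v. The second difference on
  the left is symmetric in u and v.\<close>

lemma second_difference:
  fixes f :: "'v::real_normed_vector \<Rightarrow> real"
  assumes f: "Ck_on 2 S f" and h: "0 < h"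
    and S: "\<And>s t. 0 \<le> s \<Longrightarrow> s \<le> h \<Longrightarrow> 0 \<le> t \<Longrightarrow> t \<le> h \<Longrightarrow> x + s *\<^sub>R u + t *\<^sub>R v \<in> S"
  obtains s t where "0 < s" "s < h" "0 < t" "t < h"
    "f (x + h *\<^sub>R u + h *\<^sub>R v) - f (x + h *\<^sub>R u) - f (x + h *\<^sub>R v) + f x
     = h * h * frechet_derivative (\<lambda>y. frechet_derivative f (at y) u) (at (x + s *\<^sub>R u + t *\<^sub>R v)) v"
proof -
  have df: "f differentiable (at y)" if "y \<in> S" for y
    using f that by (simp add: numeral_2_eq_2)
  have ddf: "(\<lambda>y. frechet_derivative f (at y) u) differentiable (at y)" if "y \<in> S" for y
    using f that by (simp add: numeral_2_eq_2)
  have g: "((\<lambda>s. f (x + t *\<^sub>R v + s *\<^sub>R u)) has_real_derivative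
      frechet_derivative f (at (x + t *\<^sub>R v + s *\<^sub>R u)) u) (at s)" if "0 \<le> s" "s \<le> h" "0 \<le> t" "t \<le> h" for s t
    using S[OF that] by (intro has_real_derivative_along_line df) (simp add: add_ac)
  have "\<exists>s>0. s < h \<and> (\<lambda>s. f (x + h *\<^sub>R v + s *\<^sub>R u) - f (x + 0 *\<^sub>R v + s *\<^sub>R u)) h
      - (\<lambda>s. f (x + h *\<^sub>R v + s *\<^sub>R u) - f (x + 0 *\<^sub>R v + s *\<^sub>R u)) 0
    = (h - 0) * (frechet_derivative f (at (x + h *\<^sub>R v + s *\<^sub>R u)) u - frechet_derivative f (at (x + 0 *\<^sub>R v + s *\<^sub>R u)) u)"
    using h by (intro MVT2 DERIV_diff g) auto
  then obtain s where s: "0 < s" "s < h"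
    "f (x + h *\<^sub>R v + h *\<^sub>R u) - f (x + h *\<^sub>R u) - (f (x + h *\<^sub>R v) - f x)
     = h * (frechet_derivative f (at (x + h *\<^sub>R v + s *\<^sub>R u)) u - frechet_derivative f (at (x + s *\<^sub>R u)) u)"
    by auto
  have "\<exists>t>0. t < h \<and> (\<lambda>t. frechet_derivative f (at (x + s *\<^sub>R u + t *\<^sub>R v)) u) h
      - (\<lambda>t. frechet_derivative f (at (x + s *\<^sub>R u + t *\<^sub>R v)) u) 0 =
    (h - 0) * frechet_derivative (\<lambda>y. frechet_derivative f (at y) u) (at (x + s *\<^sub>R u + t *\<^sub>R v)) v"
    using h s by (intro MVT2 has_real_derivative_along_line ddf S) auto
  then obtain t where t: "0 < t" "t < h" "frechet_derivative f (at (x + s *\<^sub>R u + h *\<^sub>R v)) u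
      - frechet_derivative f (at (x + s *\<^sub>R u)) u =
    h * frechet_derivative (\<lambda>y. frechet_derivative f (at y) u) (at (x + s *\<^sub>R u + t *\<^sub>R v)) v"
    by auto
  have comm: "x + h *\<^sub>R v + s' *\<^sub>R u = x + s' *\<^sub>R u + h *\<^sub>R v" for s' by (simp add: add_ac)
  show ?thesis
    by (rule that[OF s(1,2) t(1,2)]) (use s(3) t(3) in \<open>simp add: comm algebra_simps\<close>)
qed

text \<open>The two mixed derivatives, taken at nearby but different points, both equal the same
  second difference divided by h^2; continuity brings the points back to x. Values are real because
  of the mean value theorem.\<close>

lemma frechet_derivative_commute_real:
  fixes f :: "'v::real_normed_vector \<Rightarrow> real"
  assumes S: "open S" "x \<in> S" and f: "Ck_on 2 S f"
  shows "frechet_derivative (\<lambda>y. frechet_derivative f (at y) u) (at x) v =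
         frechet_derivative (\<lambda>y. frechet_derivative f (at y) v) (at x) u"
proof (rule ccontr)
  define E where "E u v y = frechet_derivative (\<lambda>y. frechet_derivative f (at y) u) (at y) v" for u v y
  assume "\<not> ?thesis"
  then have ne: "\<bar>E u v x - E v u x\<bar> > 0" by (simp add: E_def)
  define e where "e = \<bar>E u v x - E v u x\<bar> / 2"
  have e: "e > 0" using ne by (simp add: e_def)
  have cont: "continuous_on S (E u v)" for u v
    using f unfolding E_def numeral_2_eq_2 by simp
  have "\<exists>d>0. \<forall>y. dist y x < d \<longrightarrow> y \<in> S \<and> \<bar>E u v y - E u v x\<bar> < e" for u v
  proof -
    obtain d1 where d1: "d1 > 0" "\<And>y. dist y x < d1 \<Longrightarrow> y \<in> S"
      using S by (metis open_dist)
    obtain d2 where d2: "d2 > 0" "\<And>y. y \<in> S \<Longrightarrow> dist y x < d2 \<Longrightarrow> dist (E u v y) (E u v x) < e"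
      using cont[of u v] S e unfolding continuous_on_iff by metis
    show ?thesis by (rule exI[of _ "min d1 d2"]) (use d1 d2 in \<open>auto simp: dist_real_def\<close>)
  qed
  then obtain d d' where d: "d > 0" "\<And>y. dist y x < d \<Longrightarrow> y \<in> S \<and> \<bar>E u v y - E u v x\<bar> < e"
    and d': "d' > 0" "\<And>y. dist y x < d' \<Longrightarrow> y \<in> S \<and> \<bar>E v u y - E v u x\<bar> < e" by metis
  \<comment> \<open>Keeps the parallelogram spanned by h u and h v inside both neighbourhoods; the
    summand 1 keeps the denominator positive when u = v = 0.\<close>
  define h where "h = min d d' / (2 * (norm u + norm v + 1))"
  have h: "h > 0" using d(1) d'(1) by (auto simp: h_def intro!: divide_pos_pos add_nonneg_pos)
  have near: "dist (x + s *\<^sub>R u + t *\<^sub>R v) x < min d d'" if "0 \<le> s" "s \<le> h" "0 \<le> t" "t \<le> h" for s t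
  proof -
    have "dist (x + s *\<^sub>R u + t *\<^sub>R v) x \<le> s * norm u + t * norm v"
      using that norm_triangle_ineq[of "s *\<^sub>R u" "t *\<^sub>R v"] by (simp add: dist_norm add_diff_eq)
    also have "\<dots> \<le> h * norm u + h * norm v" using that by (intro add_mono mult_right_mono) auto
    also have "\<dots> \<le> h * (norm u + norm v + 1)" using h by (simp add: algebra_simps)
    also have "\<dots> = min d d' / 2"
    proof -
      have "norm u + norm v + 1 \<noteq> 0" using norm_ge_zero[of u] norm_ge_zero[of v] by linarith
      moreover have "M / (2 * N) * N = M / 2" if "N \<noteq> 0" for M N :: real using that by simp
      ultimately show ?thesis unfolding h_def by blast
    qed
    also have "\<dots> < min d d'" using d(1) d'(1) by (simp add: min_def)
    finally show ?thesis .
  qed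
  obtain s t where 1: "0 < s" "s < h" "0 < t" "t < h"
    "f (x + h *\<^sub>R u + h *\<^sub>R v) - f (x + h *\<^sub>R u) - f (x + h *\<^sub>R v) + f x = h * h * E u v (x + s *\<^sub>R u + t *\<^sub>R v)"
    using second_difference[OF f h, of x u v] near d(2) unfolding E_def by (metis min_less_iff_conj)
  have near': "dist (x + s *\<^sub>R v + t *\<^sub>R u) x < min d d'" if "0 \<le> s" "s \<le> h" "0 \<le> t" "t \<le> h" for s t
    using near[OF that(3,4,1,2)] by (simp add: add_ac)
  obtain s' t' where 2: "0 < s'" "s' < h" "0 < t'" "t' < h"
    "f (x + h *\<^sub>R v + h *\<^sub>R u) - f (x + h *\<^sub>R v) - f (x + h *\<^sub>R u) + f x = h * h * E v u (x + s' *\<^sub>R v + t' *\<^sub>R u)"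
    using second_difference[OF f h, of x v u] near' d(2) unfolding E_def by (metis min_less_iff_conj)
  have "h * h * E u v (x + s *\<^sub>R u + t *\<^sub>R v) = h * h * E v u (x + s' *\<^sub>R v + t' *\<^sub>R u)"
    using 1(5) 2(5) unfolding add.assoc[of x] add.commute[of "h *\<^sub>R v"] by linarith
  then have eq: "E u v (x + s *\<^sub>R u + t *\<^sub>R v) = E v u (x + s' *\<^sub>R v + t' *\<^sub>R u)" using h by simp
  have "\<bar>E u v (x + s *\<^sub>R u + t *\<^sub>R v) - E u v x\<bar> < e"
    using near[of s t] 1 d(2) by auto
  moreover have "\<bar>E v u (x + s' *\<^sub>R v + t' *\<^sub>R u) - E v u x\<bar> < e"
    using near'[of s' t'] 2 d'(2) by auto
  ultimately show False using eq unfolding e_def by (auto simp: abs_if split: if_splits)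
qed

lemma frechet_derivative_bounded_linear:
  assumes "bounded_linear L" "f differentiable (at x)"
  shows "frechet_derivative (\<lambda>y. L (f y)) (at x) v = L (frechet_derivative f (at x) v)"
  using bounded_linear.has_derivative[OF assms(1) has_derivative_frechet[OF assms(2)]]
  by (simp add: frechet_derivative_eqI)

lemma frechet_derivative_commute:
  fixes f :: "'v::real_normed_vector \<Rightarrow> 'w::euclidean_space"
  assumes S: "open S" "x \<in> S" and f: "Ck_on 2 S f"
  shows "frechet_derivative (\<lambda>y. frechet_derivative f (at y) u) (at x) v =
         frechet_derivative (\<lambda>y. frechet_derivative f (at y) v) (at x) u"
proof (rule euclidean_eqI)
  fix b :: 'w
  have L: "bounded_linear (\<lambda>w. w \<bullet> b)" by (rule bounded_linear_inner_left)
  have d: "f differentiable (at y)" "(\<lambda>y. frechet_derivative f (at y) u) differentiable (at y)" if "y \<in> S" for y u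
    using f that by (simp_all add: numeral_2_eq_2)
  have "frechet_derivative (\<lambda>y. frechet_derivative (\<lambda>y. f y \<bullet> b) (at y) u) (at x) v =
      frechet_derivative (\<lambda>y. frechet_derivative f (at y) u) (at x) v \<bullet> b" for u v
  proof -
    have "(\<lambda>y. frechet_derivative f (at y) u \<bullet> b) differentiable (at x)"
      using bounded_linear.has_derivative[OF L has_derivative_frechet[OF d(2)[OF S(2)]]]
      by (auto simp: differentiable_def)
    then have "frechet_derivative (\<lambda>y. frechet_derivative (\<lambda>y. f y \<bullet> b) (at y) u) (at x) =
        frechet_derivative (\<lambda>y. frechet_derivative f (at y) u \<bullet> b) (at x)"
      by (rule frechet_derivative_cong_open[OF _ S]) (simp add: frechet_derivative_bounded_linear[OF L d(1)])
    then show ?thesis by (simp add: frechet_derivative_bounded_linear[OF L d(2)[OF S(2)]])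
  qed
  then show "frechet_derivative (\<lambda>y. frechet_derivative f (at y) u) (at x) v \<bullet> b =
         frechet_derivative (\<lambda>y. frechet_derivative f (at y) v) (at x) u \<bullet> b"
    using frechet_derivative_commute_real[OF S Ck_on_bounded_linear[OF S(1) L f], of u v] by simp
qed


section \<open>Smoothness of holomorphic maps\<close>

text \<open>The scalar case of \<open>holomorphic_map_on\<close>. The derivative is complex linear
  at each point, but its continuity is not part of the definition, so smoothness is a
  theorem.\<close>

definition holo_on :: "(complex ^ 'n::finite) set \<Rightarrow> (complex ^ 'n \<Rightarrow> complex) \<Rightarrow> bool" where
  "holo_on S f \<longleftrightarrow> (\<forall>x\<in>S. \<exists>f'. (f has_derivative f') (at x) \<and> (\<forall>z v. f' (z *s v) = z * f' v))"

lemma norm_vector_smult: "norm (z *s v) = norm z * norm (v :: complex ^ 'n::finite)"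
  by (simp add: norm_vec_def L2_set_def norm_mult power_mult_distrib real_sqrt_mult
      flip: sum_distrib_left)

lemma holo_on_frechet:
  assumes "holo_on S f" "x \<in> S"
  shows "(f has_derivative frechet_derivative f (at x)) (at x)"
    and "frechet_derivative f (at x) (z *s v) = z * frechet_derivative f (at x) v"
proof -
  obtain f' where f': "(f has_derivative f') (at x)" "\<And>z v. f' (z *s v) = z * f' v"
    using assms unfolding holo_on_def by blast
  then show "(f has_derivative frechet_derivative f (at x)) (at x)"
    "frechet_derivative f (at x) (z *s v) = z * frechet_derivative f (at x) v"
    by (simp_all add: frechet_derivative_eqI[OF f'(1)])
qed

lemma bounded_linear_smult_left: "bounded_linear (\<lambda>z. z *s (v :: complex ^ 'n::finite))"
  by (rule bounded_linear_intro[where K = "norm v"])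
    (simp_all add: vec_eq_iff distrib_right norm_vector_smult)

text \<open>On a complex line f is a holomorphic function of one variable, which makes the classical
  Cauchy theory available direction by direction.\<close>

lemma holo_on_along_line:
  assumes "holo_on S f" "x + \<zeta> *s v \<in> S"
  shows "((\<lambda>\<zeta>. f (x + \<zeta> *s v)) has_field_derivative frechet_derivative f (at (x + \<zeta> *s v)) v) (at \<zeta>)"
proof -
  have "((\<lambda>\<zeta>. x + \<zeta> *s v) has_derivative (\<lambda>h. h *s v)) (at \<zeta>)"
    using has_derivative_add[OF has_derivative_const bounded_linear.has_derivative[OF bounded_linear_smult_left has_derivative_ident]]
    by simp
  from has_derivative_compose[OF this holo_on_frechet(1)[OF assms]] show ?thesis
    unfolding has_field_derivative_def
    by (rule has_derivative_eq_rhs) (simp add: fun_eq_iff holo_on_frechet(2)[OF assms] mult.commute)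
qed

text \<open>Cauchy's inequality on the disc of radius r in the complex line through x along
  v.\<close>

lemma holo_on_derivative_bound:
  assumes f: "holo_on S f" and r: "0 < r"
    and S: "\<And>\<zeta>. norm \<zeta> \<le> r \<Longrightarrow> x + \<zeta> *s v \<in> S \<and> norm (f (x + \<zeta> *s v)) \<le> M"
  shows "norm (frechet_derivative f (at x) v) \<le> M / r"
proof -
  define u :: "complex \<Rightarrow> complex" where "u \<zeta> = f (x + \<zeta> *s v)" for \<zeta>
  have d: "(u has_field_derivative frechet_derivative f (at (x + \<zeta> *s v)) v) (at \<zeta>)" if "norm \<zeta> \<le> r" for \<zeta>
    unfolding u_def using holo_on_along_line[OF f] S[OF that] by blast
  have "norm ((deriv ^^ 1) u 0) \<le> fact 1 * M / r ^ 1"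
  proof (rule Cauchy_inequality)
    show "u holomorphic_on ball 0 r"
      proof (rule holomorphic_onI)
      fix \<zeta> :: complex assume "\<zeta> \<in> ball 0 r"
      then have "norm \<zeta> \<le> r" by simp
      from d[OF this] show "u field_differentiable at \<zeta> within ball 0 r"
        by (metis field_differentiable_at_within field_differentiable_def)
    qed
    show "continuous_on (cball 0 r) u"
      by (intro continuous_at_imp_continuous_on ballI, rule DERIV_isCont, rule d) simp
    show "norm (u \<zeta>) \<le> M" if "norm (0 - \<zeta>) = r" for \<zeta>
      using S[of \<zeta>] that by (simp add: u_def)
  qed (rule r)
  moreover have "deriv u 0 = frechet_derivative f (at x) v"
    using DERIV_imp_deriv[OF d[of 0]] r by simp
  ultimately show ?thesis by simp
qed

text \<open>First-order Taylor formula along the line. On the disc of radius r the second derivative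
  is at most 2 M / r^2, by Cauchy's inequality on discs of radius r about its points; this is why f
  is controlled on the disc of radius 2 r.\<close>

lemma holo_on_difference_quotient:
  assumes f: "holo_on S f" and t: "0 < t" "t \<le> r"
    and S: "\<And>\<zeta>. norm \<zeta> \<le> 2 * r \<Longrightarrow> x + \<zeta> *s v \<in> S \<and> norm (f (x + \<zeta> *s v)) \<le> M"
  shows "norm ((f (x + of_real t *s v) - f x) / of_real t - frechet_derivative f (at x) v) \<le> 2 * M / r\<^sup>2 * t"
proof -
  have r: "r > 0" using t by simp
  define u :: "complex \<Rightarrow> complex" where "u \<zeta> = f (x + \<zeta> *s v)" for \<zeta>
  have d: "(u has_field_derivative frechet_derivative f (at (x + \<zeta> *s v)) v) (at \<zeta>)" if "norm \<zeta> \<le> 2 * r" for \<zeta>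
    unfolding u_def using holo_on_along_line[OF f] S[OF that] by blast
  have hol: "u holomorphic_on ball 0 (2 * r)"
    proof (rule holomorphic_onI)
      fix \<zeta> :: complex assume "\<zeta> \<in> ball 0 (2 * r)"
      then have "norm \<zeta> \<le> 2 * r" by simp
      from d[OF this] show "u field_differentiable at \<zeta> within ball 0 (2 * r)"
        by (metis field_differentiable_at_within field_differentiable_def)
    qed
  have cont: "continuous_on (cball 0 (2 * r)) u"
    by (intro continuous_at_imp_continuous_on ballI, rule DERIV_isCont, rule d) simp
  have "cmod ((deriv ^^ 0) u (of_real t) - (\<Sum>i\<le>1. (deriv ^^ i) u 0 * (of_real t - 0) ^ i / fact i))
      \<le> (2 * M / r\<^sup>2) * cmod (of_real t - 0) ^ Suc 1 / fact 1"
  proof (rule complex_Taylor[where S = "cball 0 r"])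
    fix i \<zeta> assume "\<zeta> \<in> cball (0 :: complex) r" "i \<le> (1 :: nat)"
    then have "\<zeta> \<in> ball 0 (2 * r)" using r by simp
    then have "((deriv ^^ i) u has_field_derivative (deriv ^^ Suc i) u \<zeta>) (at \<zeta>)"
      using holomorphic_derivI[OF holomorphic_higher_deriv[OF hol open_ball] open_ball] by simp
    then show "((deriv ^^ i) u has_field_derivative (deriv ^^ Suc i) u \<zeta>) (at \<zeta> within cball 0 r)"
      by (rule has_field_derivative_at_within)
  next
    fix \<zeta> assume \<zeta>: "\<zeta> \<in> cball (0 :: complex) r"
    have sub: "cball \<zeta> r \<subseteq> cball 0 (2 * r)"
      using cball_trans[OF \<zeta>, of _ r] by auto
    have "norm ((deriv ^^ 2) u \<zeta>) \<le> fact 2 * M / r ^ 2"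
    proof (rule Cauchy_inequality[OF _ _ r])
      show "u holomorphic_on ball \<zeta> r"
      proof (rule holomorphic_on_subset[OF hol], rule subsetI)
        fix \<eta> assume "\<eta> \<in> ball \<zeta> r"
        then show "\<eta> \<in> ball 0 (2 * r)" using dist_triangle[of 0 \<eta> \<zeta>] \<zeta> by simp
      qed
      show "continuous_on (cball \<zeta> r) u" by (rule continuous_on_subset[OF cont sub])
      show "norm (u \<eta>) \<le> M" if "norm (\<zeta> - \<eta>) = r" for \<eta>
        using S[of \<eta>] sub that by (simp add: u_def subset_iff dist_norm)
    qed
    then show "cmod ((deriv ^^ Suc 1) u \<zeta>) \<le> 2 * M / r\<^sup>2" by (simp add: numeral_2_eq_2)
  qed (use r t in auto)
  moreover have "deriv u 0 = frechet_derivative f (at x) v"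
    using DERIV_imp_deriv[OF d[of 0]] r by simp
  ultimately have *: "cmod (f (x + of_real t *s v) - f x - of_real t * frechet_derivative f (at x) v) \<le> (2 * M / r\<^sup>2) * t\<^sup>2"
    using t by (simp add: u_def power2_eq_square algebra_simps)
  have "(f (x + of_real t *s v) - f x) / of_real t - frechet_derivative f (at x) v =
      (f (x + of_real t *s v) - f x - of_real t * frechet_derivative f (at x) v) / of_real t"
    using t by (simp add: field_simps)
  then show ?thesis using * t by (simp add: norm_divide divide_le_eq power2_eq_square mult.assoc)
qed

lemma holo_on_translate:
  assumes "holo_on S f" "\<And>x. x \<in> T \<Longrightarrow> x + a \<in> S"
  shows "holo_on T (\<lambda>x. f (x + a))"
    and "x \<in> T \<Longrightarrow> frechet_derivative (\<lambda>x. f (x + a)) (at x) = frechet_derivative f (at (x + a))"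
proof -
  have *: "((\<lambda>x. f (x + a)) has_derivative frechet_derivative f (at (x + a))) (at x)" if "x \<in> T" for x
  proof -
    have "((\<lambda>x. x + a) has_derivative (\<lambda>h. h)) (at x)" by (auto intro!: derivative_eq_intros)
    from has_derivative_compose[OF this holo_on_frechet(1)[OF assms(1) assms(2)[OF that]]] show ?thesis by simp
  qed
  then show "holo_on T (\<lambda>x. f (x + a))"
    using holo_on_frechet(2)[OF assms(1) assms(2)] unfolding holo_on_def by blast
  show "x \<in> T \<Longrightarrow> frechet_derivative (\<lambda>x. f (x + a)) (at x) = frechet_derivative f (at (x + a))"
    using * by (rule frechet_derivative_eqI)
qed

lemma holo_on_linear_combination:
  assumes "holo_on S f" "holo_on S g"
  shows "holo_on S (\<lambda>x. c * f x + d * g x)"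
  unfolding holo_on_def
proof
  fix x assume x: "x \<in> S"
  have "((\<lambda>x. c * f x + d * g x) has_derivative
      (\<lambda>h. c * frechet_derivative f (at x) h + d * frechet_derivative g (at x) h)) (at x)"
    by (intro has_derivative_add has_derivative_mult_right holo_on_frechet(1)[OF _ x] assms)
  then show "\<exists>f'. ((\<lambda>x. c * f x + d * g x) has_derivative f') (at x) \<and> (\<forall>z v. f' (z *s v) = z * f' v)"
    using holo_on_frechet(2)[OF _ x] assms by (intro exI conjI) (auto simp: algebra_simps)
qed

lemma holo_on_subset: "holo_on S f \<Longrightarrow> T \<subseteq> S \<Longrightarrow> holo_on T f"
  unfolding holo_on_def by blast

text \<open>The derivative along \<open>v\<close> is a locally uniform limit of difference quotients, and Cauchy's
  estimate makes the derivatives of these converge uniformly as well.\<close>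

lemma holo_on_derivative:
  fixes f :: "complex ^ 'n::finite \<Rightarrow> complex"
  assumes S: "open S" and f: "holo_on S f"
  shows "holo_on S (\<lambda>x. frechet_derivative f (at x) v)"
  unfolding holo_on_def
proof
  fix x0 assume "x0 \<in> S"
  then obtain R where R: "R > 0" "cball x0 R \<subseteq> S" using S open_contains_cball by blast
  have "continuous_on (cball x0 R) f"
    using R holo_on_frechet(1)[OF f] by (intro continuous_at_imp_continuous_on ballI has_derivative_continuous) blast
  then have "bounded (f ` cball x0 R)" by (intro compact_imp_bounded compact_continuous_image compact_cball)
  then obtain M where M: "\<And>x. x \<in> cball x0 R \<Longrightarrow> norm (f x) \<le> M" unfolding bounded_iff by blast
  have M0: "M \<ge> 0" using M[of x0] R norm_ge_zero[of "f x0"] by (simp del: norm_ge_zero)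
  \<comment> \<open>Three nested radii: the limit is taken on the ball of radius \<rho>, Cauchy
    estimates reach out to 2 \<rho>, and difference quotients evaluate f up to distance 4 \<rho> =
    R.\<close>
  define \<rho> where "\<rho> = R / 4"
  define r where "r = \<rho> / (norm v + 1)"
  define C where "C = 2 * M / r\<^sup>2"
  have \<rho>: "\<rho> > 0" using R by (simp add: \<rho>_def)
  have nv: "norm v + 1 > 0" using norm_ge_zero[of v] by linarith
  have r: "r > 0" using \<rho> nv by (simp add: r_def)
  have C: "C \<ge> 0" using M0 by (simp add: C_def)
  have rv: "norm (\<zeta> *s v) \<le> 2 * \<rho>" if "norm \<zeta> \<le> 2 * r" for \<zeta>
  proof -
    have "norm (\<zeta> *s v) \<le> 2 * r * (norm v + 1)"
      unfolding norm_vector_smult using that r by (intro mult_mono) auto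
    also have "\<dots> = 2 * \<rho>" using nv by (simp add: r_def)
    finally show ?thesis .
  qed
  have inR: "x + \<zeta> *s v \<in> cball x0 R" if "x \<in> ball x0 (2 * \<rho>)" "norm \<zeta> \<le> 2 * r" for x \<zeta>
  proof -
    have "dist x0 (x + \<zeta> *s v) \<le> dist x0 x + norm (\<zeta> *s v)"
      using norm_triangle_ineq4[of "x0 - x" "\<zeta> *s v"] by (simp add: dist_norm algebra_simps)
    then show ?thesis using that rv[OF that(2)] by (simp add: \<rho>_def)
  qed
  define t where "t n = r / real (Suc n)" for n
  have t: "0 < t n" "t n \<le> r" for n using r by (auto simp: t_def field_simps)
  \<comment> \<open>The difference quotients of f along v, written so that
    \<open>holo_on_linear_combination\<close> applies.\<close>
  define g where "g n x = (1 / of_real (t n)) * f (x + of_real (t n) *s v) + (- 1 / of_real (t n)) * f x" for n x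
  have g: "holo_on (ball x0 (2 * \<rho>)) (g n)" for n
    unfolding g_def
  proof (intro holo_on_linear_combination)
    have "norm (complex_of_real (t n)) \<le> 2 * r" using t[of n] by simp
    then show "holo_on (ball x0 (2 * \<rho>)) (\<lambda>x. f (x + of_real (t n) *s v))"
      using inR R by (intro holo_on_translate(1)[OF f]) blast
    show "holo_on (ball x0 (2 * \<rho>)) f"
      using R \<rho> by (intro holo_on_subset[OF f]) (auto simp: \<rho>_def)
  qed
  have gD: "norm (g n x - frechet_derivative f (at x) v) \<le> C * t n" if "x \<in> ball x0 (2 * \<rho>)" for n x
  proof -
    have "norm ((f (x + of_real (t n) *s v) - f x) / of_real (t n) - frechet_derivative f (at x) v) \<le> 2 * M / r\<^sup>2 * t n"
      by (rule holo_on_difference_quotient[OF f t]) (use inR[OF that] R M in blast)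
    then show ?thesis by (simp add: g_def C_def diff_divide_distrib)
  qed
  define g' where "g' n x = frechet_derivative (g n) (at x)" for n x
  have g': "(g n has_derivative g' n x) (at x)" "g' n x (z *s h) = z * g' n x h" if "x \<in> ball x0 (2 * \<rho>)" for n x z h
    unfolding g'_def using holo_on_frechet[OF g that] by auto
  \<comment> \<open>On the ball of radius 2 \<rho> the difference of \<open>g n\<close> and
    \<open>g m\<close> is at most \<open>C * (t n + t m)\<close>, since both are close to the
    derivative of f. Cauchy's inequality on a disc of radius \<open>\<rho> / norm h\<close> in
    direction h then bounds the derivative of this difference.\<close>
  have diff: "norm (g' n x h - g' m x h) \<le> C * (t n + t m) / \<rho> * norm h" if x: "x \<in> ball x0 \<rho>" for n m x h
  proof (cases "h = 0")
    case True
    then show ?thesis using g'(2)[of x _ 0 h] x \<rho> by simp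
  next
    case False
    have x2: "x \<in> ball x0 (2 * \<rho>)" using x \<rho> by simp
    have "((\<lambda>x. 1 * g n x + (-1) * g m x) has_derivative (\<lambda>h. 1 * g' n x h + (-1) * g' m x h)) (at x)"
      by (intro has_derivative_add has_derivative_mult_right g' x2)
    then have e: "frechet_derivative (\<lambda>x. 1 * g n x + (-1) * g m x) (at x) h = g' n x h - g' m x h"
      by (simp add: frechet_derivative_eqI)
    have "norm (frechet_derivative (\<lambda>x. 1 * g n x + (-1) * g m x) (at x) h) \<le> (C * (t n + t m)) / (\<rho> / norm h)"
    proof (rule holo_on_derivative_bound[OF holo_on_linear_combination[OF g g]])
      fix \<zeta> :: complex assume "norm \<zeta> \<le> \<rho> / norm h"
      then have "norm (\<zeta> *s h) \<le> \<rho>" using False by (simp add: norm_vector_smult field_simps)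
      moreover have "dist x0 (x + \<zeta> *s h) \<le> dist x0 x + norm (\<zeta> *s h)"
        using norm_triangle_ineq4[of "x0 - x" "\<zeta> *s h"] by (simp add: dist_norm algebra_simps)
      ultimately have y: "x + \<zeta> *s h \<in> ball x0 (2 * \<rho>)" using x by simp
      let ?y = "x + \<zeta> *s h"
      have "norm (g n ?y - g m ?y) \<le> norm (g n ?y - frechet_derivative f (at ?y) v) + norm (g m ?y - frechet_derivative f (at ?y) v)"
        using norm_triangle_ineq4[of "g n ?y - frechet_derivative f (at ?y) v" "g m ?y - frechet_derivative f (at ?y) v"] by simp
      also have "\<dots> \<le> C * t n + C * t m" using gD[OF y] by (intro add_mono)
      finally show "?y \<in> ball x0 (2 * \<rho>) \<and> norm (1 * g n ?y + (-1) * g m ?y) \<le> C * (t n + t m)"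
        using y by (simp add: algebra_simps)
    qed (use \<rho> False in auto)
    then show ?thesis unfolding e by (simp add: mult_ac)
  qed
  have tlim: "t \<longlonglongrightarrow> 0"
    unfolding t_def using LIMSEQ_Suc[OF lim_const_over_n[of r]] by simp
  have tmono: "t m \<le> t n" if "n \<le> m" for n m
    unfolding t_def using that r by (intro divide_left_mono) auto
  have diff2: "norm (g' n x h - g' m x h) \<le> (2 * C * t n / \<rho>) * norm h" if "x \<in> ball x0 \<rho>" "n \<le> m" for n m x h
  proof -
    have "C * (t n + t m) / \<rho> * norm h \<le> (2 * C * t n / \<rho>) * norm h"
      using tmono[OF that(2)] C \<rho> by (intro mult_right_mono divide_right_mono) (auto simp: mult_left_mono algebra_simps)
    then show ?thesis using diff[OF that(1), of n h m] by linarith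
  qed
  have small: "(\<lambda>n. (2 * C * t n / \<rho>) * c) \<longlonglongrightarrow> 0" for c
    by (rule tendsto_eq_intros tlim refl | use \<rho> in simp)+
  have "convergent (\<lambda>n. g' n x h)" if x: "x \<in> ball x0 \<rho>" for x h
  proof (rule Cauchy_convergent, rule metric_CauchyI)
    fix e :: real assume e: "e > 0"
    then obtain N where N: "\<And>n. n \<ge> N \<Longrightarrow> (2 * C * t n / \<rho>) * norm h < e / 2"
      using small[of "norm h"] order_tendstoD(2)[OF small[of "norm h"], of "e / 2"] unfolding eventually_sequentially by (metis half_gt_zero)
    have "dist (g' m x h) (g' n x h) < e" if "m \<ge> N" "n \<ge> N" for m n
    proof -
      have "dist (g' N x h) (g' m x h) < e / 2" "dist (g' N x h) (g' n x h) < e / 2"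
        using diff2[OF x that(1), of h] diff2[OF x that(2), of h] N[of N] by (auto simp: dist_norm)
      then show ?thesis by (metis dist_commute dist_triangle_half_l)
    qed
    then show "\<exists>N. \<forall>m\<ge>N. \<forall>n\<ge>N. dist (g' m x h) (g' n x h) < e" by blast
  qed
  then obtain G where G: "\<And>x h. x \<in> ball x0 \<rho> \<Longrightarrow> (\<lambda>n. g' n x h) \<longlonglongrightarrow> G x h"
    unfolding convergent_def by metis
  have bound: "norm (g' n x h - G x h) \<le> (2 * C * t n / \<rho>) * norm h" if x: "x \<in> ball x0 \<rho>" for n x h
  proof (rule tendsto_upperbound)
    show "(\<lambda>m. norm (g' n x h - g' m x h)) \<longlonglongrightarrow> norm (g' n x h - G x h)"
      by (intro tendsto_intros G x)
    show "\<forall>\<^sub>F m in sequentially. norm (g' n x h - g' m x h) \<le> (2 * C * t n / \<rho>) * norm h"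
      using eventually_ge_at_top[of n] by (rule eventually_mono) (rule diff2[OF x])
  qed simp
  have lim: "(\<lambda>n. g n x) \<longlonglongrightarrow> frechet_derivative f (at x) v" if "x \<in> ball x0 \<rho>" for x
  proof (rule LIM_zero_cancel, rule Lim_null_comparison)
    show "\<forall>\<^sub>F n in sequentially. norm (g n x - frechet_derivative f (at x) v) \<le> C * t n"
      using gD[of x] that \<rho> by simp
    show "(\<lambda>n. C * t n) \<longlonglongrightarrow> 0" using tendsto_mult_right_zero[OF tlim] by simp
  qed
  have x0: "x0 \<in> ball x0 \<rho>" using \<rho> by simp
  \<comment> \<open>Derivatives that converge uniformly, together with convergence of the functions
    at the one point x0, make the limit differentiable; \<open>lim\<close> identifies this limit
    with the derivative of f along v.\<close>
  have "\<exists>k. \<forall>x\<in>ball x0 \<rho>. (\<lambda>n. g n x) \<longlonglongrightarrow> k x \<and> (k has_derivative G x) (at x within ball x0 \<rho>)"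
  proof (rule has_derivative_sequence[where f = g and f' = g' and g' = G])
    show "(g n has_derivative g' n x) (at x within ball x0 \<rho>)" if "x \<in> ball x0 \<rho>" for n x
      by (rule has_derivative_at_withinI, rule g') (use that \<rho> in simp)
    show "x0 \<in> ball x0 \<rho>" "(\<lambda>n. g n x0) \<longlonglongrightarrow> frechet_derivative f (at x0) v"
      using x0 lim[OF x0] by auto
    fix e :: real assume "e > 0"
    then have "\<forall>\<^sub>F n in sequentially. (2 * C * t n / \<rho>) * 1 < e"
      by (rule order_tendstoD(2)[OF small])
    then show "\<forall>\<^sub>F n in sequentially. \<forall>x\<in>ball x0 \<rho>. \<forall>h. norm (g' n x h - G x h) \<le> e * norm h"
    proof eventually_elim
      case (elim n)
      then have "(2 * C * t n / \<rho>) * norm h \<le> e * norm h" for h :: "complex ^ 'n" by (intro mult_right_mono) auto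
      then show ?case using bound order_trans by blast
    qed
  qed simp
  then obtain k where k: "\<And>x. x \<in> ball x0 \<rho> \<Longrightarrow> (\<lambda>n. g n x) \<longlonglongrightarrow> k x"
    "\<And>x. x \<in> ball x0 \<rho> \<Longrightarrow> (k has_derivative G x) (at x within ball x0 \<rho>)" by blast
  have "(k has_derivative G x0) (at x0)" using k(2)[OF x0] at_within_open[OF x0 open_ball] by simp
  then have "((\<lambda>x. frechet_derivative f (at x) v) has_derivative G x0) (at x0)"
    by (rule has_derivative_transform_within_open[OF _ open_ball x0]) (use LIMSEQ_unique k(1) lim in blast)
  moreover have "G x0 (z *s h) = z * G x0 h" for z h
  proof (rule LIMSEQ_unique[OF G[OF x0]])
    show "(\<lambda>n. g' n x0 (z *s h)) \<longlonglongrightarrow> z * G x0 h"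
      using tendsto_mult_left[OF G[OF x0], of z h] g'(2)[of x0] \<rho> by simp
  qed
  ultimately show "\<exists>f'. ((\<lambda>x. frechet_derivative f (at x) v) has_derivative f') (at x0) \<and> (\<forall>z v. f' (z *s v) = z * f' v)"
    by blast
qed

text \<open>Bootstrapping: each directional derivative is again holomorphic, so the induction
  hypothesis applies to it.\<close>

lemma holo_on_imp_Ck_on:
  assumes "open S" "holo_on S f"
  shows "Ck_on k S f"
  using assms(2)
proof (induction k arbitrary: f)
  case 0
  then show ?case
    using holo_on_frechet(1) by (auto intro!: continuous_at_imp_continuous_on dest: has_derivative_continuous)
next
  case (Suc k)
  have "f differentiable (at x)" if "x \<in> S" for x
    using holo_on_frechet(1)[OF Suc.prems that] by (auto simp: differentiable_def)
  then show ?case using Suc.IH holo_on_derivative[OF assms(1) Suc.prems] by simp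
qed

lemma holomorphic_map_on_imp_smooth_on:
  assumes "open S" "holomorphic_map_on S f"
  shows "smooth_on S f"
  unfolding smooth_on_def
proof (intro allI Ck_on_vec[OF assms(1)] holo_on_imp_Ck_on[OF assms(1)])
  fix i
  show "holo_on S (\<lambda>x. f x $ i)"
    unfolding holo_on_def
  proof
    fix x assume "x \<in> S"
    then obtain f' where f': "(f has_derivative f') (at x)" "\<And>z v. f' (z *s v) = z *s f' v"
      using assms(2) unfolding holomorphic_map_on_def by blast
    then show "\<exists>f'. ((\<lambda>x. f x $ i) has_derivative f') (at x) \<and> (\<forall>z v. f' (z *s v) = z * f' v)"
      using bounded_linear.has_derivative[OF bounded_linear_vec_nth f'(1)] by (intro exI conjI) auto
  qed
qed


section \<open>Powers of a 2-form on a symplectic frame\<close>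

text \<open>\<open>form_power\<close> at a single point, without the cut-off outside the
  charts.\<close>

primrec wedge_power :: "'v form \<Rightarrow> nat \<Rightarrow> 'v form" where
  "wedge_power w 0 = (\<lambda>v. 1)"
| "wedge_power w (Suc p) = wedge 2 (2 * p) w (wedge_power w p)"

definition pairing :: "'v form \<Rightarrow> 'v \<Rightarrow> 'v \<Rightarrow> complex" where
  "pairing w x y = w (\<lambda>j. if j = 0 then x else y)"

lemma alt_form_pairing:
  assumes "alt_form 2 w"
  shows "w v = pairing w (v 0) (v 1)"
  unfolding pairing_def by (rule alt_form_cong[OF assms]) (auto simp: less_2_cases_iff)

lemma pairing_antisym:
  assumes "alt_form 2 w"
  shows "pairing w y x = - pairing w x y"
proof -
  let ?v = "\<lambda>l :: nat. if l = 0 then x else y"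
  have 1: "w (\<lambda>l. ?v (Transposition.transpose 0 1 l)) = - w ?v"
    by (rule alt_form_transpose[OF assms]) auto
  have 2: "pairing w y x = w (\<lambda>l. ?v (Transposition.transpose 0 1 l))"
    by (subst alt_form_pairing[OF assms]) simp
  have 3: "pairing w x y = w ?v" by (simp only: pairing_def)
  show ?thesis unfolding 2 3 by (rule 1)
qed

text \<open>Each inner alternation of the recursive definition is absorbed by the outer one. Of the
  normalising factorials only one \<open>fact 2\<close> per factor survives.\<close>

lemma wedge_power_alternation:
  assumes w: "alt_form 2 w"
  shows "wedge_power w p v =
    alternation (2 * p) (\<lambda>v. \<Prod>i<p. pairing w (v (2 * i)) (v (Suc (2 * i)))) v / 2 ^ p"
proof (induction p arbitrary: v)
  case 0
  show ?case by (simp add: alternation_def)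
next
  case (Suc p)
  define P where "P p v = (\<Prod>i<p. pairing w (v (2 * i)) (v (Suc (2 * i))))" for p and v :: "nat \<Rightarrow> 'a"
  have IH: "wedge_power w p v = alternation (2 * p) (P p) v / 2 ^ p" for v
    unfolding Suc.IH P_def ..
  have "(\<lambda>u. w u * wedge_power w p (\<lambda>i. u (2 + i))) =
    (\<lambda>u. (1 / 2 ^ p) * (\<Sum>\<tau> | \<tau> permutes {..<2 * p}. of_int (sign \<tau>) * P (Suc p) (\<lambda>i. u (shift_perm 2 \<tau> i))))"
  proof
    fix u :: "nat \<Rightarrow> 'a"
    have "w u * P p (\<lambda>i. u (2 + \<tau> i)) = P (Suc p) (\<lambda>i. u (shift_perm 2 \<tau> i))" for \<tau>
      using shift_perm_add[of 2 \<tau>] unfolding P_def prod.lessThan_Suc_shift alt_form_pairing[OF w, of u]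
      by (simp add: o_def)
    then have "(\<Sum>\<tau> | \<tau> permutes {..<2 * p}. of_int (sign \<tau>) * (w u * P p (\<lambda>i. u (2 + \<tau> i)))) =
      (\<Sum>\<tau> | \<tau> permutes {..<2 * p}. of_int (sign \<tau>) * P (Suc p) (\<lambda>i. u (shift_perm 2 \<tau> i)))"
      by simp
    then show "w u * wedge_power w p (\<lambda>i. u (2 + i)) =
      (1 / 2 ^ p) * (\<Sum>\<tau> | \<tau> permutes {..<2 * p}. of_int (sign \<tau>) * P (Suc p) (\<lambda>i. u (shift_perm 2 \<tau> i)))"
      unfolding IH alternation_def by (simp add: sum_distrib_left mult.left_commute flip: sum_divide_distrib)
  qed
  moreover have "alternation (2 + 2 * p) (\<lambda>u. \<Sum>\<tau> | \<tau> permutes {..<2 * p}. of_int (sign \<tau>) *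
      P (Suc p) (\<lambda>i. u (shift_perm 2 \<tau> i))) v = fact (2 * p) * alternation (2 + 2 * p) (P (Suc p)) v"
    by (rule alternation_absorb, rule shift_perm_permutes) auto
  ultimately have "wedge_power w (Suc p) v = alternation (2 + 2 * p) (P (Suc p)) v / 2 ^ Suc p"
    by (simp only: wedge_power.simps wedge_alternation alternation_scale) simp
  then show ?case unfolding P_def by (simp only: mult_Suc_right)
qed

lemma wedge_power_wedge_alternation:
  assumes w: "alt_form 2 w"
  shows "wedge (2 * p) 1 (wedge_power w p) a v = alternation (2 * p + 1)
    (\<lambda>v. (\<Prod>i<p. pairing w (v (2 * i)) (v (Suc (2 * i)))) * a (\<lambda>j. v (2 * p + j))) v / 2 ^ p"
proof -
  define P where "P v = (\<Prod>i<p. pairing w (v (2 * i)) (v (Suc (2 * i))))" for v :: "nat \<Rightarrow> 'a"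
  define F where "F v = P v * a (\<lambda>j. v (2 * p + j))" for v
  have wp: "wedge_power w p v = alternation (2 * p) P v / 2 ^ p" for v
    unfolding wedge_power_alternation[OF w] P_def ..
  have "(\<lambda>u. wedge_power w p u * a (\<lambda>i. u (2 * p + i))) =
    (\<lambda>u. (1 / 2 ^ p) * (\<Sum>\<tau> | \<tau> permutes {..<2 * p}. of_int (sign \<tau>) * F (\<lambda>i. u (\<tau> i))))"
  proof
    fix u :: "nat \<Rightarrow> 'a"
    have "P (\<lambda>i. u (\<tau> i)) * a (\<lambda>i. u (2 * p + i)) = F (\<lambda>i. u (\<tau> i))" if "\<tau> permutes {..<2 * p}" for \<tau>
    proof -
      have "\<tau> (2 * p + j) = 2 * p + j" for j using that by (rule permutes_not_in) simp
      then show ?thesis by (simp add: F_def)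
    qed
    then have "(\<Sum>\<tau> | \<tau> permutes {..<2 * p}. of_int (sign \<tau>) * (P (\<lambda>i. u (\<tau> i)) * a (\<lambda>i. u (2 * p + i)))) =
      (\<Sum>\<tau> | \<tau> permutes {..<2 * p}. of_int (sign \<tau>) * F (\<lambda>i. u (\<tau> i)))"
      by simp
    then show "wedge_power w p u * a (\<lambda>i. u (2 * p + i)) =
      (1 / 2 ^ p) * (\<Sum>\<tau> | \<tau> permutes {..<2 * p}. of_int (sign \<tau>) * F (\<lambda>i. u (\<tau> i)))"
      unfolding wp alternation_def
      by (simp add: sum_distrib_right mult.assoc flip: sum_divide_distrib)
  qed
  moreover have "alternation (2 * p + 1) (\<lambda>u. \<Sum>\<tau> | \<tau> permutes {..<2 * p}. of_int (sign \<tau>) *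
      F (\<lambda>i. u ((\<lambda>x. x) \<tau> i))) v = fact (2 * p) * alternation (2 * p + 1) F v"
  proof (rule alternation_absorb)
    fix \<tau> :: "nat \<Rightarrow> nat" assume "\<tau> permutes {..<2 * p}"
    then show "\<tau> permutes {..<2 * p + 1} \<and> sign \<tau> = sign \<tau>" by (auto elim: permutes_subset)
  qed
  ultimately have "wedge (2 * p) 1 (wedge_power w p) a v = alternation (2 * p + 1) F v / 2 ^ p"
    by (simp only: wedge_alternation alternation_scale) simp
  then show ?thesis unfolding F_def P_def .
qed

text \<open>The involution exchanging the two members of each pair 2 k, 2 k + 1, which index
  conjugate vectors of a symplectic frame.\<close>

definition partner :: "nat \<Rightarrow> nat" where
  "partner a = (if even a then Suc a else a - 1)"

text \<open>Exchanging two whole pairs is an even permutation, so only flips inside a pair affect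
  the sign, and a flip is visible in the parity of \<open>\<sigma> (2 * i)\<close>. The induction
  normalises the image of the last pair, by a flip if necessary and then by an exchange of pairs,
  until that pair is fixed.\<close>

lemma sign_pair_permutation:
  assumes "\<sigma> permutes {..<2 * p}" "\<And>i. i < p \<Longrightarrow> \<sigma> (Suc (2 * i)) = partner (\<sigma> (2 * i))"
  shows "sign \<sigma> * (\<Prod>i<p. (-1) ^ \<sigma> (2 * i)) = 1"
  using assms
proof (induction p arbitrary: \<sigma>)
  case 0
  then show ?case by (simp add: permutes_empty flip: id_def)
next
  case (Suc p)
  let ?S = "{..<2 * Suc p}"
  have fixed: "sign \<sigma> * (\<Prod>i<Suc p. (-1) ^ \<sigma> (2 * i)) = 1"
    if perm: "\<sigma> permutes ?S" and pair: "\<And>i. i < Suc p \<Longrightarrow> \<sigma> (Suc (2 * i)) = partner (\<sigma> (2 * i))"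
      and last: "\<sigma> (2 * p) = 2 * p" for \<sigma>
  proof -
    have "\<sigma> (Suc (2 * p)) = Suc (2 * p)" using pair[of p] last by (simp add: partner_def)
    then have "\<sigma> permutes {..<2 * p}"
      using last by (intro permutes_superset[OF perm]) (auto simp: less_Suc_eq)
    from Suc.IH[OF this] pair show ?thesis by (simp add: last)
  qed
  have even: "sign \<sigma> * (\<Prod>i<Suc p. (-1) ^ \<sigma> (2 * i)) = 1"
    if perm: "\<sigma> permutes ?S" and pair: "\<And>i. i < Suc p \<Longrightarrow> \<sigma> (Suc (2 * i)) = partner (\<sigma> (2 * i))"
      and last: "\<sigma> (2 * p) = 2 * k" for \<sigma> k
  proof (cases "k = p")
    case True
    then show ?thesis using fixed[OF perm pair] last by simp
  next
    case False
    let ?t1 = "Transposition.transpose (2 * k) (2 * p)" and ?t2 = "Transposition.transpose (Suc (2 * k)) (Suc (2 * p))"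
    \<comment> \<open>Exchanges the pairs k and p as wholes: two transpositions, hence no change of
      the sign or of any parity.\<close>
    define \<tau> where "\<tau> = ?t1 \<circ> (?t2 \<circ> \<sigma>)"
    have k: "k < p"
      using permutes_in_image[OF perm, of "2 * p"] last False by simp
    have t: "?t1 permutes ?S" "?t2 permutes ?S" using k by (intro permutes_swap_id; simp)+
    have p2: "?t2 \<circ> \<sigma> permutes ?S" by (rule permutes_compose[OF perm t(2)])
    have p1: "\<tau> permutes ?S" unfolding \<tau>_def by (rule permutes_compose[OF p2 t(1)])
    have sg: "sign \<tau> = sign \<sigma>"
      unfolding \<tau>_def using sign_comp_permutes[OF finite_lessThan t(1) p2] sign_comp_permutes[OF finite_lessThan t(2) perm] k
      by (simp only: sign_swap_id) simp
    have par: "?t1 (?t2 (partner x)) = partner (?t1 (?t2 x))" "even (?t1 (?t2 x)) = even x" for x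
      using k by (cases "even x"; auto simp: Transposition.transpose_def partner_def elim!: evenE oddE; presburger)+
    have last': "\<tau> (2 * p) = 2 * p" using k by (simp add: \<tau>_def last Transposition.transpose_def)
    then have "sign \<tau> * (\<Prod>i<Suc p. (-1) ^ \<tau> (2 * i)) = 1"
      by (rule fixed[OF p1, rotated]) (simp add: \<tau>_def par pair)
    moreover have "(-1 :: int) ^ \<tau> x = (-1) ^ \<sigma> x" for x
      using par(2)[of "\<sigma> x"] by (simp add: \<tau>_def minus_one_power_iff)
    ultimately show ?thesis by (simp add: sg)
  qed
  show ?case
  proof (cases "even (\<sigma> (2 * p))")
    case True
    then show ?thesis using even[OF Suc.prems] by (auto elim!: evenE)
  next
    case False
    then obtain k where k: "\<sigma> (2 * p) = Suc (2 * k)" by (auto elim!: oddE)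
    let ?t = "Transposition.transpose (2 * k) (Suc (2 * k))"
    \<comment> \<open>Flips the pair k. The sign changes, and so does exactly one factor of the
      product, the last one.\<close>
    define \<tau> where "\<tau> = ?t \<circ> \<sigma>"
    have kp: "k \<le> p" using permutes_in_image[OF Suc.prems(1), of "2 * p"] k by simp
    have t: "?t permutes ?S" using kp by (intro permutes_swap_id) auto
    have p1: "\<tau> permutes ?S" unfolding \<tau>_def by (rule permutes_compose[OF Suc.prems(1) t])
    have sg: "sign \<tau> = - sign \<sigma>"
      unfolding \<tau>_def using sign_comp_permutes[OF finite_lessThan t Suc.prems(1)]
      by (simp only: sign_swap_id) simp
    have par: "?t (partner x) = partner (?t x)" for x
      by (cases "even x"; auto simp: Transposition.transpose_def partner_def elim!: evenE oddE; presburger)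
    have last: "\<tau> (2 * p) = 2 * k" by (simp add: \<tau>_def k)
    have 1: "sign \<tau> * (\<Prod>i<Suc p. (-1) ^ \<tau> (2 * i)) = 1"
      by (rule even[OF p1 _ last]) (simp add: \<tau>_def par Suc.prems(2))
    have inj: "inj \<sigma>" using Suc.prems(1) by (rule permutes_inj)
    have other: "\<tau> (2 * i) = \<sigma> (2 * i)" if "i < p" for i
    proof -
      have "\<sigma> (2 * i) \<noteq> \<sigma> (2 * p)" "\<sigma> (2 * i) \<noteq> \<sigma> (Suc (2 * p))"
        using that injD[OF inj] by (metis less_irrefl mult_cancel1 pos2, metis even_Suc even_mult_iff even_numeral)
      moreover have "\<sigma> (Suc (2 * p)) = 2 * k" using Suc.prems(2)[of p] k by (simp add: partner_def)
      ultimately show ?thesis using k by (simp add: \<tau>_def Transposition.transpose_def)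
    qed
    then have "(\<Prod>i<p. (-1) ^ \<tau> (2 * i)) = (\<Prod>i<p. (-1 :: int) ^ \<sigma> (2 * i))" by simp
    then show ?thesis using 1 by (simp add: sg last k)
  qed
qed

text \<open>Only the permutations that map each pair \<open>2 * i, 2 * i + 1\<close> to a pair survive, and the
  sign of such a permutation cancels the signs of its factors, so all terms are positive.\<close>

lemma alternation_symplectic:
  fixes B :: "'v \<Rightarrow> 'v \<Rightarrow> complex"
  assumes zero: "\<And>a b. a \<le> 2 * p \<Longrightarrow> b \<le> 2 * p \<Longrightarrow> \<not> (a < 2 * p \<and> b = partner a) \<Longrightarrow> B (e a) (e b) = 0"
    and pair: "\<And>i. i < p \<Longrightarrow> B (e (2 * i)) (e (Suc (2 * i))) = of_real (g i)"
      "\<And>i. i < p \<Longrightarrow> B (e (Suc (2 * i))) (e (2 * i)) = - of_real (g i)"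
    and pos: "\<And>i. i < p \<Longrightarrow> g i > 0"
  obtains c :: real where "c > 0"
    "alternation (2 * p + 1) (\<lambda>v. (\<Prod>i<p. B (v (2 * i)) (v (Suc (2 * i)))) * a (v (2 * p))) e
      = of_real c * a (e (2 * p))"
proof -
  \<comment> \<open>The permutations whose terms survive. The bound is needed because the index 2 p
    has no partner within range.\<close>
  define C where "C = {\<sigma>. \<sigma> permutes {..<2 * p + 1} \<and> (\<forall>i<p. \<sigma> (2 * i) < 2 * p \<and> \<sigma> (Suc (2 * i)) = partner (\<sigma> (2 * i)))}"
  define c where "c = (\<Sum>\<sigma>\<in>C. \<Prod>i<p. g (\<sigma> (2 * i) div 2))"
  have fin: "finite {\<sigma>. \<sigma> permutes {..<2 * p + 1}}" by (rule finite_permutations) simp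
  then have finC: "finite C" unfolding C_def by (rule rev_finite_subset) auto
  have id: "id \<in> C" unfolding C_def using permutes_id by (simp add: partner_def)
  have "c > 0" unfolding c_def
  proof (intro sum_pos finC prod_pos)
    show "C \<noteq> {}" using id by blast
    show "0 < g (\<sigma> (2 * i) div 2)" if "\<sigma> \<in> C" "i \<in> {..<p}" for \<sigma> i
      using that pos[of "\<sigma> (2 * i) div 2"] by (simp add: C_def less_mult_imp_div_less mult.commute)
  qed
  have B: "B (e x) (e (partner x)) = (-1) ^ x * of_real (g (x div 2))" if "x < 2 * p" for x
  proof (cases "even x")
    case True
    then show ?thesis using that pair(1)[of "x div 2"] by (auto simp: partner_def elim!: evenE)
  next
    case False
    then show ?thesis using that pair(2)[of "x div 2"] by (auto simp: partner_def elim!: oddE)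
  qed
  have nz: "of_int (sign \<sigma>) * ((\<Prod>i<p. B (e (\<sigma> (2 * i))) (e (\<sigma> (Suc (2 * i))))) * a (e (\<sigma> (2 * p))))
      = of_real (\<Prod>i<p. g (\<sigma> (2 * i) div 2)) * a (e (2 * p))" if "\<sigma> \<in> C" for \<sigma>
  proof -
    have perm: "\<sigma> permutes {..<2 * p + 1}" and lt: "\<And>i. i < p \<Longrightarrow> \<sigma> (2 * i) < 2 * p"
      and pr: "\<And>i. i < p \<Longrightarrow> \<sigma> (Suc (2 * i)) = partner (\<sigma> (2 * i))" using that by (auto simp: C_def)
    have "partner x < 2 * p" if "x < 2 * p" for x
      using that by (auto simp: partner_def)
    then have "\<sigma> j < 2 * p" if "j < 2 * p" for j
      using lt pr that by (cases "even j") (auto elim!: evenE oddE)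
    \<comment> \<open>The first 2 p indices are permuted among themselves, so the last one is fixed
      and \<open>a\<close> is evaluated at \<open>e (2 * p)\<close> in every surviving term.\<close>
    then have "\<sigma> ` {..<2 * p} \<subseteq> {..<2 * p}" by auto
    then have "\<sigma> ` {..<2 * p} = {..<2 * p}"
      by (intro card_subset_eq) (auto simp: card_image permutes_inj_on[OF perm])
    then have last: "\<sigma> (2 * p) = 2 * p"
      using permutes_in_image[OF perm, of "2 * p"] injD[OF permutes_inj[OF perm]]
      by (metis image_iff lessThan_iff less_Suc_eq Suc_eq_plus1 less_irrefl)
    then have "\<sigma> permutes {..<2 * p}" by (intro permutes_superset[OF perm]) (auto simp: less_Suc_eq)
    then have "sign \<sigma> * (\<Prod>i<p. (-1) ^ \<sigma> (2 * i)) = 1" by (rule sign_pair_permutation) (rule pr)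
    then have "of_int (sign \<sigma> * (\<Prod>i<p. (-1) ^ \<sigma> (2 * i))) = (1 :: complex)" by (simp only: of_int_1)
    then have sg: "of_int (sign \<sigma>) * (\<Prod>i<p. (-1) ^ \<sigma> (2 * i)) = (1 :: complex)" by simp
    have "(\<Prod>i<p. B (e (\<sigma> (2 * i))) (e (\<sigma> (Suc (2 * i))))) =
      (\<Prod>i<p. (-1) ^ \<sigma> (2 * i) * of_real (g (\<sigma> (2 * i) div 2)))"
      by (intro prod.cong refl) (simp add: pr B lt)
    then show ?thesis using sg by (simp add: prod.distrib last mult.assoc[symmetric])
  qed
  have z: "of_int (sign \<sigma>) * ((\<Prod>i<p. B (e (\<sigma> (2 * i))) (e (\<sigma> (Suc (2 * i))))) * a (e (\<sigma> (2 * p)))) = 0"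
    if perm: "\<sigma> permutes {..<2 * p + 1}" and notC: "\<sigma> \<notin> C" for \<sigma>
  proof -
    obtain i where i: "i < p" "\<not> (\<sigma> (2 * i) < 2 * p \<and> \<sigma> (Suc (2 * i)) = partner (\<sigma> (2 * i)))"
      using perm notC by (auto simp: C_def)
    have "\<sigma> (2 * i) \<le> 2 * p" "\<sigma> (Suc (2 * i)) \<le> 2 * p"
      using permutes_in_image[OF perm, of "2 * i"] permutes_in_image[OF perm, of "Suc (2 * i)"] i(1) by auto
    from zero[OF this i(2)] show ?thesis using i(1) by auto
  qed
  have "alternation (2 * p + 1) (\<lambda>v. (\<Prod>i<p. B (v (2 * i)) (v (Suc (2 * i)))) * a (v (2 * p))) e
    = (\<Sum>\<sigma>\<in>C. of_real (\<Prod>i<p. g (\<sigma> (2 * i) div 2)) * a (e (2 * p)))"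
    unfolding alternation_def
    by (rule sum.mono_neutral_cong_right[OF fin]) (use nz z in \<open>auto simp: C_def\<close>)
  also have "\<dots> = of_real c * a (e (2 * p))" by (simp add: c_def sum_distrib_right)
  finally show ?thesis by (rule that[OF \<open>c > 0\<close>])
qed


section \<open>The Lefschetz isomorphism on 1-forms\<close>

lemma linear_functional_inner:
  fixes f :: "'a::euclidean_space \<Rightarrow> real"
  assumes "linear f"
  shows "f x = x \<bullet> (\<Sum>b\<in>Basis. f b *\<^sub>R b)"
proof -
  have "f x = f (\<Sum>b\<in>Basis. (x \<bullet> b) *\<^sub>R b)" by (simp add: euclidean_representation)
  also have "\<dots> = (\<Sum>b\<in>Basis. (x \<bullet> b) * f b)"
    by (simp add: linear_sum[OF assms] linear_scale[OF assms])
  finally show ?thesis by (simp add: inner_sum_right mult.commute)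
qed

text \<open>Each functional is the inner product with a vector. Fewer vectors than the dimension do
  not span, and a nonzero vector orthogonal to all of them is a common zero.\<close>

lemma common_kernel_exists:
  fixes F :: "('a::euclidean_space \<Rightarrow> real) set"
  assumes "finite F" "card F < DIM('a)" "\<And>f. f \<in> F \<Longrightarrow> linear f"
  shows "\<exists>x. x \<noteq> 0 \<and> (\<forall>f\<in>F. f x = 0)"
proof -
  define r where "r f = (\<Sum>b\<in>Basis. f b *\<^sub>R b)" for f :: "'a \<Rightarrow> real"
  have "dim (r ` F) \<le> card (r ` F)" using assms(1) by (intro dim_le_card') auto
  also have "\<dots> \<le> card F" using assms(1) by (rule card_image_le)
  finally obtain x where x: "x \<noteq> 0" "\<And>y. y \<in> span (r ` F) \<Longrightarrow> orthogonal x y"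
    using assms(2) orthogonal_to_subspace_exists[of "r ` F"] by (metis le_less_trans)
  show ?thesis
  proof (intro exI conjI ballI)
    show "x \<noteq> 0" by (rule x(1))
    fix f assume f: "f \<in> F"
    then have "orthogonal x (r f)" by (intro x(2) span_base) auto
    then show "f x = 0" using linear_functional_inner[OF assms(3)[OF f], of x] by (simp add: r_def orthogonal_def)
  qed
qed

text \<open>Orthogonalisation without normalising, one vector at a time. The next vector must be
  annihilated by 2 (m + 1) real functionals, which are fewer than the real dimension 2n as long as m
  + 1 < n.\<close>

lemma isotropic_frame:
  fixes b :: "complex ^ 'n::finite \<Rightarrow> complex ^ 'n \<Rightarrow> real"
  assumes lin: "\<And>x. linear (b x)" and "u0 \<noteq> 0" and "m < CARD('n)"
  shows "\<exists>u. u 0 = u0 \<and> (\<forall>i\<le>m. u i \<noteq> 0) \<and> (\<forall>j\<le>m. \<forall>i<j. b (u i) (u j) = 0 \<and> b (\<i> *s u i) (u j) = 0)"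
  using assms(3)
proof (induction m)
  case 0
  then show ?case using assms(2) by (intro exI[of _ "\<lambda>_. u0"]) auto
next
  case (Suc m)
  then obtain u where u: "u 0 = u0" "\<And>i. i \<le> m \<Longrightarrow> u i \<noteq> 0"
    "\<And>i j. j \<le> m \<Longrightarrow> i < j \<Longrightarrow> b (u i) (u j) = 0 \<and> b (\<i> *s u i) (u j) = 0" by auto
  let ?F = "(\<lambda>i. b (u i)) ` {..m} \<union> (\<lambda>i. b (\<i> *s u i)) ` {..m}"
  have "card ?F \<le> card {..m} + card {..m}"
    by (intro card_Un_le[THEN order_trans] add_mono card_image_le) auto
  also have "\<dots> < DIM(complex ^ 'n)" using Suc.prems by simp
  finally have card: "card ?F < DIM(complex ^ 'n)" .
  have "\<exists>x. x \<noteq> 0 \<and> (\<forall>f\<in>?F. f x = 0)"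
    by (rule common_kernel_exists[OF _ card]) (use lin in auto)
  then obtain x where x: "x \<noteq> 0" "\<forall>f\<in>?F. f x = 0" by blast
  have "b (u i) x = 0 \<and> b (\<i> *s u i) x = 0" if "i \<le> m" for i using x(2) that by auto
  then show ?case using u x(1)
    by (intro exI[of _ "u(Suc m := x)"]) (auto simp: le_Suc_eq)
qed

lemma wedge_1_1:
  "wedge 1 1 (dz j) (dzbar k) v = v 0 $ j * cnj (v 1 $ k) - v 1 $ j * cnj (v 0 $ k)"
proof -
  have "alternation (Suc 1) (\<lambda>w. dz j w * dzbar k (\<lambda>i. w (1 + i))) v =
     fact 1 * (\<Sum>b\<le>1. (-1) ^ b * (dz j (\<lambda>i. v (cycle_perm b i)) * dzbar k (\<lambda>i. v (cycle_perm b (1 + i)))))"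
  proof (rule alternation_Suc)
    fix \<tau> w assume "\<tau> permutes {1..1 :: nat}"
    then have "\<tau> = id" by simp
    then show "dz j (\<lambda>i. w (\<tau> i)) * dzbar k (\<lambda>i. w (\<tau> (1 + i))) = of_int (sign \<tau>) * (dz j w * dzbar k (\<lambda>i. w (1 + i)))"
      by (simp only: id_apply sign_id) simp
  qed
  then show ?thesis by (simp add: wedge_alternation dz_def dzbar_def)
qed

text \<open>If H is the Hermitian form of h, then w(x, y) is \<i> times the difference of H(x, y)
  and its conjugate, that is -2 Im H(x, y). Putting y = \<i> x gives 2 Re H(x, x), which is
  positive.\<close>

lemma hermitian_pairing:
  fixes h :: "complex ^ 'n::finite ^ 'n"
  assumes h: "positive_definite_hermitian h"
    and w: "w = (\<lambda>v. \<Sum>j\<in>UNIV. \<Sum>k\<in>UNIV. \<i> * h $ j $ k * wedge 1 1 (dz j) (dzbar k) v)"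
  obtains b where "\<And>x y. pairing w x y = of_real (b x y)" "\<And>x. linear (b x)"
    "\<And>x y. b (\<i> *s x) (\<i> *s y) = b x y" "\<And>x. x \<noteq> 0 \<Longrightarrow> 0 < b x (\<i> *s x)"
proof -
  define H where "H x y = (\<Sum>j\<in>UNIV. \<Sum>k\<in>UNIV. h $ j $ k * x $ j * cnj (y $ k))" for x y
  have sym: "H y x = cnj (H x y)" for x y
  proof -
    have "cnj (h $ j $ k) = h $ k $ j" for j k
      using h unfolding positive_definite_hermitian_def by (metis complex_cnj_cnj)
    then have "cnj (H x y) = (\<Sum>j\<in>UNIV. \<Sum>k\<in>UNIV. h $ k $ j * cnj (x $ j) * y $ k)"
      by (simp add: H_def)
    also have "\<dots> = H y x"
      unfolding H_def by (subst sum.swap) (simp add: mult_ac)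
    finally show ?thesis ..
  qed
  have pw: "pairing w x y = \<i> * (H x y - H y x)" for x y
    unfolding pairing_def w H_def wedge_1_1
    by (simp add: sum_distrib_left sum_subtractf right_diff_distrib mult_ac)
  define b where "b x y = - 2 * Im (H x y)" for x y
  show ?thesis
  proof (rule that)
    show "pairing w x y = of_real (b x y)" for x y
      unfolding pw b_def sym[of y x] by (simp add: complex_eq_iff)
    show "linear (b x)" for x
      unfolding b_def H_def
      by (rule linearI) (simp_all add: algebra_simps sum.distrib sum_distrib_left)
    have Hi: "H (\<i> *s x) y = \<i> * H x y" "H x (\<i> *s y) = - \<i> * H x y" for x y
      unfolding H_def by (simp_all add: sum_distrib_left mult_ac sum_negf)
    show "b (\<i> *s x) (\<i> *s y) = b x y" for x y by (simp add: b_def Hi)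
    show "0 < b x (\<i> *s x)" if "x \<noteq> 0" for x
      using h that unfolding positive_definite_hermitian_def H_def[symmetric] by (simp add: b_def Hi)
  qed
qed

text \<open>A nonzero u0 is completed to a frame in which it is the one unpaired vector. By
  \<open>alternation_symplectic\<close> the wedge evaluated there is a positive multiple of
  \<open>a\<close> at u0, so \<open>a\<close> vanishes at u0. The application takes p = n -
  1.\<close>

lemma wedge_power_wedge_injective:
  fixes w :: "(complex ^ 'n::finite) form"
  assumes w: "alt_form 2 w" and a: "alt_form 1 a"
    and h: "positive_definite_hermitian h"
      "w = (\<lambda>v. \<Sum>j\<in>UNIV. \<Sum>k\<in>UNIV. \<i> * h $ j $ k * wedge 1 1 (dz j) (dzbar k) v)"
    and p: "p < CARD('n)"
    and zero: "\<And>v. wedge (2 * p) 1 (wedge_power w p) a v = 0"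
  shows "a v = 0"
proof -
  obtain b where b: "\<And>x y. pairing w x y = of_real (b x y)" "\<And>x. linear (b x)"
    "\<And>x y. b (\<i> *s x) (\<i> *s y) = b x y" "\<And>x. x \<noteq> 0 \<Longrightarrow> 0 < b x (\<i> *s x)"
    using hermitian_pairing[OF h] by blast
  have anti: "b y x = - b x y" for x y
    using pairing_antisym[OF w, of y x] by (simp add: b(1) flip: of_real_minus)
  have "a (\<lambda>_. u0) = 0" if nz: "u0 \<noteq> 0" for u0
  proof -
    obtain u where u: "u 0 = u0" "\<And>i. i \<le> p \<Longrightarrow> u i \<noteq> 0"
      "\<And>i j. j \<le> p \<Longrightarrow> i < j \<Longrightarrow> b (u i) (u j) = 0 \<and> b (\<i> *s u i) (u j) = 0"
      using isotropic_frame[of b, OF b(2) nz p] by blast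
    have ii: "\<i> *s (\<i> *s x) = - x" for x :: "complex ^ 'n" by (simp add: vec_eq_iff)
    have self: "b x x = 0" for x using anti[of x x] by simp
    \<comment> \<open>The frame comes with two relations for i < j only; antisymmetry and invariance
      of \<open>b\<close> under multiplication of both arguments by \<i> give the others.\<close>
    have orth: "b (u i) (u j) = 0" "b (\<i> *s u i) (u j) = 0" "b (u i) (\<i> *s u j) = 0" "b (\<i> *s u i) (\<i> *s u j) = 0"
      if ij: "i \<noteq> j" "i \<le> p" "j \<le> p" for i j
    proof -
      have 1: "b (u i) (u j) = 0" if "i \<noteq> j" "i \<le> p" "j \<le> p" for i j
        using u(3)[of j i] u(3)[of i j] anti[of "u i" "u j"] that by (cases "i < j") auto
      have 2: "b (\<i> *s u i) (u j) = 0" if "i < j" "j \<le> p" for i j using u(3) that by auto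
      have 3: "b (u i) (\<i> *s u j) = 0" if "i < j" "j \<le> p" for i j
        using b(3)[of "u i" "\<i> *s u j"] 2[OF that] by (simp add: ii linear_neg[OF b(2)])
      show "b (u i) (u j) = 0" using 1 ij by blast
      show "b (\<i> *s u i) (\<i> *s u j) = 0" using 1 ij b(3) by simp
      show "b (\<i> *s u i) (u j) = 0"
        using 2[of i j] 3[of j i] anti[of "u j" "\<i> *s u i"] ij by (cases "i < j") auto
      show "b (u i) (\<i> *s u j) = 0"
        using 3[of i j] 2[of j i] anti[of "u i" "\<i> *s u j"] ij by (cases "i < j") auto
    qed
    \<comment> \<open>Slots 2 k and 2 k + 1 carry \<open>u (Suc k)\<close> and
      \<open>\<i> *s u (Suc k)\<close>; the last slot 2 p, the one seen by \<open>a\<close>, carries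
      \<open>u 0\<close>, which is u0.\<close>
    define idx where "idx l = (if l < 2 * p then Suc (l div 2) else 0)" for l
    define e where "e l = (if even l then u (idx l) else \<i> *s u (idx l))" for l
    have idx: "idx l \<le> p" if "l \<le> 2 * p" for l using that by (auto simp: idx_def)
    obtain c where c: "c > 0" "alternation (2 * p + 1)
        (\<lambda>v. (\<Prod>i<p. pairing w (v (2 * i)) (v (Suc (2 * i)))) * a (\<lambda>_. v (2 * p))) e
      = of_real c * a (\<lambda>_. e (2 * p))"
    proof (rule alternation_symplectic[of p "pairing w" e "\<lambda>i. b (u (Suc i)) (\<i> *s u (Suc i))" "\<lambda>x. a (\<lambda>_. x)"])
      fix k l assume kl: "k \<le> 2 * p" "l \<le> 2 * p" "\<not> (k < 2 * p \<and> l = partner k)"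
      show "pairing w (e k) (e l) = 0"
      proof (cases "idx k = idx l")
        case False
        then show ?thesis using orth[OF False idx idx] kl by (auto simp: e_def b(1))
      next
        case True
        have "k = l"
        proof (cases "k < 2 * p")
          case t: True
          then have "l < 2 * p" "k div 2 = l div 2" using True by (auto simp: idx_def split: if_splits)
          then show ?thesis using kl(3) t by (cases "even k"; cases "even l") (auto simp: partner_def elim!: evenE oddE)
        next
          case False
          then show ?thesis using True kl by (auto simp: idx_def split: if_splits)
        qed
        then show ?thesis by (simp add: b(1) self)
      qed
    next
      fix i assume i: "i < p"
      show "pairing w (e (2 * i)) (e (Suc (2 * i))) = of_real (b (u (Suc i)) (\<i> *s u (Suc i)))"
        "pairing w (e (Suc (2 * i))) (e (2 * i)) = - of_real (b (u (Suc i)) (\<i> *s u (Suc i)))"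
        using i anti[of "u (Suc i)" "\<i> *s u (Suc i)"] by (auto simp: e_def idx_def b(1))
      show "b (u (Suc i)) (\<i> *s u (Suc i)) > 0" using i by (intro b(4) u(2)) simp
    qed
    have "a (\<lambda>j. v (2 * p + j)) = a (\<lambda>_. v (2 * p))" for v by (rule alt_form_cong[OF a]) simp
    then have "of_real c * a (\<lambda>_. e (2 * p)) = 0"
      using zero[of e] c(2) unfolding wedge_power_wedge_alternation[OF w] by simp
    then show ?thesis using c(1) by (simp add: e_def idx_def u(1))
  qed
  moreover have "a (\<lambda>_. 0) = 0"
    using linear_0[OF alt_form_linear[OF a, of 0 "\<lambda>_. 0"]] by (simp add: fun_upd_idem)
  moreover have "a v = a (\<lambda>_. v 0)" by (rule alt_form_cong[OF a]) simp
  ultimately show ?thesis by metis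
qed

section \<open>Coordinates on 1-forms and on forms of degree 2n - 1\<close>

lemma alt_form_vanish:
  fixes a :: "'v::euclidean_space form"
  assumes a: "alt_form k a" and z: "\<And>v. (\<And>i. i < k \<Longrightarrow> v i \<in> Basis) \<Longrightarrow> inj_on v {..<k} \<Longrightarrow> a v = 0"
  shows "a v = 0"
proof -
  \<comment> \<open>Multilinearity replaces arguments by basis vectors one at a time; j counts the
    leading arguments that are still arbitrary.\<close>
  have "a v = 0" if "j \<le> k" "\<And>i. j \<le> i \<Longrightarrow> i < k \<Longrightarrow> v i \<in> Basis" for j v
    using that
  proof (induction j arbitrary: v)
    case 0
    show ?case
    proof (cases "inj_on v {..<k}")
      case True
      then show ?thesis using z 0 by blast
    next
      case False
      then obtain i j where "i < k" "j < k" "i \<noteq> j" "v i = v j" by (auto simp: inj_on_def)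
      then show ?thesis by (rule alt_form_repeat[OF a])
    qed
  next
    case (Suc j)
    have lin: "linear (\<lambda>x. a (v(j := x)))" using Suc.prems by (intro alt_form_linear[OF a]) simp
    have "a v = a (v(j := \<Sum>b\<in>Basis. (v j \<bullet> b) *\<^sub>R b))" by (simp add: euclidean_representation)
    also have "\<dots> = (\<Sum>b\<in>Basis. (v j \<bullet> b) *\<^sub>R a (v(j := b)))"
      by (simp add: linear_sum[OF lin] linear_scale[OF lin])
    also have "\<dots> = 0" using Suc by (intro sum.neutral ballI) simp
    finally show ?case .
  qed
  from this[of k v] show ?thesis by simp
qed

text \<open>Indexed by a finite type rather than by a set, so that the map on 1-forms becomes a
  square matrix with a determinant.\<close>

definition real_basis :: "'n + 'n \<Rightarrow> complex ^ 'n::finite" where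
  "real_basis i = (case i of Inl j \<Rightarrow> axis j 1 | Inr j \<Rightarrow> axis j \<i>)"

lemma bij_betw_real_basis: "bij_betw real_basis UNIV (Basis :: (complex ^ 'n::finite) set)"
  unfolding bij_betw_def
proof
  show "inj (real_basis :: 'n + 'n \<Rightarrow> _)"
    by (rule injI) (auto simp: real_basis_def axis_eq_axis split: sum.splits)
  show "range (real_basis :: 'n + 'n \<Rightarrow> _) = Basis"
  proof (intro equalityI subsetI)
    fix x :: "complex ^ 'n" assume "x \<in> Basis"
    then obtain j where "x = axis j 1 \<or> x = axis j \<i>" by (auto simp: Basis_vec_def Basis_complex_def)
    then have "x = real_basis (Inl j) \<or> x = real_basis (Inr j)" by (simp add: real_basis_def)
    then show "x \<in> range real_basis" by auto
  qed (auto simp: real_basis_def Basis_vec_def Basis_complex_def split: sum.splits)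
qed

text \<open>The values on these 2n tuples serve as coordinates of a form of degree 2n - 1. The
  choice of enumeration is the same at every point, so a smooth form has smooth coordinates.\<close>

definition omit_tuple :: "'n + 'n \<Rightarrow> nat \<Rightarrow> complex ^ 'n::finite" where
  "omit_tuple i = (SOME t. bij_betw t {..<2 * (CARD('n) - 1) + 1} (Basis - {real_basis i}))"

lemma bij_betw_omit_tuple:
  fixes i :: "'n::finite + 'n"
  shows "bij_betw (omit_tuple i) {..<2 * (CARD('n) - 1) + 1} (Basis - {real_basis i})"
proof -
  have "real_basis i \<in> Basis" using bij_betw_real_basis by (auto simp: bij_betw_def)
  then have "card (Basis - {real_basis i}) = DIM(complex ^ 'n) - 1" by simp
  moreover have "DIM(complex ^ 'n) = 2 * CARD('n)" "CARD('n) > 0" by simp_all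
  ultimately have "card (Basis - {real_basis i}) = 2 * (CARD('n) - 1) + 1" by linarith
  then show ?thesis
    unfolding omit_tuple_def
    using someI_ex[of "\<lambda>t. bij_betw t {..<2 * (CARD('n) - 1) + 1} (Basis - {real_basis i})"]
      ex_bij_betw_nat_finite[of "Basis - {real_basis i}"] by (metis atLeast0LessThan finite_Basis finite_Diff)
qed

text \<open>Distinct basis vectors, 2n - 1 in number, leave out exactly one, hence form a
  permutation of an \<open>omit_tuple\<close>. \<open>alt_form_vanish\<close> reduces all other
  arguments to this case.\<close>

lemma alt_form_eqI:
  fixes a b :: "(complex ^ 'n::finite) form"
  assumes a: "alt_form (2 * (CARD('n) - 1) + 1) a" and b: "alt_form (2 * (CARD('n) - 1) + 1) b"
    and eq: "\<And>i. a (omit_tuple i) = b (omit_tuple i)"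
  shows "a = b"
proof
  fix v
  let ?k = "2 * (CARD('n) - 1) + 1"
  have ab: "alt_form ?k (\<lambda>v. a v - b v)"
  proof (rule alt_formI)
    show "a v - b v = a w - b w" if "\<And>i. i < ?k \<Longrightarrow> v i = w i" for v w
      using alt_form_cong[OF a that] alt_form_cong[OF b that] by simp
    show "linear (\<lambda>x. a (v(i := x)) - b (v(i := x)))" if "i < ?k" for v i
      by (rule linear_compose_sub[OF alt_form_linear[OF a that] alt_form_linear[OF b that]])
    show "a (\<lambda>l. v (\<tau> l)) - b (\<lambda>l. v (\<tau> l)) = of_int (sign \<tau>) * (a v - b v)" if "\<tau> permutes {..<?k}" for v \<tau>
      using alt_form_permute[OF a that] alt_form_permute[OF b that] by (simp add: right_diff_distrib)
  qed
  have "a v - b v = 0" for v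
  proof (rule alt_form_vanish[OF ab])
    fix v :: "nat \<Rightarrow> complex ^ 'n"
    assume v: "\<And>i. i < ?k \<Longrightarrow> v i \<in> Basis" "inj_on v {..<?k}"
    have "card (v ` {..<?k}) < card (Basis :: (complex ^ 'n) set)"
    proof -
      have "DIM(complex ^ 'n) = 2 * CARD('n)" "CARD('n) > 0" by simp_all
      then have "?k < DIM(complex ^ 'n)" by linarith
      then show ?thesis unfolding card_image[OF v(2)] by (simp only: card_lessThan)
    qed
    then obtain x where x: "x \<in> Basis" "x \<notin> v ` {..<?k}"
      by (metis finite_Basis card_mono finite_lessThan finite_imageI not_le subsetI)
    obtain i where i: "x = real_basis i" using x(1) bij_betw_real_basis by (auto simp: bij_betw_def)
    note t = bij_betw_omit_tuple[of i]
    have "v ` {..<?k} = Basis - {x}"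
    proof (rule card_subset_eq)
      show "card (v ` {..<?k}) = card (Basis - {x})"
        using card_image[OF v(2)] bij_betw_same_card[OF t] i by simp
    qed (use v x in auto)
    then have vb: "bij_betw v {..<?k} (Basis - {x})" using v(2) by (simp add: bij_betw_def)
    define \<tau> where "\<tau> l = (if l < ?k then inv_into {..<?k} (omit_tuple i) (v l) else l)" for l
    have "bij_betw (inv_into {..<?k} (omit_tuple i) \<circ> v) {..<?k} {..<?k}"
      using bij_betw_trans[OF vb] bij_betw_inv_into[OF t] i by simp
    then have "bij_betw \<tau> {..<?k} {..<?k}"
      by (rule bij_betw_cong[THEN iffD1, rotated]) (simp add: \<tau>_def)
    then have \<tau>: "\<tau> permutes {..<?k}" by (rule bij_imp_permutes) (simp add: \<tau>_def)
    have "v l = omit_tuple i (\<tau> l)" if "l < ?k" for l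
    proof -
      have "v l \<in> Basis - {real_basis i}" using bij_betwE[OF vb] that i by blast
      then show ?thesis using bij_betw_inv_into_right[OF t] that by (simp add: \<tau>_def)
    qed
    then have "a v - b v = a (\<lambda>l. omit_tuple i (\<tau> l)) - b (\<lambda>l. omit_tuple i (\<tau> l))"
      by (intro alt_form_cong[OF ab])
    then show "a v - b v = 0"
      using alt_form_permute[OF ab \<tau>, of "omit_tuple i"] eq[of i] by simp
  qed
  then show "a v = b v" by simp
qed

text \<open>The 1-form with coordinates y in the basis dual to \<open>real_basis\<close>.\<close>

definition one_form :: "complex ^ ('n + 'n) \<Rightarrow> (complex ^ 'n::finite) form" where
  "one_form y = (\<lambda>v. \<Sum>j\<in>UNIV. y $ j * of_real (v 0 \<bullet> real_basis j))"

lemma alt_form_one_form: "alt_form 1 (one_form y)"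
proof -
  have "linear (\<lambda>x. one_form y (v(0 := x)))" for v
    unfolding one_form_def
    by (rule linearI) (simp_all add: inner_left_distrib algebra_simps sum.distrib sum_distrib_left scaleR_conv_of_real[where 'a = complex])
  then show ?thesis unfolding alt_form_def by (simp add: one_form_def)
qed

lemma one_form_real_basis:
  fixes y :: "complex ^ ('n + 'n::finite)"
  shows "one_form y (\<lambda>_. real_basis i) = y $ i"
proof -
  have "real_basis i \<bullet> real_basis j = (if j = i then 1 else 0)" for j
  proof -
    have "real_basis i \<in> Basis" "real_basis j \<in> Basis" "real_basis i = real_basis j \<longleftrightarrow> i = j"
      using bij_betw_real_basis[where 'n = 'n] by (auto simp: bij_betw_def inj_eq)
    then show ?thesis using inner_Basis[of "real_basis i" "real_basis j"] by auto
  qed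
  then have "one_form y (\<lambda>_. real_basis i) = (\<Sum>j\<in>UNIV. if j = i then y $ j else 0)"
    unfolding one_form_def by (intro sum.cong refl) simp
  then show ?thesis by simp
qed

text \<open>Column j holds the coordinates of the image of the j-th dual basis form under the wedge
  with \<Omega>.\<close>

definition lefschetz_matrix :: "(complex ^ 'n::finite) form \<Rightarrow> complex ^ ('n + 'n) ^ ('n + 'n)" where
  "lefschetz_matrix \<Omega> = (\<chi> i j. wedge (2 * (CARD('n) - 1)) 1 \<Omega> (one_form (axis j 1)) (omit_tuple i))"

lemma wedge_sum_right:
  "wedge p q a (\<lambda>v. \<Sum>j\<in>S. c j * b j v) v = (\<Sum>j\<in>S. c j * wedge p q a (b j) v)"
  unfolding wedge_alternation
  by (simp add: sum_distrib_left mult.left_commute[of _ "c _"] alternation_sum alternation_scale sum_divide_distrib)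

lemma one_form_axis_sum:
  fixes y :: "complex ^ ('n + 'n::finite)"
  shows "one_form y = (\<lambda>v. \<Sum>j\<in>UNIV. y $ j * one_form (axis j 1) v)"
proof
  fix v :: "nat \<Rightarrow> complex ^ 'n"
  have "one_form (axis j 1) v = of_real (v 0 \<bullet> real_basis j)" for j :: "'n + 'n"
  proof -
    have "one_form (axis j 1) v = (\<Sum>k\<in>UNIV. if k = j then of_real (v 0 \<bullet> real_basis k) else 0)"
      unfolding one_form_def by (intro sum.cong refl) (simp add: axis_def)
    then show ?thesis by simp
  qed
  then show "one_form y v = (\<Sum>j\<in>UNIV. y $ j * one_form (axis j 1) v)" by (simp add: one_form_def)
qed

lemma lefschetz_matrix_mult:
  fixes \<Omega> :: "(complex ^ 'n::finite) form"
  shows "(lefschetz_matrix \<Omega> *v y) $ i = wedge (2 * (CARD('n) - 1)) 1 \<Omega> (one_form y) (omit_tuple i)"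
  unfolding one_form_axis_sum[of y] wedge_sum_right
  by (simp add: lefschetz_matrix_def matrix_vector_mult_def mult.commute)

text \<open>The inverse of \<open>a \<mapsto> \<Omega> \<and> a\<close> on 1-forms by Cramer's rule, whose rational
  expression in the coefficients shows that the preimage of a smooth form is smooth.\<close>

definition lefschetz_inverse :: "(complex ^ 'n::finite) form \<Rightarrow> (complex ^ 'n) form \<Rightarrow> (complex ^ 'n) form" where
  "lefschetz_inverse \<Omega> g = one_form (\<chi> k.
     det (\<chi> i j. if j = k then g (omit_tuple i) else lefschetz_matrix \<Omega> $ i $ j) / det (lefschetz_matrix \<Omega>))"

text \<open>A vector in the kernel of the matrix gives a 1-form whose image has all coordinates 0;
  by injectivity this 1-form is 0. A square matrix with trivial kernel has nonzero
  determinant.\<close>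

lemma lefschetz_inverse:
  fixes \<Omega> :: "(complex ^ 'n::finite) form"
  assumes \<Omega>: "alt_form (2 * (CARD('n) - 1)) \<Omega>"
    and inj: "\<And>a v. alt_form 1 a \<Longrightarrow> (\<And>v. wedge (2 * (CARD('n) - 1)) 1 \<Omega> a v = 0) \<Longrightarrow> a v = 0"
  shows "det (lefschetz_matrix \<Omega>) \<noteq> 0"
    and "alt_form (2 * (CARD('n) - 1) + 1) g \<Longrightarrow> wedge (2 * (CARD('n) - 1)) 1 \<Omega> (lefschetz_inverse \<Omega> g) = g"
proof -
  note alt = alt_form_wedge[OF \<Omega> alt_form_one_form]
  have "y = 0" if "lefschetz_matrix \<Omega> *v y = 0" for y
  proof -
    have "wedge (2 * (CARD('n) - 1)) 1 \<Omega> (one_form y) (omit_tuple i) = 0" for i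
      using that lefschetz_matrix_mult[of \<Omega> y i] by simp
    moreover have "alt_form (2 * (CARD('n) - 1) + 1) (\<lambda>_ :: nat \<Rightarrow> complex ^ 'n. 0)"
      by (simp add: alt_form_def linear_zero)
    ultimately have "wedge (2 * (CARD('n) - 1)) 1 \<Omega> (one_form y) = (\<lambda>_. 0)"
      by (intro alt_form_eqI[OF alt])
    then have "one_form y v = 0" for v by (intro inj[OF alt_form_one_form]) (simp only:)
    then show ?thesis using one_form_real_basis[of y] by (simp add: vec_eq_iff)
  qed
  then have "invertible (lefschetz_matrix \<Omega>)"
    unfolding invertible_left_inverse matrix_left_invertible_ker by blast
  then show det: "det (lefschetz_matrix \<Omega>) \<noteq> 0" by (simp add: invertible_det_nz)
  assume g: "alt_form (2 * (CARD('n) - 1) + 1) g"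
  show "wedge (2 * (CARD('n) - 1)) 1 \<Omega> (lefschetz_inverse \<Omega> g) = g"
    unfolding lefschetz_inverse_def
  proof (rule alt_form_eqI[OF alt g])
    fix i
    let ?y = "\<chi> k. det (\<chi> i j. if j = k then (\<chi> i. g (omit_tuple i)) $ i else lefschetz_matrix \<Omega> $ i $ j) / det (lefschetz_matrix \<Omega>)"
    have "lefschetz_matrix \<Omega> *v ?y = (\<chi> i. g (omit_tuple i))"
      by (rule cramer[OF det, THEN iffD2]) (rule refl)
    from arg_cong[OF this, of "\<lambda>x. vec_nth x i"]
    show "wedge (2 * (CARD('n) - 1)) 1 \<Omega> (one_form (\<chi> k.
       det (\<chi> i j. if j = k then g (omit_tuple i) else lefschetz_matrix \<Omega> $ i $ j) / det (lefschetz_matrix \<Omega>))) (omit_tuple i)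
       = g (omit_tuple i)"
      unfolding lefschetz_matrix_mult by (simp only: vec_lambda_beta)
  qed
qed


section \<open>The exterior derivative of a 1-form\<close>

lemma ext_deriv_1:
  fixes a :: "'v::real_normed_vector \<Rightarrow> 'v form"
  assumes S: "open S" "x \<in> S" and a: "\<And>y. y \<in> S \<Longrightarrow> alt_form 1 (a y)"
    and d: "\<And>w. (\<lambda>y. a y w) differentiable (at x)"
  shows "ext_deriv 1 a x v = frechet_derivative (\<lambda>y. a y (\<lambda>_. v 1)) (at x) (v 0)
    - frechet_derivative (\<lambda>y. a y (\<lambda>_. v 0)) (at x) (v 1)"
proof -
  have "frechet_derivative (\<lambda>y. a y w) (at x) = frechet_derivative (\<lambda>y. a y (\<lambda>_. w 0)) (at x)" for w
    by (rule frechet_derivative_cong_open[OF d S]) (auto intro: alt_form_cong[OF a])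
  from this[of "\<lambda>j. v (Suc j)"] this[of "\<lambda>j. if j < 1 then v j else v (Suc j)"] show ?thesis
    by (simp add: ext_deriv_def)
qed

lemma linear_one_form: "alt_form 1 a \<Longrightarrow> linear (\<lambda>w. a (\<lambda>_. w))"
proof -
  assume a: "alt_form 1 a"
  have "(\<lambda>w. a (\<lambda>_. w)) = (\<lambda>w. a ((\<lambda>_. 0)(0 := w)))"
    by (intro ext alt_form_cong[OF a]) simp
  then show ?thesis using alt_form_linear[OF a, of 0 "\<lambda>_. 0"] by simp
qed

lemma linear_frechet_derivative_one_form:
  fixes a :: "'v::real_normed_vector \<Rightarrow> 'v form"
  assumes S: "open S" "x \<in> S" and a: "\<And>y. y \<in> S \<Longrightarrow> alt_form 1 (a y)"
    and d: "\<And>w. (\<lambda>y. a y w) differentiable (at x)"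
  shows "linear (\<lambda>w. frechet_derivative (\<lambda>y. a y (\<lambda>_. w)) (at x) h)"
proof (rule linearI)
  note D = has_derivative_frechet[OF d]
  fix w w' r
  have "((\<lambda>y. a y (\<lambda>_. w) + a y (\<lambda>_. w')) has_derivative (\<lambda>h. frechet_derivative (\<lambda>y. a y (\<lambda>_. w)) (at x) h +
      frechet_derivative (\<lambda>y. a y (\<lambda>_. w')) (at x) h)) (at x)"
    by (rule has_derivative_add[OF D D])
  then have "((\<lambda>y. a y (\<lambda>_. w + w')) has_derivative (\<lambda>h. frechet_derivative (\<lambda>y. a y (\<lambda>_. w)) (at x) h +
      frechet_derivative (\<lambda>y. a y (\<lambda>_. w')) (at x) h)) (at x)"
    by (rule has_derivative_transform_within_open[OF _ S]) (simp add: linear_add[OF linear_one_form[OF a]])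
  then show "frechet_derivative (\<lambda>y. a y (\<lambda>_. w + w')) (at x) h = frechet_derivative (\<lambda>y. a y (\<lambda>_. w)) (at x) h +
      frechet_derivative (\<lambda>y. a y (\<lambda>_. w')) (at x) h" by (simp add: frechet_derivative_eqI)
  have "((\<lambda>y. r *\<^sub>R a y (\<lambda>_. w)) has_derivative (\<lambda>h. r *\<^sub>R frechet_derivative (\<lambda>y. a y (\<lambda>_. w)) (at x) h)) (at x)"
    by (rule has_derivative_scaleR_right[OF D])
  then have "((\<lambda>y. a y (\<lambda>_. r *\<^sub>R w)) has_derivative (\<lambda>h. r *\<^sub>R frechet_derivative (\<lambda>y. a y (\<lambda>_. w)) (at x) h)) (at x)"
    by (rule has_derivative_transform_within_open[OF _ S]) (simp add: linear_scale[OF linear_one_form[OF a]])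
  then show "frechet_derivative (\<lambda>y. a y (\<lambda>_. r *\<^sub>R w)) (at x) h = r *\<^sub>R frechet_derivative (\<lambda>y. a y (\<lambda>_. w)) (at x) h"
    by (simp add: frechet_derivative_eqI)
qed

lemma alt_form_ext_deriv_1:
  fixes a :: "'v::real_normed_vector \<Rightarrow> 'v form"
  assumes S: "open S" "x \<in> S" and a: "\<And>y. y \<in> S \<Longrightarrow> alt_form 1 (a y)"
    and d: "\<And>w. (\<lambda>y. a y w) differentiable (at x)"
  shows "alt_form 2 (ext_deriv 1 a x)"
proof (rule alt_formI)
  have e: "ext_deriv 1 a x v = frechet_derivative (\<lambda>y. a y (\<lambda>_. v 1)) (at x) (v 0)
      - frechet_derivative (\<lambda>y. a y (\<lambda>_. v 0)) (at x) (v 1)" for v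
    by (rule ext_deriv_1[OF S a d])
  show "ext_deriv 1 a x v = ext_deriv 1 a x w" if "\<And>i. i < 2 \<Longrightarrow> v i = w i" for v w
    unfolding e using that[of 0] that[of 1] by simp
  show "ext_deriv 1 a x (\<lambda>l. v (\<tau> l)) = of_int (sign \<tau>) * ext_deriv 1 a x v" if "\<tau> permutes {..<2}" for v \<tau>
  proof -
    have "ext_deriv 1 a x v =
        alternation (Suc 1) (\<lambda>w. frechet_derivative (\<lambda>y. a y (\<lambda>j. w (Suc j))) (at x) (w 0)) v / fact 1" for v
      by (rule ext_deriv_alternation[OF S a d])
    then show ?thesis using alternation_permute_outer[of \<tau> "Suc 1"] that by (simp add: numeral_2_eq_2)
  qed
  have l: "linear (frechet_derivative (\<lambda>y. a y (\<lambda>_. w)) (at x))" for w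
    by (rule has_derivative_linear[OF has_derivative_frechet[OF d]])
  have l': "linear (\<lambda>w. frechet_derivative (\<lambda>y. a y (\<lambda>_. w)) (at x) h)" for h
    by (rule linear_frechet_derivative_one_form[OF S a d])
  show "linear (\<lambda>w. ext_deriv 1 a x (v(i := w)))" if "i < 2" for v i
    unfolding e using that linear_compose_sub[OF l l'] linear_compose_sub[OF l' l] by (auto simp: less_2_cases_iff)
qed

text \<open>Six second derivatives cancel in pairs by symmetry. F is prescribed on S only, because
  \<open>ext_d\<close> is 0 outside the chart.\<close>

lemma ext_deriv_2_ext_deriv_1:
  fixes a :: "'v::real_normed_vector \<Rightarrow> 'v form"
  assumes S: "open S" "x \<in> S" and a: "\<And>y. y \<in> S \<Longrightarrow> alt_form 1 (a y)"
    and smooth: "\<And>w. smooth_on S (\<lambda>y. a y w)"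
    and F: "\<And>y. y \<in> S \<Longrightarrow> F y = ext_deriv 1 a y"
  shows "ext_deriv 2 F x v = 0"
proof -
  define D where "D w h y = frechet_derivative (\<lambda>y. a y (\<lambda>_. w)) (at y) h" for w h y
  define H where "H w h k = frechet_derivative (D w h) (at x) k" for w h k
  have sm: "smooth_on S (D w h)" for w h
    unfolding D_def by (rule smooth_on_frechet[OF smooth])
  have FD: "F y u = D (u 1) (u 0) y - D (u 0) (u 1) y" if "y \<in> S" for y u
    unfolding F[OF that] D_def
    by (rule ext_deriv_1[OF S(1) that a smooth_on_differentiable[OF smooth that]])
  have "frechet_derivative (\<lambda>y. F y u) (at x) k = H (u 1) (u 0) k - H (u 0) (u 1) k" for u k
  proof -
    have "((\<lambda>y. D (u 1) (u 0) y - D (u 0) (u 1) y) has_derivative (\<lambda>k. H (u 1) (u 0) k - H (u 0) (u 1) k)) (at x)"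
      unfolding H_def
      by (intro has_derivative_diff has_derivative_frechet smooth_on_differentiable[OF sm S(2)])
    then have "((\<lambda>y. F y u) has_derivative (\<lambda>k. H (u 1) (u 0) k - H (u 0) (u 1) k)) (at x)"
      by (rule has_derivative_transform_within_open[OF _ S]) (simp add: FD)
    then show ?thesis by (simp add: frechet_derivative_eqI)
  qed
  note fF = this
  have sym: "H w h k = H w k h" for w h k
  proof -
    have "Ck_on 2 S (\<lambda>y. a y (\<lambda>_. w))" using smooth unfolding smooth_on_def by blast
    then show ?thesis unfolding H_def D_def by (rule frechet_derivative_commute[OF S])
  qed
  show ?thesis
    unfolding ext_deriv_def fF
    using sym[of "v 0" "v 1" "v 2"] sym[of "v 1" "v 0" "v 2"] sym[of "v 2" "v 0" "v 1"]
    by (simp add: numeral_2_eq_2)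
qed

text \<open>The chain rule produces an additional term containing the second derivative of T; it is
  symmetric in the two arguments and disappears on antisymmetrising.\<close>

lemma ext_deriv_1_pullback:
  fixes T :: "'v::euclidean_space \<Rightarrow> 'w::euclidean_space"
  assumes S: "open S" "x \<in> S" and S': "open S'" "\<And>y. y \<in> S \<Longrightarrow> T y \<in> S'" and T: "smooth_on S T"
    and a: "\<And>y. y \<in> S' \<Longrightarrow> alt_form 1 (a y)" and d: "\<And>w. (\<lambda>y. a y w) differentiable (at (T x))"
    and b: "\<And>y. y \<in> S \<Longrightarrow> b y = pullback (frechet_derivative T (at y)) (a (T y))"
    and b1: "\<And>y. y \<in> S \<Longrightarrow> alt_form 1 (b y)"
  shows "ext_deriv 1 b x = pullback (frechet_derivative T (at x)) (ext_deriv 1 a (T x))"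
proof
  fix v
  define L where "L y = frechet_derivative T (at y)" for y
  define Q where "Q w h = frechet_derivative (\<lambda>y. L y w) (at x) h" for w h
  define N where "N w h = frechet_derivative (\<lambda>z. a z (\<lambda>_. w)) (at (T x)) h" for w h
  have Tx: "T x \<in> S'" by (rule S'(2)[OF S(2)])
  have dT: "(T has_derivative L x) (at x)"
    unfolding L_def by (rule has_derivative_frechet[OF smooth_on_differentiable[OF T S(2)]])
  have dL: "((\<lambda>y. L y w) has_derivative Q w) (at x)" for w
    unfolding Q_def[abs_def] L_def
    by (rule has_derivative_frechet[OF smooth_on_differentiable[OF smooth_on_frechet[OF T] S(2)]])
  have sym: "Q w h = Q h w" for w h
  proof -
    have "Ck_on 2 S T" using T unfolding smooth_on_def by blast
    then show ?thesis unfolding Q_def L_def by (rule frechet_derivative_commute[OF S])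
  qed
  have dN: "((\<lambda>y. a (T y) (\<lambda>_. w)) has_derivative (\<lambda>h. N w (L x h))) (at x)" for w
    unfolding N_def by (rule has_derivative_compose[OF dT has_derivative_frechet[OF d]])
  have linN: "linear (\<lambda>w. N w h)" for h
    unfolding N_def by (rule linear_frechet_derivative_one_form[OF S'(1) Tx a d])
  \<comment> \<open>In \<open>b y w\<close> both the base point and the vector fed to
    \<open>a\<close> vary with y. Expansion in a fixed basis separates them into a sum of products,
    to which the product rule applies.\<close>
  have expand: "f w = (\<Sum>e\<in>Basis. (w \<bullet> e) *\<^sub>R f e)" if "linear f" for f :: "'w \<Rightarrow> complex" and w
    by (subst euclidean_representation[of w, symmetric])
      (simp only: linear_sum[OF that] linear_scale[OF that])
  have dB: "((\<lambda>y. b y w) has_derivative (\<lambda>h. a (T x) (\<lambda>_. Q (w 0) h) + N (L x (w 0)) (L x h))) (at x)" for w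
  proof -
    have "((\<lambda>y. \<Sum>e\<in>Basis. (L y (w 0) \<bullet> e) *\<^sub>R a (T y) (\<lambda>_. e)) has_derivative
      (\<lambda>h. \<Sum>e\<in>Basis. (L x (w 0) \<bullet> e) *\<^sub>R N e (L x h) + (Q (w 0) h \<bullet> e) *\<^sub>R a (T x) (\<lambda>_. e))) (at x)"
      by (intro has_derivative_sum has_derivative_scaleR has_derivative_inner_left dL dN)
    then have "((\<lambda>y. b y w) has_derivative
      (\<lambda>h. \<Sum>e\<in>Basis. (L x (w 0) \<bullet> e) *\<^sub>R N e (L x h) + (Q (w 0) h \<bullet> e) *\<^sub>R a (T x) (\<lambda>_. e))) (at x)"
    proof (rule has_derivative_transform_within_open[OF _ S])
      fix y assume y: "y \<in> S"
      have "b y w = b y (\<lambda>_. w 0)" by (rule alt_form_cong[OF b1[OF y]]) simp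
      then show "(\<Sum>e\<in>Basis. (L y (w 0) \<bullet> e) *\<^sub>R a (T y) (\<lambda>_. e)) = b y w"
        using y expand[OF linear_one_form[OF a[OF S'(2)]], of y "L y (w 0)"] by (simp add: b pullback_def L_def)
    qed
    then show ?thesis
      by (rule has_derivative_eq_rhs)
        (simp add: fun_eq_iff expand[OF linear_one_form[OF a[OF Tx]], of "Q _ _"] expand[OF linN, of "L x _"] sum.distrib add.commute)
  qed
  then have db: "(\<lambda>y. b y w) differentiable (at x)" for w unfolding differentiable_def by blast
  have "ext_deriv 1 b x v = frechet_derivative (\<lambda>y. b y (\<lambda>_. v 1)) (at x) (v 0)
      - frechet_derivative (\<lambda>y. b y (\<lambda>_. v 0)) (at x) (v 1)"
    by (rule ext_deriv_1[OF S b1 db])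
  moreover have "ext_deriv 1 a (T x) u = N (u 1) (u 0) - N (u 0) (u 1)" for u
    unfolding N_def by (rule ext_deriv_1[OF S'(1) Tx a d])
  ultimately show "ext_deriv 1 b x v = pullback (frechet_derivative T (at x)) (ext_deriv 1 a (T x)) v"
    unfolding pullback_def frechet_derivative_eqI[OF dB]
    using sym[of "v 0" "v 1"] by (simp add: L_def)
qed


section \<open>Forms on a complex manifold\<close>

lemma smooth_on_wedge:
  assumes "open S" "\<And>v. smooth_on S (\<lambda>x. a x v)" "\<And>v. smooth_on S (\<lambda>x. b x v)"
  shows "smooth_on S (\<lambda>x. wedge p q (a x) (b x) v)"
  unfolding wedge_def divide_inverse
  by (intro smooth_on_mult smooth_on_sum assms smooth_on_const)

lemma smooth_on_det:
  fixes M :: "'v::real_normed_vector \<Rightarrow> complex ^ 'k ^ 'k::finite"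
  assumes "open S" "\<And>i j. smooth_on S (\<lambda>x. M x $ i $ j)"
  shows "smooth_on S (\<lambda>x. det (M x))"
  unfolding det_def
  by (intro smooth_on_mult smooth_on_sum smooth_on_prod assms smooth_on_const)

lemma wedge_zero_left [simp]: "wedge p q 0 b = 0"
  by (simp add: wedge_def fun_eq_iff)

lemma pullback_wedge: "pullback f (wedge p q a b) = wedge p q (pullback f a) (pullback f b)"
  by (simp add: pullback_def wedge_def)

lemma wedge_scale_left: "wedge p q (\<lambda>v. c * a v) b v = c * wedge p q a b v"
  unfolding wedge_alternation by (simp add: mult.assoc alternation_scale)

lemma wedge_add_right: "wedge p q a (b + c) = wedge p q a b + wedge p q a c"
  unfolding wedge_alternation[abs_def] by (simp add: fun_eq_iff distrib_left alternation_add add_divide_distrib)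

lemma wedge_minus_right: "wedge p q a (- b) = - wedge p q a b"
  by (simp add: wedge_def fun_eq_iff sum_negf)

lemma alt_form_pullback:
  assumes f: "linear f" and a: "alt_form k a"
  shows "alt_form k (pullback f a)"
proof (rule alt_formI)
  show "pullback f a v = pullback f a w" if "\<And>i. i < k \<Longrightarrow> v i = w i" for v w
    unfolding pullback_def by (rule alt_form_cong[OF a]) (simp add: that)
  show "linear (\<lambda>x. pullback f a (v(i := x)))" if "i < k" for v i
  proof -
    have "(\<lambda>x. pullback f a (v(i := x))) = (\<lambda>y. a ((\<lambda>j. f (v j))(i := y))) \<circ> f"
      unfolding pullback_def by (auto intro!: ext arg_cong[of _ _ a])
    then show ?thesis using linear_compose[OF f alt_form_linear[OF a that]] by simp
  qed
  show "pullback f a (\<lambda>l. v (\<tau> l)) = of_int (sign \<tau>) * pullback f a v" if "\<tau> permutes {..<k}" for v \<tau>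
    unfolding pullback_def by (rule alt_form_permute[OF a that])
qed

lemma smooth_formsD:
  assumes "\<alpha> \<in> smooth_forms A k"
  shows "c \<in> A \<Longrightarrow> x \<in> chart_image c \<Longrightarrow> alt_form k (\<alpha> c x)"
    and "c \<in> A \<Longrightarrow> smooth_on (chart_image c) (\<lambda>x. \<alpha> c x v)"
    and "c \<in> A \<Longrightarrow> e \<in> A \<Longrightarrow> x \<in> overlap c e \<Longrightarrow>
      \<alpha> c x = pullback (frechet_derivative (transition c e) (at x)) (\<alpha> e (transition c e x))"
    and "\<not> (c \<in> A \<and> x \<in> chart_image c) \<Longrightarrow> \<alpha> c x = 0"
  using assms unfolding smooth_forms_def by blast+

lemma smooth_formsI:
  assumes "\<And>c x. c \<in> A \<Longrightarrow> x \<in> chart_image c \<Longrightarrow> alt_form k (\<alpha> c x)"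
    and "\<And>c v. c \<in> A \<Longrightarrow> smooth_on (chart_image c) (\<lambda>x. \<alpha> c x v)"
    and "\<And>c e x. c \<in> A \<Longrightarrow> e \<in> A \<Longrightarrow> x \<in> overlap c e \<Longrightarrow>
      \<alpha> c x = pullback (frechet_derivative (transition c e) (at x)) (\<alpha> e (transition c e x))"
    and "\<And>c x. \<not> (c \<in> A \<and> x \<in> chart_image c) \<Longrightarrow> \<alpha> c x = 0"
  shows "\<alpha> \<in> smooth_forms A k"
  using assms unfolding smooth_forms_def by blast

locale complex_atlas =
  fixes X :: "'a topology" and A :: "('a, 'n::finite) chart set"
  assumes manifold: "complex_manifold X A"
begin

lemma open_chart_image: "c \<in> A \<Longrightarrow> open (chart_image c)"
  using manifold unfolding complex_manifold_def by blast

lemma overlap_subset: "overlap c e \<subseteq> chart_image c"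
  by (auto simp: overlap_def chart_image_def)

text \<open>Injectivity of the chart on its domain makes \<open>chart_inv\<close> recover the
  original point, which also lies in the domain of the other chart.\<close>

lemma transition_in_chart_image:
  assumes "c \<in> A" "x \<in> overlap c e"
  shows "transition c e x \<in> chart_image e"
proof -
  obtain a where a: "a \<in> fst c" "a \<in> fst e" "x = snd c a" using assms(2) by (auto simp: overlap_def)
  have h: "homeomorphic_map (subtopology X (fst c)) (top_of_set (chart_image c)) (snd c)" and o: "openin X (fst c)"
    using manifold assms(1) unfolding complex_manifold_def by blast+
  have "inj_on (snd c) (topspace (subtopology X (fst c)))" by (rule homeomorphic_imp_injective_map[OF h])
  then have "inj_on (snd c) (fst c)" using openin_subset[OF o] by (simp add: Int_absorb1)
  then show ?thesis using a by (simp add: transition_def chart_inv_def chart_image_def)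
qed

lemma open_overlap:
  assumes "c \<in> A" "e \<in> A"
  shows "open (overlap c e)"
proof -
  have h: "homeomorphic_map (subtopology X (fst c)) (top_of_set (chart_image c)) (snd c)"
    and o: "openin X (fst c)" "openin X (fst e)"
    using manifold assms unfolding complex_manifold_def by blast+
  have "openin (subtopology X (fst c)) (fst c \<inter> fst e)"
    using o by (subst openin_open_subtopology) auto
  then have "openin (top_of_set (chart_image c)) (overlap c e)"
    using homeomorphic_imp_open_map[OF h] unfolding open_map_def overlap_def by blast
  then show ?thesis using open_chart_image[OF assms(1)] by (rule openin_open_trans)
qed

lemma smooth_transition:
  assumes "c \<in> A" "e \<in> A"
  shows "smooth_on (overlap c e) (transition c e)"
  using manifold assms unfolding complex_manifold_def
  by (intro holomorphic_map_on_imp_smooth_on open_overlap) auto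

lemma linear_transition:
  assumes "c \<in> A" "e \<in> A" "x \<in> overlap c e"
  shows "linear (frechet_derivative (transition c e) (at x))"
  by (rule has_derivative_linear[OF has_derivative_frechet[OF smooth_on_differentiable[OF smooth_transition assms(3)]]])
    (use assms in auto)

lemma differentiable_form:
  "\<alpha> \<in> smooth_forms A k \<Longrightarrow> c \<in> A \<Longrightarrow> x \<in> chart_image c \<Longrightarrow> (\<lambda>y. \<alpha> c y v) differentiable (at x)"
  using smooth_on_differentiable smooth_formsD(2) by blast

lemma wedge_form_smooth:
  assumes "\<alpha> \<in> smooth_forms A p" "\<beta> \<in> smooth_forms A q"
  shows "wedge_form p q \<alpha> \<beta> \<in> smooth_forms A (p + q)"
proof (rule smooth_formsI)
  show "alt_form (p + q) (wedge_form p q \<alpha> \<beta> c x)" if "c \<in> A" "x \<in> chart_image c" for c x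
    unfolding wedge_form_def using that by (intro alt_form_wedge smooth_formsD(1)[OF assms(1)] smooth_formsD(1)[OF assms(2)])
  show "smooth_on (chart_image c) (\<lambda>x. wedge_form p q \<alpha> \<beta> c x v)" if "c \<in> A" for c v
    unfolding wedge_form_def
    by (rule smooth_on_wedge[OF open_chart_image[OF that] smooth_formsD(2)[OF assms(1) that] smooth_formsD(2)[OF assms(2) that]])
  show "wedge_form p q \<alpha> \<beta> c x =
      pullback (frechet_derivative (transition c e) (at x)) (wedge_form p q \<alpha> \<beta> e (transition c e x))"
    if "c \<in> A" "e \<in> A" "x \<in> overlap c e" for c e x
    unfolding wedge_form_def pullback_wedge
    using smooth_formsD(3)[OF assms(1) that] smooth_formsD(3)[OF assms(2) that] by simp
  show "wedge_form p q \<alpha> \<beta> c x = 0" if "\<not> (c \<in> A \<and> x \<in> chart_image c)" for c x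
    unfolding wedge_form_def smooth_formsD(4)[OF assms(1) that] by simp
qed

lemma add_smooth_forms:
  assumes "\<alpha> \<in> smooth_forms A k" "\<beta> \<in> smooth_forms A k"
  shows "\<alpha> + \<beta> \<in> smooth_forms A k"
proof (rule smooth_formsI)
  fix c x assume c: "c \<in> A" "x \<in> chart_image c"
  note a = smooth_formsD(1)[OF assms(1) c] and b = smooth_formsD(1)[OF assms(2) c]
  have "alt_form k (\<lambda>v. \<alpha> c x v + \<beta> c x v)"
  proof (rule alt_formI)
    show "\<alpha> c x v + \<beta> c x v = \<alpha> c x w + \<beta> c x w" if "\<And>i. i < k \<Longrightarrow> v i = w i" for v w
      using alt_form_cong[OF a that] alt_form_cong[OF b that] by simp
    show "linear (\<lambda>y. \<alpha> c x (v(i := y)) + \<beta> c x (v(i := y)))" if "i < k" for v i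
      by (rule linear_compose_add[OF alt_form_linear[OF a that] alt_form_linear[OF b that]])
    show "\<alpha> c x (\<lambda>l. v (\<tau> l)) + \<beta> c x (\<lambda>l. v (\<tau> l)) = of_int (sign \<tau>) * (\<alpha> c x v + \<beta> c x v)"
      if "\<tau> permutes {..<k}" for v \<tau>
      using alt_form_permute[OF a that] alt_form_permute[OF b that] by (simp add: distrib_left)
  qed
  then show "alt_form k ((\<alpha> + \<beta>) c x)" by (simp add: plus_fun_def)
next
  show "smooth_on (chart_image c) (\<lambda>x. (\<alpha> + \<beta>) c x v)" if "c \<in> A" for c v
    using smooth_on_add[OF open_chart_image[OF that] smooth_formsD(2)[OF assms(1) that] smooth_formsD(2)[OF assms(2) that]]
    by simp
  show "(\<alpha> + \<beta>) c x = pullback (frechet_derivative (transition c e) (at x)) ((\<alpha> + \<beta>) e (transition c e x))"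
    if "c \<in> A" "e \<in> A" "x \<in> overlap c e" for c e x
    using smooth_formsD(3)[OF assms(1) that] smooth_formsD(3)[OF assms(2) that]
    by (simp add: pullback_def fun_eq_iff)
  show "(\<alpha> + \<beta>) c x = 0" if "\<not> (c \<in> A \<and> x \<in> chart_image c)" for c x
    using smooth_formsD(4)[OF assms(1) that] smooth_formsD(4)[OF assms(2) that] by simp
qed

lemma scale_smooth_forms:
  assumes "\<alpha> \<in> smooth_forms A k"
  shows "(\<lambda>c x v. z * \<alpha> c x v) \<in> smooth_forms A k"
proof (rule smooth_formsI)
  fix c x assume c: "c \<in> A" "x \<in> chart_image c"
  note a = smooth_formsD(1)[OF assms(1) c]
  show "alt_form k (\<lambda>v. z * \<alpha> c x v)"
  proof (rule alt_formI)
    show "z * \<alpha> c x v = z * \<alpha> c x w" if "\<And>i. i < k \<Longrightarrow> v i = w i" for v w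
      using alt_form_cong[OF a that] by simp
    show "linear (\<lambda>y. z * \<alpha> c x (v(i := y)))" if "i < k" for v i
      by (rule linear_cmult[OF alt_form_linear[OF a that]])
    show "z * \<alpha> c x (\<lambda>l. v (\<tau> l)) = of_int (sign \<tau>) * (z * \<alpha> c x v)"
      if "\<tau> permutes {..<k}" for v \<tau>
      using alt_form_permute[OF a that] by simp
  qed
next
  show "smooth_on (chart_image c) (\<lambda>x. z * \<alpha> c x v)" if "c \<in> A" for c v
    by (rule smooth_on_mult[OF open_chart_image[OF that] smooth_on_const smooth_formsD(2)[OF assms(1) that]])
  show "(\<lambda>v. z * \<alpha> c x v) = pullback (frechet_derivative (transition c e) (at x)) (\<lambda>v. z * \<alpha> e (transition c e x) v)"
    if "c \<in> A" "e \<in> A" "x \<in> overlap c e" for c e x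
    using smooth_formsD(3)[OF assms(1) that] by (simp add: pullback_def)
  show "(\<lambda>v. z * \<alpha> c x v) = 0" if "\<not> (c \<in> A \<and> x \<in> chart_image c)" for c x
    using smooth_formsD(4)[OF assms(1) that] by (simp add: fun_eq_iff)
qed

lemma uminus_smooth_forms: "\<alpha> \<in> smooth_forms A k \<Longrightarrow> - \<alpha> \<in> smooth_forms A k"
  using scale_smooth_forms[of \<alpha> k "-1"] by (simp add: fun_Compl_def)

lemma zero_smooth_forms: "0 \<in> smooth_forms A k"
  by (rule smooth_formsI) (simp_all add: alt_form_def linear_zero pullback_def fun_eq_iff)

lemma ext_d_add:
  assumes "\<alpha> \<in> smooth_forms A k" "\<beta> \<in> smooth_forms A k"
  shows "ext_d A k (\<alpha> + \<beta>) = ext_d A k \<alpha> + ext_d A k \<beta>"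
proof (intro ext)
  fix c x v
  have "frechet_derivative (\<lambda>y. \<alpha> c y w + \<beta> c y w) (at x) h =
      frechet_derivative (\<lambda>y. \<alpha> c y w) (at x) h + frechet_derivative (\<lambda>y. \<beta> c y w) (at x) h"
    if "c \<in> A" "x \<in> chart_image c" for w h
    using frechet_derivative_eqI[OF has_derivative_add[OF has_derivative_frechet[OF differentiable_form[OF assms(1) that]]
        has_derivative_frechet[OF differentiable_form[OF assms(2) that]]]] by simp
  then show "ext_d A k (\<alpha> + \<beta>) c x v = (ext_d A k \<alpha> + ext_d A k \<beta>) c x v"
    by (simp add: ext_d_def ext_deriv_def distrib_left sum.distrib)
qed

lemma ext_d_scale:
  assumes "\<alpha> \<in> smooth_forms A k"
  shows "ext_d A k (\<lambda>c x v. z * \<alpha> c x v) = (\<lambda>c x v. z * ext_d A k \<alpha> c x v)"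
proof (intro ext)
  fix c x v
  have "frechet_derivative (\<lambda>y. z * \<alpha> c y w) (at x) h = z * frechet_derivative (\<lambda>y. \<alpha> c y w) (at x) h"
    if "c \<in> A" "x \<in> chart_image c" for w h
    using frechet_derivative_eqI[OF has_derivative_mult_right[OF has_derivative_frechet[OF differentiable_form[OF assms(1) that]]]]
    by simp
  then show "ext_d A k (\<lambda>c x v. z * \<alpha> c x v) c x v = z * ext_d A k \<alpha> c x v"
    by (simp add: ext_d_def ext_deriv_def sum_distrib_left mult.left_commute)
qed

lemma ext_d_uminus: "\<alpha> \<in> smooth_forms A k \<Longrightarrow> ext_d A k (- \<alpha>) = - ext_d A k \<alpha>"
  using ext_d_scale[of \<alpha> k "-1"] by (simp add: fun_Compl_def)

lemma ext_d_zero: "ext_d A k 0 = 0"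
  using ext_d_scale[OF zero_smooth_forms, of k 0] by (simp add: fun_eq_iff zero_fun_def)

text \<open>The substance is the compatibility between charts: \<open>ext_deriv_1_pullback\<close>
  applies because holomorphic transition maps are smooth.\<close>

lemma ext_d_1_smooth:
  assumes \<eta>: "\<eta> \<in> smooth_forms A 1"
  shows "ext_d A 1 \<eta> \<in> smooth_forms A 2"
proof (rule smooth_formsI)
  fix c x assume c: "c \<in> A" "x \<in> chart_image c"
  have "alt_form 2 (ext_deriv 1 (\<eta> c) x)"
    by (rule alt_form_ext_deriv_1[OF open_chart_image[OF c(1)] c(2) smooth_formsD(1)[OF \<eta> c(1)] differentiable_form[OF \<eta> c]])
  then show "alt_form 2 (ext_d A 1 \<eta> c x)" using c by (simp add: ext_d_def)
next
  fix c v assume c: "c \<in> A"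
  have "smooth_on (chart_image c) (\<lambda>x. ext_deriv 1 (\<eta> c) x v)"
    unfolding ext_deriv_def
    by (intro smooth_on_sum smooth_on_mult smooth_on_const smooth_on_frechet smooth_formsD(2)[OF \<eta> c] open_chart_image[OF c])
  then show "smooth_on (chart_image c) (\<lambda>x. ext_d A 1 \<eta> c x v)"
    by (rule smooth_on_cong[OF open_chart_image[OF c]]) (simp add: ext_d_def c)
next
  fix c e x assume c: "c \<in> A" "e \<in> A" "x \<in> overlap c e"
  note Tx = transition_in_chart_image[OF c(1,3)]
  have "ext_deriv 1 (\<eta> c) x = pullback (frechet_derivative (transition c e) (at x)) (ext_deriv 1 (\<eta> e) (transition c e x))"
  proof (rule ext_deriv_1_pullback[OF open_overlap[OF c(1,2)] c(3) open_chart_image[OF c(2)]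
      transition_in_chart_image[OF c(1)] smooth_transition[OF c(1,2)] smooth_formsD(1)[OF \<eta> c(2)]
      differentiable_form[OF \<eta> c(2) Tx] smooth_formsD(3)[OF \<eta> c(1,2)]])
    show "alt_form 1 (\<eta> c y)" if "y \<in> overlap c e" for y
      using that overlap_subset smooth_formsD(1)[OF \<eta> c(1)] by blast
  qed
  then show "ext_d A 1 \<eta> c x = pullback (frechet_derivative (transition c e) (at x)) (ext_d A 1 \<eta> e (transition c e x))"
    using c Tx subsetD[OF overlap_subset c(3)] by (simp add: ext_d_def)
qed (auto simp: ext_d_def)

lemma ext_d_ext_d_1:
  assumes \<eta>: "\<eta> \<in> smooth_forms A 1"
  shows "ext_d A 2 (ext_d A 1 \<eta>) = 0"
proof (intro ext)
  fix c x v
  have "ext_deriv 2 (ext_d A 1 \<eta> c) x v = 0" if c: "c \<in> A" "x \<in> chart_image c"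
    by (rule ext_deriv_2_ext_deriv_1[OF open_chart_image[OF c(1)] c(2) smooth_formsD(1)[OF \<eta> c(1)] smooth_formsD(2)[OF \<eta> c(1)]])
      (simp_all add: ext_d_def c)
  then show "ext_d A 2 (ext_d A 1 \<eta>) c x v = 0 c x v" by (simp add: ext_d_def)
qed

lemma ext_d_wedge_closed:
  assumes \<Omega>: "\<Omega> \<in> smooth_forms A p" and closed: "ext_d A p \<Omega> = 0" and "even p" and \<beta>: "\<beta> \<in> smooth_forms A q"
  shows "ext_d A (p + q) (wedge_form p q \<Omega> \<beta>) = wedge_form p (Suc q) \<Omega> (ext_d A q \<beta>)"
proof (intro ext)
  fix c x v
  show "ext_d A (p + q) (wedge_form p q \<Omega> \<beta>) c x v = wedge_form p (Suc q) \<Omega> (ext_d A q \<beta>) c x v"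
  proof (cases "c \<in> A \<and> x \<in> chart_image c")
    case False
    then show ?thesis using smooth_formsD(4)[OF \<Omega> False] by (auto simp: ext_d_def wedge_form_def)
  next
    case True
    then have c: "c \<in> A" "x \<in> chart_image c" by auto
    have z: "ext_deriv p (\<Omega> c) x = 0"
      using fun_cong[OF fun_cong[OF closed, of c], of x] c by (simp add: ext_d_def)
    have "ext_deriv (p + q) (\<lambda>y. wedge p q (\<Omega> c y) (\<beta> c y)) x v =
      wedge (Suc p) q (ext_deriv p (\<Omega> c) x) (\<beta> c x) v + (-1) ^ p * wedge p (Suc q) (\<Omega> c x) (ext_deriv q (\<beta> c) x) v"
      by (rule ext_deriv_wedge[OF open_chart_image[OF c(1)] c(2) smooth_formsD(1)[OF \<Omega> c(1)] differentiable_form[OF \<Omega> c]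
        smooth_formsD(1)[OF \<beta> c(1)] differentiable_form[OF \<beta> c]])
    then show ?thesis using c \<open>even p\<close> by (simp add: ext_d_def wedge_form_def[abs_def] z)
  qed
qed

lemma form_power_eq:
  "c \<in> A \<Longrightarrow> x \<in> chart_image c \<Longrightarrow> form_power A \<omega> p c x = wedge_power (\<omega> c x) p"
  by (induction p) (simp_all add: wedge_form_def)

lemma form_power_smooth:
  assumes \<omega>: "\<omega> \<in> smooth_forms A 2"
  shows "form_power A \<omega> p \<in> smooth_forms A (2 * p)"
proof (induction p)
  case 0
  show ?case
  proof (rule smooth_formsI)
    show "smooth_on (chart_image c) (\<lambda>x. form_power A \<omega> 0 c x v)" if "c \<in> A" for c v
      by (rule smooth_on_cong[OF open_chart_image[OF that] smooth_on_const[of _ 1]]) (simp add: that)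
    show "form_power A \<omega> 0 c x = pullback (frechet_derivative (transition c e) (at x)) (form_power A \<omega> 0 e (transition c e x))"
      if "c \<in> A" "e \<in> A" "x \<in> overlap c e" for c e x
      using that transition_in_chart_image[OF that(1,3)] subsetD[OF overlap_subset that(3)] by (simp add: pullback_def)
  qed (auto simp: alt_form_def)
next
  case (Suc p)
  then show ?case using wedge_form_smooth[OF \<omega> Suc] by simp
qed

section \<open>Exact forms and de Rham classes\<close>

lemma exact_formsI: "\<eta> \<in> smooth_forms A k \<Longrightarrow> ext_d A k \<eta> \<in> exact_forms A (Suc k)"
  by (simp add: exact_forms_def)

lemma zero_exact_forms: "0 \<in> exact_forms A k"
  by (cases k) (auto simp: exact_forms_def ext_d_zero intro!: image_eqI[of 0 _ 0] zero_smooth_forms)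

lemma uminus_exact_forms:
  assumes "\<alpha> \<in> exact_forms A k"
  shows "- \<alpha> \<in> exact_forms A k"
proof (cases k)
  case 0
  then show ?thesis using assms by (simp add: exact_forms_def)
next
  case (Suc m)
  then obtain \<eta> where "\<eta> \<in> smooth_forms A m" "\<alpha> = ext_d A m \<eta>" using assms by (auto simp: exact_forms_def)
  then show ?thesis using exact_formsI[OF uminus_smooth_forms] by (simp add: Suc ext_d_uminus)
qed

lemma add_exact_forms:
  assumes "\<alpha> \<in> exact_forms A k" "\<beta> \<in> exact_forms A k"
  shows "\<alpha> + \<beta> \<in> exact_forms A k"
proof (cases k)
  case 0
  then show ?thesis using assms by (simp add: exact_forms_def)
next
  case (Suc m)
  then obtain \<eta> \<zeta> where "\<eta> \<in> smooth_forms A m" "\<alpha> = ext_d A m \<eta>" "\<zeta> \<in> smooth_forms A m" "\<beta> = ext_d A m \<zeta>"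
    using assms by (auto simp: exact_forms_def)
  then show ?thesis using exact_formsI[OF add_smooth_forms] by (simp add: Suc ext_d_add)
qed

lemma de_Rham_class_zero:
  "de_Rham_class A k 0 = {\<gamma> \<in> closed_forms A k. \<gamma> \<in> exact_forms A k}"
proof -
  have "0 \<in> closed_forms A k" by (simp add: closed_forms_def zero_smooth_forms ext_d_zero)
  moreover have "- \<gamma> \<in> exact_forms A k \<longleftrightarrow> \<gamma> \<in> exact_forms A k" for \<gamma>
    using uminus_exact_forms[of \<gamma>] uminus_exact_forms[of "- \<gamma>"] by auto
  ultimately show ?thesis by (auto simp: de_Rham_class_def de_Rham_rel_def)
qed

lemma de_Rham_class_exact:
  assumes "\<alpha> \<in> closed_forms A k" "\<alpha> \<in> exact_forms A k"
  shows "de_Rham_class A k \<alpha> = de_Rham_class A k 0"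
proof -
  have "\<alpha> - \<gamma> \<in> exact_forms A k \<longleftrightarrow> \<gamma> \<in> exact_forms A k" for \<gamma>
  proof
    assume "\<alpha> - \<gamma> \<in> exact_forms A k"
    from add_exact_forms[OF assms(2) uminus_exact_forms[OF this]] show "\<gamma> \<in> exact_forms A k" by simp
  next
    assume "\<gamma> \<in> exact_forms A k"
    from add_exact_forms[OF assms(2) uminus_exact_forms[OF this]] show "\<alpha> - \<gamma> \<in> exact_forms A k" by simp
  qed
  then show ?thesis unfolding de_Rham_class_zero using assms(1) by (auto simp: de_Rham_class_def de_Rham_rel_def)
qed

lemma de_Rham_class_self: "\<alpha> \<in> closed_forms A k \<Longrightarrow> \<alpha> \<in> de_Rham_class A k \<alpha>"
  by (simp add: de_Rham_class_def de_Rham_rel_def zero_exact_forms)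

text \<open>The pointwise hypothesis has a double use: it makes the matrix invertible at each point,
  and it identifies the solution in one chart with the pullback of the solution in another.\<close>

lemma wedge_form_injective_inverse:
  assumes \<Omega>: "\<Omega> \<in> smooth_forms A (2 * (CARD('n) - 1))"
    and inj: "\<And>c x a v. c \<in> A \<Longrightarrow> x \<in> chart_image c \<Longrightarrow> alt_form 1 a \<Longrightarrow>
      (\<And>v. wedge (2 * (CARD('n) - 1)) 1 (\<Omega> c x) a v = 0) \<Longrightarrow> a v = 0"
    and \<zeta>: "\<zeta> \<in> smooth_forms A (2 * (CARD('n) - 1) + 1)"
  obtains \<eta> where "\<eta> \<in> smooth_forms A 1" "wedge_form (2 * (CARD('n) - 1)) 1 \<Omega> \<eta> = \<zeta>"
proof -
  let ?d = "2 * (CARD('n) - 1)"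
  define \<eta> where "\<eta> = (\<lambda>c x. if c \<in> A \<and> x \<in> chart_image c then lefschetz_inverse (\<Omega> c x) (\<zeta> c x) else 0)"
  have det: "det (lefschetz_matrix (\<Omega> c x)) \<noteq> 0" if "c \<in> A" "x \<in> chart_image c" for c x
    by (rule lefschetz_inverse(1)[OF smooth_formsD(1)[OF \<Omega> that]]) (rule inj[OF that])
  have sol: "wedge ?d 1 (\<Omega> c x) (\<eta> c x) = \<zeta> c x" if "c \<in> A" "x \<in> chart_image c" for c x
  proof -
    have "wedge ?d 1 (\<Omega> c x) (lefschetz_inverse (\<Omega> c x) (\<zeta> c x)) = \<zeta> c x"
      by (rule lefschetz_inverse(2)[OF smooth_formsD(1)[OF \<Omega> that] _ smooth_formsD(1)[OF \<zeta> that]]) (rule inj[OF that])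
    then show ?thesis using that by (simp add: \<eta>_def)
  qed
  have alt: "alt_form 1 (\<eta> c x)" if "c \<in> A" "x \<in> chart_image c" for c x
    unfolding \<eta>_def lefschetz_inverse_def using that alt_form_one_form by simp
  show ?thesis
  proof (rule that)
    show "\<eta> \<in> smooth_forms A 1"
    proof (rule smooth_formsI)
      fix c v assume c: "c \<in> A"
      note o = open_chart_image[OF c]
      have M: "smooth_on (chart_image c) (\<lambda>x. lefschetz_matrix (\<Omega> c x) $ i $ j)" for i j
        unfolding lefschetz_matrix_def
        using smooth_on_wedge[OF o smooth_formsD(2)[OF \<Omega> c] smooth_on_const] by simp
      have "smooth_on (chart_image c) (\<lambda>x. (\<chi> i j. if j = k then \<zeta> c x (omit_tuple i) else lefschetz_matrix (\<Omega> c x) $ i $ j) $ i $ j)" for i j k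
        using M smooth_formsD(2)[OF \<zeta> c] by (cases "j = k") simp_all
      \<comment> \<open>For fixed tuples both determinants are polynomials in smooth coefficients,
        and the denominator has no zero on the chart.\<close>
      then have "smooth_on (chart_image c) (\<lambda>x. lefschetz_inverse (\<Omega> c x) (\<zeta> c x) v)"
        unfolding lefschetz_inverse_def one_form_def vec_lambda_beta
        by (intro smooth_on_sum smooth_on_mult smooth_on_divide smooth_on_det smooth_on_const o M det[OF c]) simp
      then show "smooth_on (chart_image c) (\<lambda>x. \<eta> c x v)"
        by (rule smooth_on_cong[OF o]) (simp add: \<eta>_def c)
    next
      fix c e x assume c: "c \<in> A" "e \<in> A" "x \<in> overlap c e"
      let ?L = "frechet_derivative (transition c e) (at x)"
      have x: "x \<in> chart_image c" using c overlap_subset by blast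
      note y = transition_in_chart_image[OF c(1,3)]
      note L = linear_transition[OF c]
      have p1: "alt_form 1 (pullback ?L (\<eta> e (transition c e x)))"
        by (rule alt_form_pullback[OF L alt[OF c(2) y]])
      have "wedge ?d 1 (\<Omega> c x) (pullback ?L (\<eta> e (transition c e x))) = \<zeta> c x"
        using sol[OF c(2) y] smooth_formsD(3)[OF \<Omega> c] smooth_formsD(3)[OF \<zeta> c] pullback_wedge by metis
      then have z: "wedge ?d 1 (\<Omega> c x) (\<eta> c x + - pullback ?L (\<eta> e (transition c e x))) = 0"
        using sol[OF c(1) x] unfolding wedge_add_right wedge_minus_right by simp
      have "alt_form 1 (\<eta> c x + - pullback ?L (\<eta> e (transition c e x)))"
      proof (rule alt_formI)
        let ?a = "\<eta> c x" and ?b = "pullback ?L (\<eta> e (transition c e x))"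
        note a = alt[OF c(1) x]
        show "(?a + - ?b) v = (?a + - ?b) w" if "\<And>i. i < 1 \<Longrightarrow> v i = w i" for v w
          using alt_form_cong[OF a that] alt_form_cong[OF p1 that] by simp
        show "linear (\<lambda>x. (?a + - ?b) (v(i := x)))" if "i < 1" for v i
          using linear_compose_sub[OF alt_form_linear[OF a that] alt_form_linear[OF p1 that]] by simp
        show "(?a + - ?b) (\<lambda>l. v (\<tau> l)) = of_int (sign \<tau>) * (?a + - ?b) v" if "\<tau> permutes {..<1}" for v \<tau>
          using alt_form_permute[OF a that] alt_form_permute[OF p1 that] by (simp add: right_diff_distrib)
      qed
      then have "(\<eta> c x + - pullback ?L (\<eta> e (transition c e x))) v = 0" for v
        by (rule inj[OF c(1) x]) (simp only: z zero_fun_apply)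
      then show "\<eta> c x = pullback ?L (\<eta> e (transition c e x))" by (simp add: fun_eq_iff)
    qed (use alt in \<open>auto simp: \<eta>_def\<close>)
    show "wedge_form ?d 1 \<Omega> \<eta> = \<zeta>"
    proof (intro ext)
      fix c x v
      show "wedge_form ?d 1 \<Omega> \<eta> c x v = \<zeta> c x v"
      proof (cases "c \<in> A \<and> x \<in> chart_image c")
        case True
        then show ?thesis using sol by (simp add: wedge_form_def)
      next
        case False
        then show ?thesis using smooth_formsD(4)[OF \<Omega> False] smooth_formsD(4)[OF \<zeta> False] by (simp add: wedge_form_def)
      qed
    qed
  qed
qed

end

theorem lemma2p3:
  fixes X :: "'a topology"
    and A :: "('a, 'n::finite) chart set"
    and \<omega> :: "('a, 'n) dform"
    and \<cc> :: "('a, 'n) dform set"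
  assumes "complex_manifold X A"
    and "compact_space X"
    and "CARD('n) \<ge> 2"
    and "balanced_metric A \<omega>"
    and "\<cc> \<in> de_Rham A 2"
  shows "primitive_class A \<omega> \<cc> \<longleftrightarrow> (\<exists>\<alpha>\<in>\<cc>. primitive_form A \<omega> \<alpha>)"
proof -
  interpret complex_atlas X A by unfold_locales (rule assms(1))
  define m where "m = CARD('n) - 1"
  define d where "d = 2 * m"
  \<comment> \<open>Degrees are written with successors: d + 1 = 2n - 1 is the degree of the
    potential \<zeta>, and \<open>top\<close> lets \<open>exact_forms\<close> unfold in degree
    2n.\<close>
  have m: "m < CARD('n)" and top: "2 * CARD('n) = Suc (d + 1)"
    using assms(3) by (auto simp: m_def d_def)
  define \<Omega> where "\<Omega> = divided_power A \<omega> m"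
  have lef: "lefschetz A \<omega> \<beta> = wedge_form d 2 \<Omega> \<beta>" for \<beta>
    by (simp add: lefschetz_def \<Omega>_def d_def m_def)
  have \<omega>: "\<omega> \<in> smooth_forms A 2"
    and herm: "\<And>c x. c \<in> A \<Longrightarrow> x \<in> chart_image c \<Longrightarrow> \<exists>h. positive_definite_hermitian h \<and>
        \<omega> c x = (\<lambda>v. \<Sum>j\<in>UNIV. \<Sum>k\<in>UNIV. \<i> * h $ j $ k * wedge 1 1 (dz j) (dzbar k) v)"
    and bal: "ext_d A d (form_power A \<omega> m) = 0"
    using assms(4) unfolding balanced_metric_def hermitian_metric_def d_def m_def by blast+
  have \<Omega>_scale: "\<Omega> = (\<lambda>c x v. (1 / fact m) * form_power A \<omega> m c x v)"
    by (simp add: \<Omega>_def divided_power_def)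
  have power: "form_power A \<omega> m \<in> smooth_forms A d"
    unfolding d_def by (rule form_power_smooth[OF \<omega>])
  have \<Omega>: "\<Omega> \<in> smooth_forms A d"
    unfolding \<Omega>_scale by (rule scale_smooth_forms[OF power])
  have \<Omega>_closed: "ext_d A d \<Omega> = 0"
    unfolding \<Omega>_scale ext_d_scale[OF power] bal by (simp add: fun_eq_iff)
  have "even d" by (simp add: d_def)
  note leibniz = ext_d_wedge_closed[OF \<Omega> \<Omega>_closed this]
  \<comment> \<open>The factor 1 / (n - 1)! does not affect vanishing, so injectivity for the power
    of \<omega> carries over to \<Omega>.\<close>
  have inj: "a v = 0" if c: "c \<in> A" "x \<in> chart_image c" and a: "alt_form 1 a"
    and z: "\<And>v. wedge d 1 (\<Omega> c x) a v = 0" for c x a v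
  proof -
    obtain h where h: "positive_definite_hermitian h"
      "\<omega> c x = (\<lambda>v. \<Sum>j\<in>UNIV. \<Sum>k\<in>UNIV. \<i> * h $ j $ k * wedge 1 1 (dz j) (dzbar k) v)"
      using herm[OF c] by blast
    have "wedge (2 * m) 1 (wedge_power (\<omega> c x) m) a v = 0" for v
      using z[of v] unfolding \<Omega>_scale form_power_eq[OF c] wedge_scale_left d_def by simp
    then show ?thesis
      by (rule wedge_power_wedge_injective[OF smooth_formsD(1)[OF \<omega> c] a h m])
  qed
  obtain \<beta> where \<beta>: "\<beta> \<in> closed_forms A 2" "\<cc> = de_Rham_rel A 2 `` {\<beta>}"
    using assms(5) by (auto simp: de_Rham_def elim: quotientE)
  \<comment> \<open>\<open>memD\<close> and \<open>memI\<close> together describe the members of the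
    class as the forms \<open>\<beta> + ext_d A 1 \<eta>\<close> with \<eta> a smooth
    1-form.\<close>
  have memD: "\<alpha> \<in> closed_forms A 2 \<and> (\<exists>\<eta>\<in>smooth_forms A 1. \<alpha> = \<beta> + ext_d A 1 \<eta>)" if "\<alpha> \<in> \<cc>" for \<alpha>
  proof -
    have \<alpha>: "\<alpha> \<in> closed_forms A 2" "\<beta> - \<alpha> \<in> exact_forms A 2" using that by (auto simp: \<beta>(2) de_Rham_rel_def)
    have "\<alpha> - \<beta> \<in> ext_d A 1 ` smooth_forms A 1"
      using uminus_exact_forms[OF \<alpha>(2)] by (simp add: exact_forms_def numeral_2_eq_2)
    then obtain \<eta> where "\<eta> \<in> smooth_forms A 1" "\<alpha> - \<beta> = ext_d A 1 \<eta>" by auto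
    then show ?thesis using \<alpha>(1) by (metis add.commute diff_add_cancel)
  qed
  have memI: "\<beta> + ext_d A 1 \<eta> \<in> \<cc>" if \<eta>: "\<eta> \<in> smooth_forms A 1" for \<eta>
  proof -
    have b: "\<beta> \<in> smooth_forms A 2" "ext_d A 2 \<beta> = 0" using \<beta>(1) by (auto simp: closed_forms_def)
    have "\<beta> + ext_d A 1 \<eta> \<in> closed_forms A 2"
      unfolding closed_forms_def
      using add_smooth_forms[OF b(1) ext_d_1_smooth[OF \<eta>]] ext_d_add[OF b(1) ext_d_1_smooth[OF \<eta>]]
        ext_d_ext_d_1[OF \<eta>] b(2)
      by simp
    moreover have "- ext_d A 1 \<eta> \<in> exact_forms A 2"
      using uminus_exact_forms[OF exact_formsI[OF \<eta>]] by (simp add: numeral_2_eq_2)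
    ultimately show ?thesis using \<beta>(1) by (simp add: \<beta>(2) de_Rham_rel_def)
  qed
  have lef_closed: "lefschetz A \<omega> \<alpha> \<in> closed_forms A (2 * CARD('n))" if "\<alpha> \<in> closed_forms A 2" for \<alpha>
  proof -
    have a: "\<alpha> \<in> smooth_forms A 2" "ext_d A 2 \<alpha> = 0" using that by (auto simp: closed_forms_def)
    have z: "wedge_form d (Suc 2) \<Omega> 0 = 0"
      by (simp add: wedge_form_def wedge_def fun_eq_iff)
    have "d + 2 = 2 * CARD('n)" using top by simp
    then show ?thesis
      using wedge_form_smooth[OF \<Omega> a(1)] leibniz[OF a(1)] unfolding closed_forms_def lef a(2) z by simp
  qed
  have lef_add: "lefschetz A \<omega> (\<alpha> + ext_d A 1 \<eta>) = lefschetz A \<omega> \<alpha> + ext_d A (d + 1) (wedge_form d 1 \<Omega> \<eta>)"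
    if "\<eta> \<in> smooth_forms A 1" for \<alpha> \<eta>
    unfolding leibniz[OF that] lef by (simp add: wedge_form_def wedge_add_right fun_eq_iff numeral_2_eq_2)
  have \<beta>_mem: "\<beta> \<in> \<cc>" using \<beta> by (simp add: de_Rham_rel_def zero_exact_forms)
  show ?thesis
  proof
    assume "primitive_class A \<omega> \<cc>"
    \<comment> \<open>The image of \<beta> belongs to its own class, hence to the union that is
      assumed to be the class of 0.\<close>
    then have "lefschetz A \<omega> \<beta> \<in> de_Rham_class A (2 * CARD('n)) 0"
      using \<beta>_mem de_Rham_class_self[OF lef_closed[OF \<beta>(1)]]
      unfolding primitive_class_def lefschetz_class_def by blast
    then have "- lefschetz A \<omega> \<beta> \<in> exact_forms A (2 * CARD('n))"
      unfolding de_Rham_class_zero using uminus_exact_forms by blast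
    then obtain \<zeta> where \<zeta>: "\<zeta> \<in> smooth_forms A (d + 1)" "- lefschetz A \<omega> \<beta> = ext_d A (d + 1) \<zeta>"
      unfolding top exact_forms_def by auto
    obtain \<eta> where \<eta>: "\<eta> \<in> smooth_forms A 1" "wedge_form d 1 \<Omega> \<eta> = \<zeta>"
      using wedge_form_injective_inverse[of \<Omega> \<zeta>] \<Omega> inj \<zeta>(1) unfolding d_def m_def by blast
    have "lefschetz A \<omega> (\<beta> + ext_d A 1 \<eta>) = 0"
      unfolding lef_add[OF \<eta>(1)] \<eta>(2) \<zeta>(2)[symmetric] by simp
    moreover have "\<beta> + ext_d A 1 \<eta> \<in> smooth_forms A 2"
      using memD[OF memI[OF \<eta>(1)]] by (simp add: closed_forms_def)
    ultimately show "\<exists>\<alpha>\<in>\<cc>. primitive_form A \<omega> \<alpha>"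
      using memI[OF \<eta>(1)] unfolding primitive_form_def by blast
  next
    assume "\<exists>\<alpha>\<in>\<cc>. primitive_form A \<omega> \<alpha>"
    then obtain \<alpha> where \<alpha>: "\<alpha> \<in> \<cc>" "lefschetz A \<omega> \<alpha> = 0" unfolding primitive_form_def by blast
    have "wedge_form d 1 \<Omega> \<eta> \<in> smooth_forms A (d + 1)" if "\<eta> \<in> smooth_forms A 1" for \<eta>
      by (rule wedge_form_smooth[OF \<Omega> that])
    note ex = exact_formsI[OF this, folded top]
    have "lefschetz A \<omega> \<beta> \<in> exact_forms A (2 * CARD('n))"
    proof -
      obtain \<eta> where \<eta>: "\<eta> \<in> smooth_forms A 1" "\<alpha> = \<beta> + ext_d A 1 \<eta>" using memD[OF \<alpha>(1)] by blast
      have "lefschetz A \<omega> \<beta> = - ext_d A (d + 1) (wedge_form d 1 \<Omega> \<eta>)"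
        using \<alpha>(2) lef_add[OF \<eta>(1), of \<beta>] unfolding \<eta>(2) by (simp add: add_eq_0_iff2)
      then show ?thesis using uminus_exact_forms[OF ex[OF \<eta>(1)]] by simp
    qed
    \<comment> \<open>\<open>lefschetz_class\<close> is a union over all representatives, so
      exactness is carried from \<beta> to each of them; \<open>\<beta>_mem\<close> later excludes
      the empty union.\<close>
    then have "lefschetz A \<omega> \<gamma> \<in> exact_forms A (2 * CARD('n))" if "\<gamma> \<in> \<cc>" for \<gamma>
      using memD[OF that] add_exact_forms ex lef_add by metis
    then have "de_Rham_class A (2 * CARD('n)) (lefschetz A \<omega> \<gamma>) = de_Rham_class A (2 * CARD('n)) 0" if "\<gamma> \<in> \<cc>" for \<gamma>
      using that memD[OF that] lef_closed de_Rham_class_exact by blast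
    then have "lefschetz_class A \<omega> \<cc> = de_Rham_class A (2 * CARD('n)) 0"
      unfolding lefschetz_class_def using \<beta>_mem by auto
    then show "primitive_class A \<omega> \<cc>" unfolding primitive_class_def using assms(5) by simp
  qed
qed

end
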